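(* Let $X$ and $Y$ be doubly-degenerate $\mathbf{Bicat}_s$-categories. A weak map $F\colon X\to Y$ of doubly-degenerate $\mathbf{Bicat}_s$-categories is a functor $F$ on the underlying categories equipped with: - a vertical monoidality constraint: for all $a,b\in X$ an isomorphism $v_{ab}\colon \frac{Fa}{Fb}\to F\big(\frac{a}{b}\big)$, natural in $a$ and $b$; - a horizontal monoidality constraint: for all $a,b\in X$ an isomorphism $h_{ab}\colon Fa\,|\,Fb\to F(a\,|\,b)$, natural in $a$ and $b$; - a unit constraint: an isomorphism $\eta\colon 1\to F1$; satisfying the usual axioms for monoidal functors (that is, $(F,v,\eta)$ is a monoidal functor for the vertical monoidal structures and $(F,h,\eta)$ is a monoidal functor for the horizontal monoidal structures), together with the interaction axiom: for all $a,b,c,d\in X$, $$v_{a|b,\,c|d}\circ \frac{h_{ab}}{h_{cd}} \;=\; h_{\frac{a}{c},\frac{b}{d}}\circ\big(v_{ac}\,|\,v_{bd}\big)$$ as morphisms $\dfrac{Fa|Fb}{Fc|Fd}=\dfrac{Fa}{Fc}\Big|\dfrac{Fb}{Fd}\longrightarrow F\Big(\dfrac{a|b}{c|d}\Big)=F\Big(\dfrac{a}{c}\Big|\dfrac{b}{d}\Big)$.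
   Context: **Doubly-degenerate $\mathbf{Bicat}_s$-categories.** $\mathbf{Bicat}_s$ is the category of bicategories and strict functors, with cartesian monoidal structure. A $\mathbf{Bicat}_s$-category is a category enriched in it, and is doubly-degenerate if it has exactly one 0-cell and exactly one 1-cell. Unpacked, such an $X$ is a category (the underlying category, also denoted $X$) with: - a weak (vertical) monoidal structure with tensor $\frac{a}{b}$ and unit $1$; - a strict (horizontal) monoidal structure with tensor $a\,|\,b$ and the same unit $1$; such that $|\colon X\times X\to X$ and the unit $\mathbf 1\to X$ are strict monoidal functors for the vertical structure. In particular $\frac{a|b}{c|d}=\frac{a}{c}\big|\frac{b}{d}$ strictly. **Weak maps.** A weak map of doubly-degenerate $\mathbf{Bicat}_s$-categories is by definition a weak map of $HV$-algebras, where $H,V,HV$ are as follows. For a 2-category $K$, $K\text{-}\mathbf{Gph}$ is the 2-category of $K$-graphs. A $K$-graph is a set $X_0$ with hom-objects $X(a,b)\in K$. A 1-cell is a function on objects together with 1-cells $X(a,b)\to Y(Fa,Fb)$ of $K$. A 2-cell $F\Rightarrow G$ exists only if $F,G$ agree on objects, and is then a family of 2-cells of $K$ between hom-components. On $\mathbf{Cat}\text{-}\mathbf{Gph}\text{-}\mathbf{Gph}$ (this construction iterated twice from $\mathbf{Cat}$): - $V$ leaves objects unchanged and applies to each hom $\mathbf{Cat}$-graph the free bicategory 2-monad (the 2-monad on $\mathbf{Cat}\text{-}\mathbf{Gph}$ whose strict algebras and strict maps are bicategories and strict functors); - $H$ is the free strict $\mathbf{Cat}\text{-}\mathbf{Gph}$-enriched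 category 2-monad, $HA(a,a')=\coprod_{k\ge0,\ a=a_0,\dots,a_k=a'}A(a_{k-1},a_k)\times\cdots\times A(a_0,a_1)$. Strict interchange gives a distributive law $VH\Rightarrow HV$, making $HV$ a 2-monad whose strict algebras are $\mathbf{Bicat}_s$-categories. For a 2-monad $T$ and strict algebras $a\colon TA\to A$, $b\colon TB\to B$, a weak map is a 1-cell $f\colon A\to B$ with an invertible 2-cell $\rho\colon b\circ Tf\Rightarrow f\circ a$ satisfying $(\rho*Ta)\circ(b*T\rho)=\rho*\mu_A$ and $\rho*\eta_A=1_f$. *)

theory Defs
  imports "HOL-Library.FuncSet"
begin

section \<open>Categories, functors, natural transformations\<close>

text \<open>
  Functors and natural transformations are extensional (equal to \<^const>\<open>undefined\<close> off their domain), so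
  that equality of HOL functions is equality of functors and of natural transformations.
  Composition is written in applicative order: \<open>cmp C g f\<close> is \<open>g\<close> after \<open>f\<close>.
\<close>

record ('x, 'm) cat =
  obj :: "'x set"
  arr :: "'m set"
  src :: "'m \<Rightarrow> 'x"
  tgt :: "'m \<Rightarrow> 'x"
  ide :: "'x \<Rightarrow> 'm"
  cmp :: "'m \<Rightarrow> 'm \<Rightarrow> 'm"

definition hom :: "('x, 'm) cat \<Rightarrow> 'x \<Rightarrow> 'x \<Rightarrow> 'm set" where
  "hom C a b = {f \<in> arr C. src C f = a \<and> tgt C f = b}"

definition category :: "('x, 'm) cat \<Rightarrow> bool" where
  "category C \<longleftrightarrow>
     (\<forall>f\<in>arr C. src C f \<in> obj C \<and> tgt C f \<in> obj C) \<and>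
     (\<forall>a\<in>obj C. ide C a \<in> hom C a a) \<and>
     (\<forall>f\<in>arr C. \<forall>g\<in>arr C. tgt C f = src C g \<longrightarrow> cmp C g f \<in> hom C (src C f) (tgt C g)) \<and>
     (\<forall>f\<in>arr C. cmp C f (ide C (src C f)) = f \<and> cmp C (ide C (tgt C f)) f = f) \<and>
     (\<forall>f\<in>arr C. \<forall>g\<in>arr C. \<forall>h\<in>arr C. tgt C f = src C g \<and> tgt C g = src C h \<longrightarrow>
        cmp C h (cmp C g f) = cmp C (cmp C h g) f)"

definition inverse_arrows :: "('x, 'm) cat \<Rightarrow> 'm \<Rightarrow> 'm \<Rightarrow> bool" where
  "inverse_arrows C f g \<longleftrightarrow> f \<in> arr C \<and> g \<in> hom C (tgt C f) (src C f) \<and>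
     cmp C g f = ide C (src C f) \<and> cmp C f g = ide C (tgt C f)"

definition isos :: "('x, 'm) cat \<Rightarrow> 'x \<Rightarrow> 'x \<Rightarrow> 'm set" where
  "isos C a b = {f \<in> hom C a b. \<exists>g. inverse_arrows C f g}"

definition inv_arr :: "('x, 'm) cat \<Rightarrow> 'm \<Rightarrow> 'm" where
  "inv_arr C f = (THE g. inverse_arrows C f g)"

definition empty_cat :: "('x, 'm) cat" where
  "empty_cat = \<lparr>obj = {}, arr = {}, src = undefined, tgt = undefined,
                ide = undefined, cmp = undefined\<rparr>"

definition terminal_cat :: "(unit, unit) cat" where
  "terminal_cat = \<lparr>obj = {()}, arr = {()}, src = (\<lambda>_. ()), tgt = (\<lambda>_. ()),
                   ide = (\<lambda>_. ()), cmp = (\<lambda>_ _. ())\<rparr>"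

definition pair_cat :: "('x, 'm) cat \<Rightarrow> ('y, 'n) cat \<Rightarrow> ('x \<times> 'y, 'm \<times> 'n) cat" where
  "pair_cat C D = \<lparr>obj = obj C \<times> obj D, arr = arr C \<times> arr D,
     src = map_prod (src C) (src D), tgt = map_prod (tgt C) (tgt D),
     ide = map_prod (ide C) (ide D),
     cmp = (\<lambda>(g, g') (f, f'). (cmp C g f, cmp D g' f'))\<rparr>"

definition prod_cat :: "('x, 'm) cat list \<Rightarrow> ('x list, 'm list) cat" where
  "prod_cat Cs =
    (let ix = [0..<length Cs] in
     \<lparr>obj = {xs. list_all2 (\<lambda>C x. x \<in> obj C) Cs xs},
      arr = {fs. list_all2 (\<lambda>C f. f \<in> arr C) Cs fs},
      src = (\<lambda>fs. map (\<lambda>i. src (Cs ! i) (fs ! i)) ix),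
      tgt = (\<lambda>fs. map (\<lambda>i. tgt (Cs ! i) (fs ! i)) ix),
      ide = (\<lambda>xs. map (\<lambda>i. ide (Cs ! i) (xs ! i)) ix),
      cmp = (\<lambda>gs fs. map (\<lambda>i. cmp (Cs ! i) (gs ! i) (fs ! i)) ix)\<rparr>)"

record ('x, 'm, 'y, 'n) func =
  fob :: "'x \<Rightarrow> 'y"
  far :: "'m \<Rightarrow> 'n"

definition cat_functor :: "('x, 'm) cat \<Rightarrow> ('y, 'n) cat \<Rightarrow> ('x, 'm, 'y, 'n) func \<Rightarrow> bool" where
  "cat_functor C D F \<longleftrightarrow>
     fob F \<in> obj C \<rightarrow>\<^sub>E obj D \<and> far F \<in> arr C \<rightarrow>\<^sub>E arr D \<and>
     (\<forall>f\<in>arr C. src D (far F f) = fob F (src C f) \<and> tgt D (far F f) = fob F (tgt C f)) \<and>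
     (\<forall>a\<in>obj C. far F (ide C a) = ide D (fob F a)) \<and>
     (\<forall>f\<in>arr C. \<forall>g\<in>arr C. tgt C f = src C g \<longrightarrow>
        far F (cmp C g f) = cmp D (far F g) (far F f))"

definition functor_id :: "('x, 'm) cat \<Rightarrow> ('x, 'm, 'x, 'm) func" where
  "functor_id C = \<lparr>fob = (\<lambda>x\<in>obj C. x), far = (\<lambda>f\<in>arr C. f)\<rparr>"

definition functor_comp ::
  "('x, 'm) cat \<Rightarrow> ('y, 'n, 'z, 'k) func \<Rightarrow> ('x, 'm, 'y, 'n) func \<Rightarrow> ('x, 'm, 'z, 'k) func" where
  "functor_comp C G F = \<lparr>fob = (\<lambda>x\<in>obj C. fob G (fob F x)), far = (\<lambda>f\<in>arr C. far G (far F f))\<rparr>"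

definition nat_trans ::
  "('x, 'm) cat \<Rightarrow> ('y, 'n) cat \<Rightarrow> ('x, 'm, 'y, 'n) func \<Rightarrow> ('x, 'm, 'y, 'n) func \<Rightarrow> ('x \<Rightarrow> 'n) \<Rightarrow> bool"
where
  "nat_trans C D F G \<tau> \<longleftrightarrow>
     \<tau> \<in> extensional (obj C) \<and>
     (\<forall>x\<in>obj C. \<tau> x \<in> hom D (fob F x) (fob G x)) \<and>
     (\<forall>f\<in>arr C. cmp D (\<tau> (tgt C f)) (far F f) = cmp D (far G f) (\<tau> (src C f)))"

definition nat_id ::
  "('x, 'm) cat \<Rightarrow> ('y, 'n) cat \<Rightarrow> ('x, 'm, 'y, 'n) func \<Rightarrow> 'x \<Rightarrow> 'n" where
  "nat_id C D F = (\<lambda>x\<in>obj C. ide D (fob F x))"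

text \<open>
  The vertical composite of \<open>\<tau>: F \<Rightarrow> G\<close> and \<open>\<sigma>: G \<Rightarrow> K\<close>, and the whiskerings \<open>\<tau> * F\<close> and
  \<open>K * \<tau>\<close> (with \<open>\<tau>: F \<Rightarrow> G\<close>). The unused functor argument is there because the corresponding
  operations on graphs, which have the same shape, need it.
\<close>

definition nat_vcomp ::
  "('x, 'm) cat \<Rightarrow> ('y, 'n) cat \<Rightarrow> ('x, 'm, 'y, 'n) func \<Rightarrow> ('x \<Rightarrow> 'n) \<Rightarrow> ('x \<Rightarrow> 'n) \<Rightarrow> 'x \<Rightarrow> 'n"
where
  "nat_vcomp C D F \<sigma> \<tau> = (\<lambda>x\<in>obj C. cmp D (\<sigma> x) (\<tau> x))"

definition nat_whiskR ::
  "('x, 'm) cat \<Rightarrow> ('y \<Rightarrow> 'k) \<Rightarrow> ('x, 'm, 'y, 'n) func \<Rightarrow> 'x \<Rightarrow> 'k" where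
  "nat_whiskR C \<tau> F = (\<lambda>x\<in>obj C. \<tau> (fob F x))"

definition nat_whiskL ::
  "('x, 'm) cat \<Rightarrow> ('y, 'n, 'z, 'k) func \<Rightarrow> ('x, 'm, 'y, 'n) func \<Rightarrow> ('x \<Rightarrow> 'n) \<Rightarrow> 'x \<Rightarrow> 'k" where
  "nat_whiskL C K F \<tau> = (\<lambda>x\<in>obj C. far K (\<tau> x))"


section \<open>The 2-category of graphs over a 2-category\<close>

text \<open>
  The constructions below take the corresponding piece of structure of the 2-category \<open>K\<close> as their
  first argument. They are applied twice, starting from the 2-category of categories.
\<close>

record ('o, 'k) graph =
  verts :: "'o set"
  edge :: "'o \<Rightarrow> 'o \<Rightarrow> 'k"

record ('o, 'p, 'f) gmap =
  vmap :: "'o \<Rightarrow> 'p"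
  emap :: "'o \<times> 'o \<Rightarrow> 'f"

definition graph_1cell ::
  "('k \<Rightarrow> 'l \<Rightarrow> 'f \<Rightarrow> bool) \<Rightarrow> ('o, 'k) graph \<Rightarrow> ('p, 'l) graph \<Rightarrow> ('o, 'p, 'f) gmap \<Rightarrow> bool" where
  "graph_1cell is1 A B F \<longleftrightarrow>
     vmap F \<in> verts A \<rightarrow>\<^sub>E verts B \<and> emap F \<in> extensional (verts A \<times> verts A) \<and>
     (\<forall>a\<in>verts A. \<forall>b\<in>verts A. is1 (edge A a b) (edge B (vmap F a) (vmap F b)) (emap F (a, b)))"

definition graph_id :: "('k \<Rightarrow> 'f) \<Rightarrow> ('o, 'k) graph \<Rightarrow> ('o, 'o, 'f) gmap" where
  "graph_id id1 A =
     \<lparr>vmap = (\<lambda>a\<in>verts A. a), emap = (\<lambda>(a, b)\<in>verts A \<times> verts A. id1 (edge A a b))\<rparr>"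

definition graph_comp ::
  "('k \<Rightarrow> 'g \<Rightarrow> 'f \<Rightarrow> 'h) \<Rightarrow> ('o, 'k) graph \<Rightarrow> ('p, 'q, 'g) gmap \<Rightarrow> ('o, 'p, 'f) gmap \<Rightarrow> ('o, 'q, 'h) gmap"
where
  "graph_comp comp1 A G F =
     \<lparr>vmap = (\<lambda>a\<in>verts A. vmap G (vmap F a)),
      emap = (\<lambda>(a, b)\<in>verts A \<times> verts A.
                comp1 (edge A a b) (emap G (vmap F a, vmap F b)) (emap F (a, b)))\<rparr>"

definition graph_2cell ::
  "('k \<Rightarrow> 'l \<Rightarrow> 'f \<Rightarrow> 'f \<Rightarrow> 't \<Rightarrow> bool) \<Rightarrow> ('o, 'k) graph \<Rightarrow> ('p, 'l) graph \<Rightarrow>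
   ('o, 'p, 'f) gmap \<Rightarrow> ('o, 'p, 'f) gmap \<Rightarrow> ('o \<times> 'o \<Rightarrow> 't) \<Rightarrow> bool" where
  "graph_2cell is2 A B F G \<tau> \<longleftrightarrow>
     (\<forall>a\<in>verts A. vmap F a = vmap G a) \<and> \<tau> \<in> extensional (verts A \<times> verts A) \<and>
     (\<forall>a\<in>verts A. \<forall>b\<in>verts A.
        is2 (edge A a b) (edge B (vmap F a) (vmap F b)) (emap F (a, b)) (emap G (a, b)) (\<tau> (a, b)))"

definition graph_id2 ::
  "('k \<Rightarrow> 'l \<Rightarrow> 'f \<Rightarrow> 't) \<Rightarrow> ('o, 'k) graph \<Rightarrow> ('p, 'l) graph \<Rightarrow> ('o, 'p, 'f) gmap \<Rightarrow> 'o \<times> 'o \<Rightarrow> 't" where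
  "graph_id2 id2 A B F =
     (\<lambda>(a, b)\<in>verts A \<times> verts A. id2 (edge A a b) (edge B (vmap F a) (vmap F b)) (emap F (a, b)))"

definition graph_vcomp ::
  "('k \<Rightarrow> 'l \<Rightarrow> 'f \<Rightarrow> 't \<Rightarrow> 't \<Rightarrow> 't) \<Rightarrow> ('o, 'k) graph \<Rightarrow> ('p, 'l) graph \<Rightarrow> ('o, 'p, 'f) gmap \<Rightarrow>
   ('o \<times> 'o \<Rightarrow> 't) \<Rightarrow> ('o \<times> 'o \<Rightarrow> 't) \<Rightarrow> 'o \<times> 'o \<Rightarrow> 't" where
  "graph_vcomp vcomp A B F \<sigma> \<tau> =
     (\<lambda>(a, b)\<in>verts A \<times> verts A.
        vcomp (edge A a b) (edge B (vmap F a) (vmap F b)) (emap F (a, b)) (\<sigma> (a, b)) (\<tau> (a, b)))"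

definition graph_whiskR ::
  "('k \<Rightarrow> 't \<Rightarrow> 'f \<Rightarrow> 's) \<Rightarrow> ('o, 'k) graph \<Rightarrow> ('p \<times> 'p \<Rightarrow> 't) \<Rightarrow> ('o, 'p, 'f) gmap \<Rightarrow> 'o \<times> 'o \<Rightarrow> 's"
where
  "graph_whiskR whiskR A \<tau> F =
     (\<lambda>(a, b)\<in>verts A \<times> verts A. whiskR (edge A a b) (\<tau> (vmap F a, vmap F b)) (emap F (a, b)))"

definition graph_whiskL ::
  "('k \<Rightarrow> 'g \<Rightarrow> 'f \<Rightarrow> 't \<Rightarrow> 's) \<Rightarrow> ('o, 'k) graph \<Rightarrow> ('p, 'q, 'g) gmap \<Rightarrow> ('o, 'p, 'f) gmap \<Rightarrow>
   ('o \<times> 'o \<Rightarrow> 't) \<Rightarrow> 'o \<times> 'o \<Rightarrow> 's" where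
  "graph_whiskL whiskL A K F \<tau> =
     (\<lambda>(a, b)\<in>verts A \<times> verts A.
        whiskL (edge A a b) (emap K (vmap F a, vmap F b)) (emap F (a, b)) (\<tau> (a, b)))"

type_synonym ('p, 'x, 'm) cgraph = "('p, ('x, 'm) cat) graph"
type_synonym ('o, 'p, 'x, 'm) cggraph = "('o, ('p, 'x, 'm) cgraph) graph"
type_synonym ('p, 'x, 'm, 'q, 'y, 'n) cgmap = "('p, 'q, ('x, 'm, 'y, 'n) func) gmap"
type_synonym ('o, 'p, 'x, 'm, 'r, 'q, 'y, 'n) cggmap =
  "('o, 'r, ('p, 'x, 'm, 'q, 'y, 'n) cgmap) gmap"
type_synonym ('p, 'x, 'n) cg2cell = "'p \<times> 'p \<Rightarrow> 'x \<Rightarrow> 'n"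
type_synonym ('o, 'p, 'x, 'n) cgg2cell = "'o \<times> 'o \<Rightarrow> ('p, 'x, 'n) cg2cell"

abbreviation "cg_1cell \<equiv> graph_1cell cat_functor"
abbreviation "cg_id \<equiv> graph_id functor_id"
abbreviation "cg_comp \<equiv> graph_comp functor_comp"
abbreviation "cg_2cell \<equiv> graph_2cell nat_trans"
abbreviation "cg_id2 \<equiv> graph_id2 nat_id"
abbreviation "cg_vcomp \<equiv> graph_vcomp nat_vcomp"
abbreviation "cg_whiskR \<equiv> graph_whiskR nat_whiskR"
abbreviation "cg_whiskL \<equiv> graph_whiskL nat_whiskL"

abbreviation "cgg_1cell \<equiv> graph_1cell cg_1cell"
abbreviation "cgg_id \<equiv> graph_id cg_id"
abbreviation "cgg_comp \<equiv> graph_comp cg_comp"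
abbreviation "cgg_2cell \<equiv> graph_2cell cg_2cell"
abbreviation "cgg_id2 \<equiv> graph_id2 cg_id2"
abbreviation "cgg_vcomp \<equiv> graph_vcomp cg_vcomp"
abbreviation "cgg_whiskR \<equiv> graph_whiskR cg_whiskR"
abbreviation "cgg_whiskL \<equiv> graph_whiskL cg_whiskL"


section \<open>The free bicategory on a \<open>Cat\<close>-graph\<close>

text \<open>
  Formal 1-cells and formal 2-cells of the free bicategory on a \<open>Cat\<close>-graph \<open>G\<close>. Composition of
  1-cells is in diagrammatic order: \<open>Tens s t\<close> is \<open>s: p \<rightarrow> q\<close> followed by \<open>t: q \<rightarrow> r\<close>. The
  arrows of the hom-categories are formal 2-cells modulo the congruence generated by the bicategory
  axioms and by the relations holding in the hom-categories of \<open>G\<close>. Generators carry their endpoints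
  since distinct hom-categories of \<open>G\<close> may overlap as sets.
\<close>

datatype ('p, 'x) tm = Gen 'p 'p 'x | Unit 'p | Tens "('p, 'x) tm" "('p, 'x) tm"

datatype ('p, 'x, 'm) ctm =
    GenC 'p 'p 'm
  | IdeC "('p, 'x) tm"
  | CmpC "('p, 'x, 'm) ctm" "('p, 'x, 'm) ctm"
  | TensC "('p, 'x, 'm) ctm" "('p, 'x, 'm) ctm"
  | Assoc "('p, 'x) tm" "('p, 'x) tm" "('p, 'x) tm"
  | AssocI "('p, 'x) tm" "('p, 'x) tm" "('p, 'x) tm"
  | Lun "('p, 'x) tm"
  | LunI "('p, 'x) tm"
  | Run "('p, 'x) tm"
  | RunI "('p, 'x) tm"

inductive formal1 :: "('p, 'x, 'm) cgraph \<Rightarrow> 'p \<Rightarrow> 'p \<Rightarrow> ('p, 'x) tm \<Rightarrow> bool" for G where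
  gen: "\<lbrakk>p \<in> verts G; q \<in> verts G; x \<in> obj (edge G p q)\<rbrakk> \<Longrightarrow> formal1 G p q (Gen p q x)"
| unit: "p \<in> verts G \<Longrightarrow> formal1 G p p (Unit p)"
| tens: "\<lbrakk>formal1 G p q s; formal1 G q r t\<rbrakk> \<Longrightarrow> formal1 G p r (Tens s t)"

inductive formal2 ::
  "('p, 'x, 'm) cgraph \<Rightarrow> 'p \<Rightarrow> 'p \<Rightarrow> ('p, 'x) tm \<Rightarrow> ('p, 'x) tm \<Rightarrow> ('p, 'x, 'm) ctm \<Rightarrow> bool" for G where
  gen: "\<lbrakk>p \<in> verts G; q \<in> verts G; m \<in> hom (edge G p q) x y\<rbrakk>
         \<Longrightarrow> formal2 G p q (Gen p q x) (Gen p q y) (GenC p q m)"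
| ide: "formal1 G p q t \<Longrightarrow> formal2 G p q t t (IdeC t)"
| cmp: "\<lbrakk>formal2 G p q s t u; formal2 G p q t r v\<rbrakk> \<Longrightarrow> formal2 G p q s r (CmpC v u)"
| tens: "\<lbrakk>formal2 G p q s s' u; formal2 G q r t t' v\<rbrakk>
         \<Longrightarrow> formal2 G p r (Tens s t) (Tens s' t') (TensC u v)"
| assoc: "\<lbrakk>formal1 G p q s; formal1 G q r t; formal1 G r l w\<rbrakk>
         \<Longrightarrow> formal2 G p l (Tens (Tens s t) w) (Tens s (Tens t w)) (Assoc s t w)"
| associ: "\<lbrakk>formal1 G p q s; formal1 G q r t; formal1 G r l w\<rbrakk>
         \<Longrightarrow> formal2 G p l (Tens s (Tens t w)) (Tens (Tens s t) w) (AssocI s t w)"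
| lun: "formal1 G p q t \<Longrightarrow> formal2 G p q (Tens (Unit p) t) t (Lun t)"
| luni: "formal1 G p q t \<Longrightarrow> formal2 G p q t (Tens (Unit p) t) (LunI t)"
| run: "formal1 G p q t \<Longrightarrow> formal2 G p q (Tens t (Unit q)) t (Run t)"
| runi: "formal1 G p q t \<Longrightarrow> formal2 G p q t (Tens t (Unit q)) (RunI t)"

inductive formal_eq ::
  "('p, 'x, 'm) cgraph \<Rightarrow> 'p \<Rightarrow> 'p \<Rightarrow> ('p, 'x) tm \<Rightarrow> ('p, 'x) tm \<Rightarrow>
   ('p, 'x, 'm) ctm \<Rightarrow> ('p, 'x, 'm) ctm \<Rightarrow> bool" for G where
  refl: "formal2 G p q s t u \<Longrightarrow> formal_eq G p q s t u u"
| sym: "formal_eq G p q s t u v \<Longrightarrow> formal_eq G p q s t v u"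
| trans: "\<lbrakk>formal_eq G p q s t u v; formal_eq G p q s t v w\<rbrakk> \<Longrightarrow> formal_eq G p q s t u w"
| cong_cmp: "\<lbrakk>formal_eq G p q s t u u'; formal_eq G p q t r v v'\<rbrakk>
    \<Longrightarrow> formal_eq G p q s r (CmpC v u) (CmpC v' u')"
| cong_tens: "\<lbrakk>formal_eq G p q s s' u u'; formal_eq G q r t t' v v'\<rbrakk>
    \<Longrightarrow> formal_eq G p r (Tens s t) (Tens s' t') (TensC u v) (TensC u' v')"
| cmp_ide_left: "formal2 G p q s t u \<Longrightarrow> formal_eq G p q s t (CmpC (IdeC t) u) u"
| cmp_ide_right: "formal2 G p q s t u \<Longrightarrow> formal_eq G p q s t (CmpC u (IdeC s)) u"
| cmp_assoc: "\<lbrakk>formal2 G p q s t u; formal2 G p q t r v; formal2 G p q r l w\<rbrakk>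
    \<Longrightarrow> formal_eq G p q s l (CmpC w (CmpC v u)) (CmpC (CmpC w v) u)"
| gen_ide: "\<lbrakk>p \<in> verts G; q \<in> verts G; x \<in> obj (edge G p q)\<rbrakk>
    \<Longrightarrow> formal_eq G p q (Gen p q x) (Gen p q x) (GenC p q (ide (edge G p q) x)) (IdeC (Gen p q x))"
| gen_cmp: "\<lbrakk>p \<in> verts G; q \<in> verts G; m \<in> hom (edge G p q) x y; n \<in> hom (edge G p q) y z\<rbrakk>
    \<Longrightarrow> formal_eq G p q (Gen p q x) (Gen p q z)
          (GenC p q (cmp (edge G p q) n m)) (CmpC (GenC p q n) (GenC p q m))"
| tens_ide: "\<lbrakk>formal1 G p q s; formal1 G q r t\<rbrakk>
    \<Longrightarrow> formal_eq G p r (Tens s t) (Tens s t) (TensC (IdeC s) (IdeC t)) (IdeC (Tens s t))"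
| tens_cmp: "\<lbrakk>formal2 G p q s s' u; formal2 G p q s' s'' u';
              formal2 G q r t t' v; formal2 G q r t' t'' v'\<rbrakk>
    \<Longrightarrow> formal_eq G p r (Tens s t) (Tens s'' t'')
          (TensC (CmpC u' u) (CmpC v' v)) (CmpC (TensC u' v') (TensC u v))"
| assoc_nat: "\<lbrakk>formal2 G p q s s' u; formal2 G q r t t' v; formal2 G r l w w' z\<rbrakk>
    \<Longrightarrow> formal_eq G p l (Tens (Tens s t) w) (Tens s' (Tens t' w'))
          (CmpC (Assoc s' t' w') (TensC (TensC u v) z)) (CmpC (TensC u (TensC v z)) (Assoc s t w))"
| lun_nat: "formal2 G p q s t u
    \<Longrightarrow> formal_eq G p q (Tens (Unit p) s) t
          (CmpC (Lun t) (TensC (IdeC (Unit p)) u)) (CmpC u (Lun s))"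
| run_nat: "formal2 G p q s t u
    \<Longrightarrow> formal_eq G p q (Tens s (Unit q)) t
          (CmpC (Run t) (TensC u (IdeC (Unit q)))) (CmpC u (Run s))"
| assoc_inv_left: "\<lbrakk>formal1 G p q s; formal1 G q r t; formal1 G r l w\<rbrakk>
    \<Longrightarrow> formal_eq G p l (Tens (Tens s t) w) (Tens (Tens s t) w)
          (CmpC (AssocI s t w) (Assoc s t w)) (IdeC (Tens (Tens s t) w))"
| assoc_inv_right: "\<lbrakk>formal1 G p q s; formal1 G q r t; formal1 G r l w\<rbrakk>
    \<Longrightarrow> formal_eq G p l (Tens s (Tens t w)) (Tens s (Tens t w))
          (CmpC (Assoc s t w) (AssocI s t w)) (IdeC (Tens s (Tens t w)))"
| lun_inv_left: "formal1 G p q t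
    \<Longrightarrow> formal_eq G p q (Tens (Unit p) t) (Tens (Unit p) t)
          (CmpC (LunI t) (Lun t)) (IdeC (Tens (Unit p) t))"
| lun_inv_right: "formal1 G p q t \<Longrightarrow> formal_eq G p q t t (CmpC (Lun t) (LunI t)) (IdeC t)"
| run_inv_left: "formal1 G p q t
    \<Longrightarrow> formal_eq G p q (Tens t (Unit q)) (Tens t (Unit q))
          (CmpC (RunI t) (Run t)) (IdeC (Tens t (Unit q)))"
| run_inv_right: "formal1 G p q t \<Longrightarrow> formal_eq G p q t t (CmpC (Run t) (RunI t)) (IdeC t)"
| pentagon: "\<lbrakk>formal1 G p1 p2 s; formal1 G p2 p3 t; formal1 G p3 p4 w; formal1 G p4 p5 z\<rbrakk>
    \<Longrightarrow> formal_eq G p1 p5 (Tens (Tens (Tens s t) w) z) (Tens s (Tens t (Tens w z)))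
          (CmpC (TensC (IdeC s) (Assoc t w z))
                (CmpC (Assoc s (Tens t w) z) (TensC (Assoc s t w) (IdeC z))))
          (CmpC (Assoc s t (Tens w z)) (Assoc (Tens s t) w z))"
| triangle: "\<lbrakk>formal1 G p q s; formal1 G q r t\<rbrakk>
    \<Longrightarrow> formal_eq G p r (Tens (Tens s (Unit q)) t) (Tens s t)
          (CmpC (TensC (IdeC s) (Lun t)) (Assoc s (Unit q) t)) (TensC (Run s) (IdeC t))"

text \<open>
  An arrow of a hom-category of the free bicategory: source, target, and a class of formal 2-cells.
\<close>

type_synonym ('p, 'x, 'm) farr = "('p, 'x) tm \<times> ('p, 'x) tm \<times> ('p, 'x, 'm) ctm set"

definition fclass ::
  "('p, 'x, 'm) cgraph \<Rightarrow> 'p \<Rightarrow> 'p \<Rightarrow> ('p, 'x) tm \<Rightarrow> ('p, 'x) tm \<Rightarrow> ('p, 'x, 'm) ctm \<Rightarrow> ('p, 'x, 'm) farr"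
where
  "fclass G p q s t u = (s, t, {v. formal_eq G p q s t u v})"

definition free_hom ::
  "('p, 'x, 'm) cgraph \<Rightarrow> 'p \<Rightarrow> 'p \<Rightarrow> (('p, 'x) tm, ('p, 'x, 'm) farr) cat" where
  "free_hom G p q =
     \<lparr>obj = {t. formal1 G p q t},
      arr = {fclass G p q s t u |s t u. formal2 G p q s t u},
      src = (\<lambda>(s, t, U). s),
      tgt = (\<lambda>(s, t, U). t),
      ide = (\<lambda>t. fclass G p q t t (IdeC t)),
      cmp = (\<lambda>(s', t', V) (s, t, U).
               (s, t', {w. \<exists>v\<in>V. \<exists>u\<in>U. formal_eq G p q s t' (CmpC v u) w}))\<rparr>"

definition free_bicat :: "('p, 'x, 'm) cgraph \<Rightarrow> ('p, ('p, 'x) tm, ('p, 'x, 'm) farr) cgraph" where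
  "free_bicat G = \<lparr>verts = verts G, edge = free_hom G\<rparr>"

definition free_eta ::
  "('p, 'x, 'm) cgraph \<Rightarrow> ('p, 'x, 'm, 'p, ('p, 'x) tm, ('p, 'x, 'm) farr) cgmap" where
  "free_eta G =
     \<lparr>vmap = (\<lambda>p\<in>verts G. p),
      emap = (\<lambda>(p, q)\<in>verts G \<times> verts G.
        \<lparr>fob = (\<lambda>x\<in>obj (edge G p q). Gen p q x),
         far = (\<lambda>m\<in>arr (edge G p q).
           fclass G p q (Gen p q (src (edge G p q) m)) (Gen p q (tgt (edge G p q) m)) (GenC p q m))\<rparr>)\<rparr>"


subsection \<open>Bicategories as targets of evaluation\<close>

text \<open>
  \<open>bcomp0\<close>, \<open>bcomp1\<close> compose 1-cells and 2-cells (in diagrammatic order) along the listed 0-cells;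
  \<open>bassoc B p q r l x y z: (x y) z \<rightarrow> x (y z)\<close>, \<open>blun B p q x: 1 x \<rightarrow> x\<close>, \<open>brun B p q x: x 1 \<rightarrow> x\<close>.
\<close>

record ('p, 'x, 'm) bicat =
  bgraph :: "('p, 'x, 'm) cgraph"
  bunit :: "'p \<Rightarrow> 'x"
  bcomp0 :: "'p \<Rightarrow> 'p \<Rightarrow> 'p \<Rightarrow> 'x \<Rightarrow> 'x \<Rightarrow> 'x"
  bcomp1 :: "'p \<Rightarrow> 'p \<Rightarrow> 'p \<Rightarrow> 'm \<Rightarrow> 'm \<Rightarrow> 'm"
  bassoc :: "'p \<Rightarrow> 'p \<Rightarrow> 'p \<Rightarrow> 'p \<Rightarrow> 'x \<Rightarrow> 'x \<Rightarrow> 'x \<Rightarrow> 'm"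
  blun :: "'p \<Rightarrow> 'p \<Rightarrow> 'x \<Rightarrow> 'm"
  brun :: "'p \<Rightarrow> 'p \<Rightarrow> 'x \<Rightarrow> 'm"

definition free_struct :: "('p, 'x, 'm) cgraph \<Rightarrow> ('p, ('p, 'x) tm, ('p, 'x, 'm) farr) bicat" where
  "free_struct G =
     \<lparr>bgraph = free_bicat G,
      bunit = Unit,
      bcomp0 = (\<lambda>p q r. Tens),
      bcomp1 = (\<lambda>p q r (s, s', U) (t, t', V).
        (Tens s t, Tens s' t', {w. \<exists>u\<in>U. \<exists>v\<in>V. formal_eq G p r (Tens s t) (Tens s' t') (TensC u v) w})),
      bassoc = (\<lambda>p q r l s t w.
        fclass G p l (Tens (Tens s t) w) (Tens s (Tens t w)) (Assoc s t w)),
      blun = (\<lambda>p q t. fclass G p q (Tens (Unit p) t) t (Lun t)),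
      brun = (\<lambda>p q t. fclass G p q (Tens t (Unit q)) t (Run t))\<rparr>"

primrec t_src :: "('p, 'x) tm \<Rightarrow> 'p" where
  "t_src (Gen p q x) = p"
| "t_src (Unit p) = p"
| "t_src (Tens s t) = t_src s"

primrec t_tgt :: "('p, 'x) tm \<Rightarrow> 'p" where
  "t_tgt (Gen p q x) = q"
| "t_tgt (Unit p) = p"
| "t_tgt (Tens s t) = t_tgt t"

primrec c_src :: "('p, 'x, 'm) ctm \<Rightarrow> 'p" where
  "c_src (GenC p q m) = p"
| "c_src (IdeC t) = t_src t"
| "c_src (CmpC v u) = c_src u"
| "c_src (TensC u v) = c_src u"
| "c_src (Assoc s t w) = t_src s"
| "c_src (AssocI s t w) = t_src s"
| "c_src (Lun t) = t_src t"
| "c_src (LunI t) = t_src t"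
| "c_src (Run t) = t_src t"
| "c_src (RunI t) = t_src t"

primrec c_tgt :: "('p, 'x, 'm) ctm \<Rightarrow> 'p" where
  "c_tgt (GenC p q m) = q"
| "c_tgt (IdeC t) = t_tgt t"
| "c_tgt (CmpC v u) = c_tgt u"
| "c_tgt (TensC u v) = c_tgt v"
| "c_tgt (Assoc s t w) = t_tgt w"
| "c_tgt (AssocI s t w) = t_tgt w"
| "c_tgt (Lun t) = t_tgt t"
| "c_tgt (LunI t) = t_tgt t"
| "c_tgt (Run t) = t_tgt t"
| "c_tgt (RunI t) = t_tgt t"

text \<open>
  \<open>free_eval G B F\<close> is the strict functor from the free bicategory on \<open>G\<close> to the bicategory \<open>B\<close>
  extending the map of \<open>Cat\<close>-graphs \<open>F: G \<rightarrow> bgraph B\<close>.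
\<close>

primrec eval0 ::
  "('q, 'y, 'n) bicat \<Rightarrow> ('p, 'x, 'm, 'q, 'y, 'n) cgmap \<Rightarrow> ('p, 'x) tm \<Rightarrow> 'y" where
  "eval0 B F (Gen p q x) = fob (emap F (p, q)) x"
| "eval0 B F (Unit p) = bunit B (vmap F p)"
| "eval0 B F (Tens s t) =
     bcomp0 B (vmap F (t_src s)) (vmap F (t_tgt s)) (vmap F (t_tgt t)) (eval0 B F s) (eval0 B F t)"

primrec eval1 ::
  "('q, 'y, 'n) bicat \<Rightarrow> ('p, 'x, 'm, 'q, 'y, 'n) cgmap \<Rightarrow> ('p, 'x, 'm) ctm \<Rightarrow> 'n" where
  "eval1 B F (GenC p q m) = far (emap F (p, q)) m"
| "eval1 B F (IdeC t) =
     ide (edge (bgraph B) (vmap F (t_src t)) (vmap F (t_tgt t))) (eval0 B F t)"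
| "eval1 B F (CmpC v u) =
     cmp (edge (bgraph B) (vmap F (c_src u)) (vmap F (c_tgt u))) (eval1 B F v) (eval1 B F u)"
| "eval1 B F (TensC u v) =
     bcomp1 B (vmap F (c_src u)) (vmap F (c_tgt u)) (vmap F (c_tgt v)) (eval1 B F u) (eval1 B F v)"
| "eval1 B F (Assoc s t w) =
     bassoc B (vmap F (t_src s)) (vmap F (t_tgt s)) (vmap F (t_tgt t)) (vmap F (t_tgt w))
       (eval0 B F s) (eval0 B F t) (eval0 B F w)"
| "eval1 B F (AssocI s t w) =
     inv_arr (edge (bgraph B) (vmap F (t_src s)) (vmap F (t_tgt w)))
       (bassoc B (vmap F (t_src s)) (vmap F (t_tgt s)) (vmap F (t_tgt t)) (vmap F (t_tgt w))
         (eval0 B F s) (eval0 B F t) (eval0 B F w))"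
| "eval1 B F (Lun t) = blun B (vmap F (t_src t)) (vmap F (t_tgt t)) (eval0 B F t)"
| "eval1 B F (LunI t) =
     inv_arr (edge (bgraph B) (vmap F (t_src t)) (vmap F (t_tgt t)))
       (blun B (vmap F (t_src t)) (vmap F (t_tgt t)) (eval0 B F t))"
| "eval1 B F (Run t) = brun B (vmap F (t_src t)) (vmap F (t_tgt t)) (eval0 B F t)"
| "eval1 B F (RunI t) =
     inv_arr (edge (bgraph B) (vmap F (t_src t)) (vmap F (t_tgt t)))
       (brun B (vmap F (t_src t)) (vmap F (t_tgt t)) (eval0 B F t))"

definition free_eval ::
  "('p, 'x, 'm) cgraph \<Rightarrow> ('q, 'y, 'n) bicat \<Rightarrow> ('p, 'x, 'm, 'q, 'y, 'n) cgmap \<Rightarrow>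
   ('p, ('p, 'x) tm, ('p, 'x, 'm) farr, 'q, 'y, 'n) cgmap" where
  "free_eval G B F =
     \<lparr>vmap = (\<lambda>p\<in>verts G. vmap F p),
      emap = (\<lambda>(p, q)\<in>verts G \<times> verts G.
        \<lparr>fob = (\<lambda>t\<in>obj (free_hom G p q). eval0 B F t),
         far = (\<lambda>(s, t, U)\<in>arr (free_hom G p q). the_elem (eval1 B F ` U))\<rparr>)\<rparr>"

text \<open>Evaluation of a 2-cell \<open>\<tau>: F \<Rightarrow> F'\<close> of \<open>Cat\<close>-graph maps at a formal 1-cell.\<close>

primrec eval_2cell ::
  "('q, 'y, 'n) bicat \<Rightarrow> ('p, 'x, 'm, 'q, 'y, 'n) cgmap \<Rightarrow> ('p, 'x, 'n) cg2cell \<Rightarrow> ('p, 'x) tm \<Rightarrow> 'n"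
where
  "eval_2cell B F \<tau> (Gen p q x) = \<tau> (p, q) x"
| "eval_2cell B F \<tau> (Unit p) = ide (edge (bgraph B) (vmap F p) (vmap F p)) (bunit B (vmap F p))"
| "eval_2cell B F \<tau> (Tens s t) =
     bcomp1 B (vmap F (t_src s)) (vmap F (t_tgt s)) (vmap F (t_tgt t))
       (eval_2cell B F \<tau> s) (eval_2cell B F \<tau> t)"

definition free_map ::
  "('p, 'x, 'm) cgraph \<Rightarrow> ('q, 'y, 'n) cgraph \<Rightarrow> ('p, 'x, 'm, 'q, 'y, 'n) cgmap \<Rightarrow>
   ('p, ('p, 'x) tm, ('p, 'x, 'm) farr, 'q, ('q, 'y) tm, ('q, 'y, 'n) farr) cgmap" where
  "free_map G G' F = free_eval G (free_struct G') (cg_comp G (free_eta G') F)"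

definition free_map2 ::
  "('p, 'x, 'm) cgraph \<Rightarrow> ('q, 'y, 'n) cgraph \<Rightarrow> ('p, 'x, 'm, 'q, 'y, 'n) cgmap \<Rightarrow>
   ('p, 'x, 'n) cg2cell \<Rightarrow> ('p, ('p, 'x) tm, ('q, 'y, 'n) farr) cg2cell" where
  "free_map2 G G' F \<tau> =
     (\<lambda>(p, q)\<in>verts G \<times> verts G. \<lambda>t\<in>obj (free_hom G p q).
        eval_2cell (free_struct G') (cg_comp G (free_eta G') F) (cg_whiskL G (free_eta G') F \<tau>) t)"

definition free_mu ::
  "('p, 'x, 'm) cgraph \<Rightarrow>
   ('p, ('p, ('p, 'x) tm) tm, ('p, ('p, 'x) tm, ('p, 'x, 'm) farr) farr,
    'p, ('p, 'x) tm, ('p, 'x, 'm) farr) cgmap" where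
  "free_mu G = free_eval (free_bicat G) (free_struct G) (cg_id (free_bicat G))"


section \<open>The 2-monad \<open>V\<close>\<close>

definition V ::
  "('o, 'p, 'x, 'm) cggraph \<Rightarrow> ('o, 'p, ('p, 'x) tm, ('p, 'x, 'm) farr) cggraph" where
  "V A = \<lparr>verts = verts A, edge = (\<lambda>a b. free_bicat (edge A a b))\<rparr>"

definition V_map ::
  "('o, 'p, 'x, 'm) cggraph \<Rightarrow> ('r, 'q, 'y, 'n) cggraph \<Rightarrow> ('o, 'p, 'x, 'm, 'r, 'q, 'y, 'n) cggmap \<Rightarrow>
   ('o, 'p, ('p, 'x) tm, ('p, 'x, 'm) farr, 'r, 'q, ('q, 'y) tm, ('q, 'y, 'n) farr) cggmap" where
  "V_map A B F =
     \<lparr>vmap = (\<lambda>a\<in>verts A. vmap F a),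
      emap = (\<lambda>(a, b)\<in>verts A \<times> verts A.
        free_map (edge A a b) (edge B (vmap F a) (vmap F b)) (emap F (a, b)))\<rparr>"

definition V_map2 ::
  "('o, 'p, 'x, 'm) cggraph \<Rightarrow> ('r, 'q, 'y, 'n) cggraph \<Rightarrow> ('o, 'p, 'x, 'm, 'r, 'q, 'y, 'n) cggmap \<Rightarrow>
   ('o, 'p, 'x, 'n) cgg2cell \<Rightarrow> ('o, 'p, ('p, 'x) tm, ('q, 'y, 'n) farr) cgg2cell" where
  "V_map2 A B F \<tau> =
     (\<lambda>(a, b)\<in>verts A \<times> verts A.
        free_map2 (edge A a b) (edge B (vmap F a) (vmap F b)) (emap F (a, b)) (\<tau> (a, b)))"

definition V_eta ::
  "('o, 'p, 'x, 'm) cggraph \<Rightarrow>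
   ('o, 'p, 'x, 'm, 'o, 'p, ('p, 'x) tm, ('p, 'x, 'm) farr) cggmap" where
  "V_eta A =
     \<lparr>vmap = (\<lambda>a\<in>verts A. a), emap = (\<lambda>(a, b)\<in>verts A \<times> verts A. free_eta (edge A a b))\<rparr>"

definition V_mu ::
  "('o, 'p, 'x, 'm) cggraph \<Rightarrow>
   ('o, 'p, ('p, ('p, 'x) tm) tm, ('p, ('p, 'x) tm, ('p, 'x, 'm) farr) farr,
    'o, 'p, ('p, 'x) tm, ('p, 'x, 'm) farr) cggmap" where
  "V_mu A =
     \<lparr>vmap = (\<lambda>a\<in>verts A. a), emap = (\<lambda>(a, b)\<in>verts A \<times> verts A. free_mu (edge A a b))\<rparr>"


section \<open>The 2-monad \<open>H\<close>\<close>

text \<open>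
  The summand of \<open>HA(a, a')\<close> at \<open>a = a\<^sub>0, \<dots>, a\<^sub>k = a'\<close> is indexed by the list
  \<open>[a\<^sub>k, \<dots>, a\<^sub>0]\<close>; it is the product of the list of \<open>Cat\<close>-graphs \<open>legs\<close>, which is
  \<open>[A(a\<^sub>k\<^sub>-\<^sub>1, a\<^sub>k), \<dots>, A(a\<^sub>0, a\<^sub>1)]\<close>.
\<close>

definition prod_graph :: "('p, 'x, 'm) cgraph list \<Rightarrow> ('p list, 'x list, 'm list) cgraph" where
  "prod_graph Gs =
     \<lparr>verts = {ps. list_all2 (\<lambda>G p. p \<in> verts G) Gs ps},
      edge = (\<lambda>ps qs. prod_cat (map (\<lambda>i. edge (Gs ! i) (ps ! i) (qs ! i)) [0..<length Gs]))\<rparr>"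

definition coprod_graph :: "'i set \<Rightarrow> ('i \<Rightarrow> ('p, 'x, 'm) cgraph) \<Rightarrow> ('i \<times> 'p, 'x, 'm) cgraph" where
  "coprod_graph I G =
     \<lparr>verts = (SIGMA i:I. verts (G i)),
      edge = (\<lambda>(i, p) (j, q). if i = j then edge (G i) p q else empty_cat)\<rparr>"

definition paths :: "'o set \<Rightarrow> 'o \<Rightarrow> 'o \<Rightarrow> 'o list set" where
  "paths W a a' = {os. os \<noteq> [] \<and> set os \<subseteq> W \<and> hd os = a' \<and> last os = a}"

definition legs :: "('o \<Rightarrow> 'o \<Rightarrow> 'k) \<Rightarrow> 'o list \<Rightarrow> 'k list" where
  "legs E os = map (\<lambda>i. E (os ! Suc i) (os ! i)) [0..<length os - 1]"

definition H ::
  "('o, 'p, 'x, 'm) cggraph \<Rightarrow> ('o, 'o list \<times> 'p list, 'x list, 'm list) cggraph" where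
  "H A = \<lparr>verts = verts A,
          edge = (\<lambda>a a'. coprod_graph (paths (verts A) a a') (\<lambda>os. prod_graph (legs (edge A) os)))\<rparr>"

definition H_map ::
  "('o, 'p, 'x, 'm) cggraph \<Rightarrow> ('o, 'p, 'x, 'm, 'r, 'q, 'y, 'n) cggmap \<Rightarrow>
   ('o, 'o list \<times> 'p list, 'x list, 'm list, 'r, 'r list \<times> 'q list, 'y list, 'n list) cggmap" where
  "H_map A F =
     \<lparr>vmap = (\<lambda>a\<in>verts A. vmap F a),
      emap = (\<lambda>(a, a')\<in>verts A \<times> verts A.
        let Q = edge (H A) a a'; E = (\<lambda>os i. emap F (os ! Suc i, os ! i)) in
        \<lparr>vmap = (\<lambda>(os, ps)\<in>verts Q.
            (map (vmap F) os, map (\<lambda>i. vmap (E os i) (ps ! i)) [0..<length ps])),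
         emap = (\<lambda>((os, ps), (os', qs))\<in>verts Q \<times> verts Q.
            \<lparr>fob = (\<lambda>xs\<in>obj (edge Q (os, ps) (os', qs)).
                map (\<lambda>i. fob (emap (E os i) (ps ! i, qs ! i)) (xs ! i)) [0..<length xs]),
             far = (\<lambda>fs\<in>arr (edge Q (os, ps) (os', qs)).
                map (\<lambda>i. far (emap (E os i) (ps ! i, qs ! i)) (fs ! i)) [0..<length fs])\<rparr>)\<rparr>)\<rparr>"

definition H_map2 ::
  "('o, 'p, 'x, 'm) cggraph \<Rightarrow> ('o, 'p, 'x, 'n) cgg2cell \<Rightarrow>
   ('o, 'o list \<times> 'p list, 'x list, 'n list) cgg2cell" where
  "H_map2 A \<tau> =
     (\<lambda>(a, a')\<in>verts A \<times> verts A.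
        let Q = edge (H A) a a' in
        (\<lambda>((os, ps), (os', qs))\<in>verts Q \<times> verts Q. \<lambda>xs\<in>obj (edge Q (os, ps) (os', qs)).
           map (\<lambda>i. \<tau> (os ! Suc i, os ! i) (ps ! i, qs ! i) (xs ! i)) [0..<length xs]))"

definition H_eta ::
  "('o, 'p, 'x, 'm) cggraph \<Rightarrow>
   ('o, 'p, 'x, 'm, 'o, 'o list \<times> 'p list, 'x list, 'm list) cggmap" where
  "H_eta A =
     \<lparr>vmap = (\<lambda>a\<in>verts A. a),
      emap = (\<lambda>(a, a')\<in>verts A \<times> verts A.
        \<lparr>vmap = (\<lambda>p\<in>verts (edge A a a'). ([a', a], [p])),
         emap = (\<lambda>(p, q)\<in>verts (edge A a a') \<times> verts (edge A a a').
           \<lparr>fob = (\<lambda>x\<in>obj (edge (edge A a a') p q). [x]),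
            far = (\<lambda>m\<in>arr (edge (edge A a a') p q). [m])\<rparr>)\<rparr>)\<rparr>"

text \<open>
  Concatenation. Consecutive inner paths share an endpoint, hence the \<^const>\<open>butlast\<close>.
\<close>

definition H_mu ::
  "('o, 'p, 'x, 'm) cggraph \<Rightarrow>
   ('o, 'o list \<times> ('o list \<times> 'p list) list, 'x list list, 'm list list,
    'o, 'o list \<times> 'p list, 'x list, 'm list) cggmap" where
  "H_mu A =
     \<lparr>vmap = (\<lambda>a\<in>verts A. a),
      emap = (\<lambda>(a, a')\<in>verts A \<times> verts A.
        let Q = edge (H (H A)) a a' in
        \<lparr>vmap = (\<lambda>(os, qs)\<in>verts Q.
            (concat (map (butlast \<circ> fst) qs) @ [last os], concat (map snd qs))),
         emap = (\<lambda>(c, d)\<in>verts Q \<times> verts Q.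
           \<lparr>fob = (\<lambda>xs\<in>obj (edge Q c d). concat xs),
            far = (\<lambda>fs\<in>arr (edge Q c d). concat fs)\<rparr>)\<rparr>)\<rparr>"


section \<open>The distributive law and the 2-monad \<open>HV\<close>\<close>

text \<open>
  Products and coproducts of bicategories; 1-cells and 2-cells of a coproduct exist, hence are
  composed, within one summand only.
\<close>

definition prod_bicat :: "('p, 'x, 'm) bicat list \<Rightarrow> ('p list, 'x list, 'm list) bicat" where
  "prod_bicat Bs =
    (let ix = [0..<length Bs] in
     \<lparr>bgraph = prod_graph (map bgraph Bs),
      bunit = (\<lambda>ps. map (\<lambda>i. bunit (Bs ! i) (ps ! i)) ix),
      bcomp0 = (\<lambda>ps qs rs xs ys.
        map (\<lambda>i. bcomp0 (Bs ! i) (ps ! i) (qs ! i) (rs ! i) (xs ! i) (ys ! i)) ix),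
      bcomp1 = (\<lambda>ps qs rs fs gs.
        map (\<lambda>i. bcomp1 (Bs ! i) (ps ! i) (qs ! i) (rs ! i) (fs ! i) (gs ! i)) ix),
      bassoc = (\<lambda>ps qs rs ls xs ys zs.
        map (\<lambda>i. bassoc (Bs ! i) (ps ! i) (qs ! i) (rs ! i) (ls ! i) (xs ! i) (ys ! i) (zs ! i)) ix),
      blun = (\<lambda>ps qs xs. map (\<lambda>i. blun (Bs ! i) (ps ! i) (qs ! i) (xs ! i)) ix),
      brun = (\<lambda>ps qs xs. map (\<lambda>i. brun (Bs ! i) (ps ! i) (qs ! i) (xs ! i)) ix)\<rparr>)"

definition coprod_bicat :: "'i set \<Rightarrow> ('i \<Rightarrow> ('p, 'x, 'm) bicat) \<Rightarrow> ('i \<times> 'p, 'x, 'm) bicat" where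
  "coprod_bicat I B =
     \<lparr>bgraph = coprod_graph I (\<lambda>i. bgraph (B i)),
      bunit = (\<lambda>(i, p). bunit (B i) p),
      bcomp0 = (\<lambda>(i, p) (_, q) (_, r). bcomp0 (B i) p q r),
      bcomp1 = (\<lambda>(i, p) (_, q) (_, r). bcomp1 (B i) p q r),
      bassoc = (\<lambda>(i, p) (_, q) (_, r) (_, l). bassoc (B i) p q r l),
      blun = (\<lambda>(i, p) (_, q). blun (B i) p q),
      brun = (\<lambda>(i, p) (_, q). brun (B i) p q)\<rparr>"

text \<open>
  Each \<open>Cat\<close>-graph \<open>HVA(a, a')\<close> underlies a bicategory, with the operations of the free
  bicategories taken factorwise (strict interchange). The distributive law \<open>VHA \<rightarrow> HVA\<close> is, on each
  hom, the strict functor extending \<open>H\<close> of the unit of \<open>V\<close>.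
\<close>

definition HV_struct ::
  "('o, 'p, 'x, 'm) cggraph \<Rightarrow> 'o \<Rightarrow> 'o \<Rightarrow>
   ('o list \<times> 'p list, ('p, 'x) tm list, ('p, 'x, 'm) farr list) bicat" where
  "HV_struct A a a' =
     coprod_bicat (paths (verts A) a a')
       (\<lambda>os. prod_bicat (legs (\<lambda>b b'. free_struct (edge A b b')) os))"

definition dist ::
  "('o, 'p, 'x, 'm) cggraph \<Rightarrow>
   ('o, 'o list \<times> 'p list, ('o list \<times> 'p list, 'x list) tm, ('o list \<times> 'p list, 'x list, 'm list) farr,
    'o, 'o list \<times> 'p list, ('p, 'x) tm list, ('p, 'x, 'm) farr list) cggmap" where
  "dist A =
     \<lparr>vmap = (\<lambda>a\<in>verts A. a),
      emap = (\<lambda>(a, a')\<in>verts A \<times> verts A.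
        free_eval (edge (H A) a a') (HV_struct A a a') (emap (H_map A (V_eta A)) (a, a')))\<rparr>"

type_synonym ('o, 'p, 'x, 'm) hv =
  "('o, 'o list \<times> 'p list, ('p, 'x) tm list, ('p, 'x, 'm) farr list) cggraph"

definition HV :: "('o, 'p, 'x, 'm) cggraph \<Rightarrow> ('o, 'p, 'x, 'm) hv" where
  "HV A = H (V A)"

definition HV_map ::
  "('o, 'p, 'x, 'm) cggraph \<Rightarrow> ('r, 'q, 'y, 'n) cggraph \<Rightarrow> ('o, 'p, 'x, 'm, 'r, 'q, 'y, 'n) cggmap \<Rightarrow>
   ('o, 'o list \<times> 'p list, ('p, 'x) tm list, ('p, 'x, 'm) farr list,
    'r, 'r list \<times> 'q list, ('q, 'y) tm list, ('q, 'y, 'n) farr list) cggmap" where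
  "HV_map A B F = H_map (V A) (V_map A B F)"

definition HV_map2 ::
  "('o, 'p, 'x, 'm) cggraph \<Rightarrow> ('r, 'q, 'y, 'n) cggraph \<Rightarrow> ('o, 'p, 'x, 'm, 'r, 'q, 'y, 'n) cggmap \<Rightarrow>
   ('o, 'p, 'x, 'n) cgg2cell \<Rightarrow>
   ('o, 'o list \<times> 'p list, ('p, 'x) tm list, ('q, 'y, 'n) farr list) cgg2cell" where
  "HV_map2 A B F \<tau> = H_map2 (V A) (V_map2 A B F \<tau>)"

definition HV_eta ::
  "('o, 'p, 'x, 'm) cggraph \<Rightarrow>
   ('o, 'p, 'x, 'm,
    'o, 'o list \<times> 'p list, ('p, 'x) tm list, ('p, 'x, 'm) farr list) cggmap" where
  "HV_eta A = cgg_comp A (H_eta (V A)) (V_eta A)"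

text \<open>The composite \<open>HVHV \<rightarrow> HHVV \<rightarrow> HVV \<rightarrow> HV\<close>.\<close>

definition HV_mu where
  "HV_mu A =
     cgg_comp (HV (HV A)) (H_map (V (V A)) (V_mu A))
       (cgg_comp (HV (HV A)) (H_mu (V (V A))) (H_map (V (HV A)) (dist (V A))))"

text \<open>
  A weak map \<open>(f, \<rho>)\<close> from the strict algebra \<open>(A, \<alpha>)\<close> to the strict algebra \<open>(B, \<beta>)\<close>.
\<close>

definition HV_weak_map ::
  "('o, 'p, 'x, 'm) cggraph \<Rightarrow>
   ('o, 'o list \<times> 'p list, ('p, 'x) tm list, ('p, 'x, 'm) farr list, 'o, 'p, 'x, 'm) cggmap \<Rightarrow>
   ('r, 'q, 'y, 'n) cggraph \<Rightarrow>
   ('r, 'r list \<times> 'q list, ('q, 'y) tm list, ('q, 'y, 'n) farr list, 'r, 'q, 'y, 'n) cggmap \<Rightarrow>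
   ('o, 'p, 'x, 'm, 'r, 'q, 'y, 'n) cggmap \<Rightarrow>
   ('o, 'o list \<times> 'p list, ('p, 'x) tm list, 'n) cgg2cell \<Rightarrow> bool" where
  "HV_weak_map A \<alpha> B \<beta> f \<rho> \<longleftrightarrow>
     (let TA = HV A; TTA = HV (HV A);
          \<beta>Tf = cgg_comp TA \<beta> (HV_map A B f);
          f\<alpha> = cgg_comp TA f \<alpha>
      in
        cgg_1cell A B f \<and>
        cgg_2cell TA B \<beta>Tf f\<alpha> \<rho> \<and>
        (\<exists>\<sigma>. cgg_2cell TA B f\<alpha> \<beta>Tf \<sigma> \<and>
             cgg_vcomp TA B \<beta>Tf \<sigma> \<rho> = cgg_id2 TA B \<beta>Tf \<and>
             cgg_vcomp TA B f\<alpha> \<rho> \<sigma> = cgg_id2 TA B f\<alpha>) \<and>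
        cgg_vcomp TTA B (cgg_comp TTA \<beta> (HV_map TA B \<beta>Tf))
            (cgg_whiskR TTA \<rho> (HV_map TA A \<alpha>))
            (cgg_whiskL TTA \<beta> (HV_map TA B \<beta>Tf) (HV_map2 TA B \<beta>Tf \<rho>))
          = cgg_whiskR TTA \<rho> (HV_mu A) \<and>
        cgg_whiskR A \<rho> (HV_eta A) = cgg_id2 A B f)"


section \<open>Monoidal categories and monoidal functors\<close>

record ('x, 'm) moncat =
  mcat :: "('x, 'm) cat"
  munit :: 'x
  mten0 :: "'x \<Rightarrow> 'x \<Rightarrow> 'x"
  mten1 :: "'m \<Rightarrow> 'm \<Rightarrow> 'm"
  massoc :: "'x \<Rightarrow> 'x \<Rightarrow> 'x \<Rightarrow> 'm"
  mlun :: "'x \<Rightarrow> 'm"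
  mrun :: "'x \<Rightarrow> 'm"

definition tensor_functor ::
  "('x, 'm) cat \<Rightarrow> ('x \<Rightarrow> 'x \<Rightarrow> 'x) \<Rightarrow> ('m \<Rightarrow> 'm \<Rightarrow> 'm) \<Rightarrow> ('x \<times> 'x, 'm \<times> 'm, 'x, 'm) func" where
  "tensor_functor C t0 t1 =
     \<lparr>fob = (\<lambda>(a, b)\<in>obj C \<times> obj C. t0 a b), far = (\<lambda>(f, g)\<in>arr C \<times> arr C. t1 f g)\<rparr>"

definition monoidal_category :: "('x, 'm) moncat \<Rightarrow> bool" where
  "monoidal_category M \<longleftrightarrow>
    (let C = mcat M; I = munit M; t = mten0 M; tt = mten1 M; as = massoc M; l = mlun M; r = mrun M in
     category C \<and> I \<in> obj C \<and>
     cat_functor (pair_cat C C) C (tensor_functor C t tt) \<and>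
     (\<forall>a\<in>obj C. \<forall>b\<in>obj C. \<forall>c\<in>obj C. as a b c \<in> isos C (t (t a b) c) (t a (t b c))) \<and>
     (\<forall>a\<in>obj C. l a \<in> isos C (t I a) a) \<and>
     (\<forall>a\<in>obj C. r a \<in> isos C (t a I) a) \<and>
     (\<forall>f\<in>arr C. \<forall>g\<in>arr C. \<forall>h\<in>arr C.
        cmp C (as (tgt C f) (tgt C g) (tgt C h)) (tt (tt f g) h) =
        cmp C (tt f (tt g h)) (as (src C f) (src C g) (src C h))) \<and>
     (\<forall>f\<in>arr C. cmp C (l (tgt C f)) (tt (ide C I) f) = cmp C f (l (src C f))) \<and>
     (\<forall>f\<in>arr C. cmp C (r (tgt C f)) (tt f (ide C I)) = cmp C f (r (src C f))) \<and>
     (\<forall>a\<in>obj C. \<forall>b\<in>obj C. \<forall>c\<in>obj C. \<forall>d\<in>obj C.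
        cmp C (tt (ide C a) (as b c d)) (cmp C (as a (t b c) d) (tt (as a b c) (ide C d))) =
        cmp C (as a b (t c d)) (as (t a b) c d)) \<and>
     (\<forall>a\<in>obj C. \<forall>b\<in>obj C.
        cmp C (tt (ide C a) (l b)) (as a I b) = tt (r a) (ide C b)))"

definition monoidal_functor ::
  "('x, 'm) moncat \<Rightarrow> ('y, 'n) moncat \<Rightarrow> ('x, 'm, 'y, 'n) func \<Rightarrow> ('x \<times> 'x \<Rightarrow> 'n) \<Rightarrow> 'n \<Rightarrow> bool" where
  "monoidal_functor M N F \<phi> \<eta> \<longleftrightarrow>
    (let C = mcat M; D = mcat N; t = mten0 M; s = mten0 N; ss = mten1 N in
     cat_functor C D F \<and>
     \<phi> \<in> extensional (obj C \<times> obj C) \<and>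
     (\<forall>a\<in>obj C. \<forall>b\<in>obj C. \<phi> (a, b) \<in> isos D (s (fob F a) (fob F b)) (fob F (t a b))) \<and>
     \<eta> \<in> isos D (munit N) (fob F (munit M)) \<and>
     (\<forall>f\<in>arr C. \<forall>g\<in>arr C.
        cmp D (\<phi> (tgt C f, tgt C g)) (ss (far F f) (far F g)) =
        cmp D (far F (mten1 M f g)) (\<phi> (src C f, src C g))) \<and>
     (\<forall>a\<in>obj C. \<forall>b\<in>obj C. \<forall>c\<in>obj C.
        cmp D (far F (massoc M a b c)) (cmp D (\<phi> (t a b, c)) (ss (\<phi> (a, b)) (ide D (fob F c)))) =
        cmp D (\<phi> (a, t b c))
          (cmp D (ss (ide D (fob F a)) (\<phi> (b, c))) (massoc N (fob F a) (fob F b) (fob F c)))) \<and>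
     (\<forall>a\<in>obj C.
        cmp D (far F (mlun M a)) (cmp D (\<phi> (munit M, a)) (ss \<eta> (ide D (fob F a)))) =
        mlun N (fob F a)) \<and>
     (\<forall>a\<in>obj C.
        cmp D (far F (mrun M a)) (cmp D (\<phi> (a, munit M)) (ss (ide D (fob F a)) \<eta>)) =
        mrun N (fob F a)))"

definition strict_monoidal_functor ::
  "('x, 'm) moncat \<Rightarrow> ('y, 'n) moncat \<Rightarrow> ('x, 'm, 'y, 'n) func \<Rightarrow> bool" where
  "strict_monoidal_functor M N F \<longleftrightarrow>
     cat_functor (mcat M) (mcat N) F \<and>
     fob F (munit M) = munit N \<and>
     (\<forall>a\<in>obj (mcat M). \<forall>b\<in>obj (mcat M). fob F (mten0 M a b) = mten0 N (fob F a) (fob F b)) \<and>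
     (\<forall>f\<in>arr (mcat M). \<forall>g\<in>arr (mcat M). far F (mten1 M f g) = mten1 N (far F f) (far F g)) \<and>
     (\<forall>a\<in>obj (mcat M). \<forall>b\<in>obj (mcat M). \<forall>c\<in>obj (mcat M).
        far F (massoc M a b c) = massoc N (fob F a) (fob F b) (fob F c)) \<and>
     (\<forall>a\<in>obj (mcat M). far F (mlun M a) = mlun N (fob F a)) \<and>
     (\<forall>a\<in>obj (mcat M). far F (mrun M a) = mrun N (fob F a))"

definition pair_moncat :: "('x, 'm) moncat \<Rightarrow> ('y, 'n) moncat \<Rightarrow> ('x \<times> 'y, 'm \<times> 'n) moncat" where
  "pair_moncat M N =
     \<lparr>mcat = pair_cat (mcat M) (mcat N),
      munit = (munit M, munit N),
      mten0 = (\<lambda>(a, a') (b, b'). (mten0 M a b, mten0 N a' b')),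
      mten1 = (\<lambda>(f, f') (g, g'). (mten1 M f g, mten1 N f' g')),
      massoc = (\<lambda>(a, a') (b, b') (c, c'). (massoc M a b c, massoc N a' b' c')),
      mlun = map_prod (mlun M) (mlun N),
      mrun = map_prod (mrun M) (mrun N)\<rparr>"

definition terminal_moncat :: "(unit, unit) moncat" where
  "terminal_moncat =
     \<lparr>mcat = terminal_cat, munit = (), mten0 = (\<lambda>_ _. ()), mten1 = (\<lambda>_ _. ()),
      massoc = (\<lambda>_ _ _. ()), mlun = (\<lambda>_. ()), mrun = (\<lambda>_. ())\<rparr>"


section \<open>Doubly-degenerate \<open>Bicat\<^sub>s\<close>-categories\<close>

text \<open>
  \<open>vten0 X a b\<close> is the vertical tensor of \<open>a\<close> (top) and \<open>b\<close> (bottom), \<open>hten0 X a b\<close> is the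
  horizontal tensor \<open>a | b\<close>; \<open>vten1\<close> and \<open>hten1\<close> are their actions on arrows.
\<close>

record ('x, 'm) ddbicat =
  ucat :: "('x, 'm) cat"
  uunit :: 'x
  vten0 :: "'x \<Rightarrow> 'x \<Rightarrow> 'x"
  vten1 :: "'m \<Rightarrow> 'm \<Rightarrow> 'm"
  vassoc :: "'x \<Rightarrow> 'x \<Rightarrow> 'x \<Rightarrow> 'm"
  vlun :: "'x \<Rightarrow> 'm"
  vrun :: "'x \<Rightarrow> 'm"
  hten0 :: "'x \<Rightarrow> 'x \<Rightarrow> 'x"
  hten1 :: "'m \<Rightarrow> 'm \<Rightarrow> 'm"

definition vert :: "('x, 'm) ddbicat \<Rightarrow> ('x, 'm) moncat" where
  "vert X = \<lparr>mcat = ucat X, munit = uunit X, mten0 = vten0 X, mten1 = vten1 X,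
             massoc = vassoc X, mlun = vlun X, mrun = vrun X\<rparr>"

definition hor :: "('x, 'm) ddbicat \<Rightarrow> ('x, 'm) moncat" where
  "hor X = \<lparr>mcat = ucat X, munit = uunit X, mten0 = hten0 X, mten1 = hten1 X,
            massoc = (\<lambda>a b c. ide (ucat X) (hten0 X (hten0 X a b) c)),
            mlun = ide (ucat X), mrun = ide (ucat X)\<rparr>"

definition dd_bicats_category :: "('x, 'm) ddbicat \<Rightarrow> bool" where
  "dd_bicats_category X \<longleftrightarrow>
     monoidal_category (vert X) \<and>
     monoidal_category (hor X) \<and>
     (\<forall>a\<in>obj (ucat X). \<forall>b\<in>obj (ucat X). \<forall>c\<in>obj (ucat X).
        hten0 X (hten0 X a b) c = hten0 X a (hten0 X b c)) \<and>
     (\<forall>a\<in>obj (ucat X). hten0 X (uunit X) a = a \<and> hten0 X a (uunit X) = a) \<and>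
     strict_monoidal_functor (pair_moncat (vert X) (vert X)) (vert X)
       (tensor_functor (ucat X) (hten0 X) (hten1 X)) \<and>
     strict_monoidal_functor terminal_moncat (vert X)
       \<lparr>fob = (\<lambda>_. uunit X), far = (\<lambda>_. ide (ucat X) (uunit X))\<rparr>"


subsection \<open>The associated \<open>HV\<close>-algebra\<close>

text \<open>
  The \<open>Cat\<close>-graph-graph with a single 0-cell and a single 1-cell; its \<open>HV\<close>-algebra structure
  evaluates formal vertical composites in the vertical monoidal structure, and then a list of \<open>k\<close>
  objects in the horizontal one.
\<close>

definition one_graph :: "('x, 'm) cat \<Rightarrow> (unit, 'x, 'm) cgraph" where
  "one_graph C = \<lparr>verts = {()}, edge = (\<lambda>_ _. C)\<rparr>"

definition dd_graph :: "('x, 'm) ddbicat \<Rightarrow> (unit, unit, 'x, 'm) cggraph" where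
  "dd_graph X = \<lparr>verts = {()}, edge = (\<lambda>_ _. one_graph (ucat X))\<rparr>"

definition one_bicat :: "('x, 'm) moncat \<Rightarrow> (unit, 'x, 'm) bicat" where
  "one_bicat M =
     \<lparr>bgraph = one_graph (mcat M), bunit = (\<lambda>_. munit M),
      bcomp0 = (\<lambda>_ _ _. mten0 M), bcomp1 = (\<lambda>_ _ _. mten1 M),
      bassoc = (\<lambda>_ _ _ _. massoc M), blun = (\<lambda>_ _. mlun M), brun = (\<lambda>_ _. mrun M)\<rparr>"

definition dd_V_action ::
  "('x, 'm) ddbicat \<Rightarrow>
   (unit, unit, (unit, 'x) tm, (unit, 'x, 'm) farr, unit, unit, 'x, 'm) cggmap" where
  "dd_V_action X =
     \<lparr>vmap = (\<lambda>a\<in>{()}. a),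
      emap = (\<lambda>_\<in>{()} \<times> {()}.
        free_eval (one_graph (ucat X)) (one_bicat (vert X)) (cg_id (one_graph (ucat X))))\<rparr>"

definition dd_H_action ::
  "('x, 'm) ddbicat \<Rightarrow>
   (unit, unit list \<times> unit list, 'x list, 'm list, unit, unit, 'x, 'm) cggmap" where
  "dd_H_action X =
     \<lparr>vmap = (\<lambda>a\<in>{()}. a),
      emap = (\<lambda>(a, a')\<in>{()} \<times> {()}.
        let Q = edge (H (dd_graph X)) a a' in
        \<lparr>vmap = (\<lambda>_\<in>verts Q. ()),
         emap = (\<lambda>(c, d)\<in>verts Q \<times> verts Q.
           \<lparr>fob = (\<lambda>xs\<in>obj (edge Q c d). foldr (hten0 X) xs (uunit X)),
            far = (\<lambda>fs\<in>arr (edge Q c d). foldr (hten1 X) fs (ide (ucat X) (uunit X)))\<rparr>)\<rparr>)\<rparr>"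

definition dd_action ::
  "('x, 'm) ddbicat \<Rightarrow>
   (unit, unit list \<times> unit list, (unit, 'x) tm list, (unit, 'x, 'm) farr list,
    unit, unit, 'x, 'm) cggmap" where
  "dd_action X =
     cgg_comp (HV (dd_graph X)) (dd_H_action X) (H_map (V (dd_graph X)) (dd_V_action X))"


subsection \<open>Weak maps and their presentation by constraints\<close>

type_synonym ('x, 'm, 'y, 'n) dd_map =
  "(unit, unit, 'x, 'm, unit, unit, 'y, 'n) cggmap \<times>
   (unit, unit list \<times> unit list, (unit, 'x) tm list, 'n) cgg2cell"

definition dd_weak_maps ::
  "('x, 'm) ddbicat \<Rightarrow> ('y, 'n) ddbicat \<Rightarrow> ('x, 'm, 'y, 'n) dd_map set" where
  "dd_weak_maps X Y =
     {(f, \<rho>). HV_weak_map (dd_graph X) (dd_action X) (dd_graph Y) (dd_action Y) f \<rho>}"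

definition interaction ::
  "('x, 'm) ddbicat \<Rightarrow> ('y, 'n) ddbicat \<Rightarrow> ('x \<times> 'x \<Rightarrow> 'n) \<Rightarrow> ('x \<times> 'x \<Rightarrow> 'n) \<Rightarrow> bool" where
  "interaction X Y v h \<longleftrightarrow>
     (\<forall>a\<in>obj (ucat X). \<forall>b\<in>obj (ucat X). \<forall>c\<in>obj (ucat X). \<forall>d\<in>obj (ucat X).
        cmp (ucat Y) (v (hten0 X a b, hten0 X c d)) (vten1 Y (h (a, b)) (h (c, d))) =
        cmp (ucat Y) (h (vten0 X a c, vten0 X b d)) (hten1 Y (v (a, c)) (v (b, d))))"

definition dd_constraint_data ::
  "('x, 'm) ddbicat \<Rightarrow> ('y, 'n) ddbicat \<Rightarrow>
   (('x, 'm, 'y, 'n) func \<times> ('x \<times> 'x \<Rightarrow> 'n) \<times> ('x \<times> 'x \<Rightarrow> 'n) \<times> 'n) set" where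
  "dd_constraint_data X Y =
     {(F, v, h, \<eta>). monoidal_functor (vert X) (vert Y) F v \<eta> \<and>
        monoidal_functor (hor X) (hor Y) F h \<eta> \<and> interaction X Y v h}"

text \<open>
  \<open>component \<rho> ts\<close> is the component of \<open>\<rho>\<close> at the list \<open>ts\<close> of formal vertical composites. The
  constraints are the components at the formal vertical composite of \<open>a\<close> and \<open>b\<close>, at the formal
  horizontal composite of \<open>a\<close> and \<open>b\<close>, and at the empty horizontal composite.
\<close>

definition component ::
  "(unit, unit list \<times> unit list, (unit, 'x) tm list, 'n) cgg2cell \<Rightarrow> (unit, 'x) tm list \<Rightarrow> 'n" where
  "component \<rho> ts =
     (let c = (replicate (Suc (length ts)) (), replicate (length ts) ()) in \<rho> ((), ()) (c, c) ts)"

definition dd_constraints ::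
  "('x, 'm) ddbicat \<Rightarrow> ('x, 'm, 'y, 'n) dd_map \<Rightarrow>
   ('x, 'm, 'y, 'n) func \<times> ('x \<times> 'x \<Rightarrow> 'n) \<times> ('x \<times> 'x \<Rightarrow> 'n) \<times> 'n" where
  "dd_constraints X = (\<lambda>(f, \<rho>).
     (emap (emap f ((), ())) ((), ()),
      (\<lambda>(a, b)\<in>obj (ucat X) \<times> obj (ucat X). component \<rho> [Tens (Gen () () a) (Gen () () b)]),
      (\<lambda>(a, b)\<in>obj (ucat X) \<times> obj (ucat X). component \<rho> [Gen () () a, Gen () () b]),
      component \<rho> []))"

end

theory Submission
  imports Defs
begin

text \<open>
  An object of \<open>HV X\<close> is a list of formal vertical composites, so a weak map is a functor \<open>F\<close> together
  with an isomorphism \<open>\<rho>(ts)\<close> for each such list \<open>ts\<close>. The multiplication axiom determines them all: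
  \<open>\<rho>[s/t] = v \<cdot> (\<rho>[s] / \<rho>[t])\<close> and \<open>\<rho>(ts @ us) = h \<cdot> (\<rho>(ts) | \<rho>(us))\<close>, where \<open>v\<close> and \<open>h\<close> are
  the values of \<open>\<rho>\<close> at the composites of two generators, while the value at a formal unit is the
  value at the empty list. Naturality at the structural 2-cells gives the axioms of the vertical
  monoidal functor; splitting a list in two ways gives those of the horizontal one; and the vertical
  composite of two rows of length two can be evaluated rows first or columns first, which is the
  interaction axiom. Conversely, constraints define \<open>\<rho>\<close> by recursion. The multiplication axiom then
  reduces to \<open>\<rho>(s\<^sub>1/t\<^sub>1, \<dots>, s\<^sub>k/t\<^sub>k) = v \<cdot> (\<rho>(s\<^sub>1, \<dots>, s\<^sub>k) / \<rho>(t\<^sub>1, \<dots>, t\<^sub>k))\<close>, by induction on \<open>k\<close>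
  from the interaction axiom; the case \<open>k = 0\<close> uses that \<open>1/1 = 1\<close> strictly.
\<close>

section \<open>Inverses, isomorphisms and functors in hom-set form\<close>

section \<open>Categories\<close>

text \<open>Constraints are far from the definition of a weak map: arrows of the free bicategory are
  classes of formal 2-cells, and cells of HV X lie under a coproduct, products and lists. The proof
  passes through \<open>weak_family\<close>, and two facts make this reduction possible. With one
  0-cell and one 1-cell, the vertices of HV X are lists over a one-element type, so only their
  length counts, and hom-categories between different lengths are empty. A formal vertical composite
  of rows is therefore a rectangular grid. Moreover an equation of 2-cells is an equation of
  components at objects, so the multiplication axiom is indexed by lists of grids, while arrows
  enter through naturality alone. What has to be earned is that evaluation respects classes: every
  relation generating \<open>formal_eq\<close> must hold in the target, which is where the axioms of
  the vertical monoidal category are used. Since all functions in sight are extensional, a family of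
  components determines its 2-cell on the nose, and the correspondence is a bijection of sets rather
  than one up to equivalence.\<close>

lemma homD: "f \<in> hom C a b \<Longrightarrow> f \<in> arr C" "f \<in> hom C a b \<Longrightarrow> src C f = a"
  "f \<in> hom C a b \<Longrightarrow> tgt C f = b"
  by (auto simp: hom_def)

locale categ =
  fixes C :: "('x, 'm) cat"
  assumes category: "category C"
begin

lemma hom_obj: "f \<in> hom C a b \<Longrightarrow> a \<in> obj C" "f \<in> hom C a b \<Longrightarrow> b \<in> obj C"
  using category by (auto simp: category_def hom_def)

lemma arr_hom: "f \<in> arr C \<Longrightarrow> f \<in> hom C (src C f) (tgt C f)"
  by (simp add: hom_def)

lemma ide_hom [intro]: "a \<in> obj C \<Longrightarrow> ide C a \<in> hom C a a"
  using category by (simp add: category_def)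

lemma cmp_hom [intro]: "g \<in> hom C b c \<Longrightarrow> f \<in> hom C a b \<Longrightarrow> cmp C g f \<in> hom C a c"
  using category unfolding category_def by (metis homD)

lemma ide_left: "f \<in> hom C a b \<Longrightarrow> cmp C (ide C b) f = f"
  using category unfolding category_def by (metis homD)

lemma ide_right: "f \<in> hom C a b \<Longrightarrow> cmp C f (ide C a) = f"
  using category unfolding category_def by (metis homD)

lemma cmp_simps:
  assumes "f \<in> arr C" "g \<in> arr C" "tgt C f = src C g"
  shows "cmp C g f \<in> arr C" "src C (cmp C g f) = src C f" "tgt C (cmp C g f) = tgt C g"
  using assms category unfolding category_def by (simp_all add: hom_def)

lemma ide_simps:
  assumes "a \<in> obj C"
  shows "ide C a \<in> arr C" "src C (ide C a) = a" "tgt C (ide C a) = a"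
  using assms category unfolding category_def by (simp_all add: hom_def)

lemma cmp_ide_simps:
  "f \<in> arr C \<Longrightarrow> tgt C f = a \<Longrightarrow> cmp C (ide C a) f = f"
  "f \<in> arr C \<Longrightarrow> src C f = a \<Longrightarrow> cmp C f (ide C a) = f"
  using category unfolding category_def by metis+

lemma arr_obj: "f \<in> arr C \<Longrightarrow> src C f \<in> obj C" "f \<in> arr C \<Longrightarrow> tgt C f \<in> obj C"
  using category unfolding category_def by simp_all

lemma assoc:
  "f \<in> arr C \<Longrightarrow> g \<in> arr C \<Longrightarrow> h \<in> arr C \<Longrightarrow> tgt C f = src C g \<Longrightarrow> tgt C g = src C h \<Longrightarrow>
    cmp C (cmp C h g) f = cmp C h (cmp C g f)"
  using category unfolding category_def by metis

lemma assoc_hom: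
  "h \<in> hom C c d \<Longrightarrow> g \<in> hom C b c \<Longrightarrow> f \<in> hom C a b \<Longrightarrow>
    cmp C (cmp C h g) f = cmp C h (cmp C g f)"
  by (simp add: hom_def assoc)

lemmas cat_simps = cmp_simps ide_simps cmp_ide_simps arr_obj assoc

lemma inverse_arrows_iff:
  "f \<in> hom C a b \<Longrightarrow> inverse_arrows C f g \<longleftrightarrow>
     g \<in> hom C b a \<and> cmp C g f = ide C a \<and> cmp C f g = ide C b"
  by (auto simp: inverse_arrows_def homD)

text \<open>Since \<open>inv_arr\<close> is a definite description, it is computed through
  uniqueness of two-sided inverses.\<close>

lemma inv_arr_eqI:
  assumes "f \<in> hom C a b" "g \<in> hom C b a" "cmp C g f = ide C a" "cmp C f g = ide C b"
  shows "inv_arr C f = g"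
  unfolding inv_arr_def
proof (rule the_equality)
  show "inverse_arrows C f g"
    using assms by (simp add: inverse_arrows_iff)
  fix h assume "inverse_arrows C f h"
  then have h: "h \<in> hom C b a" "cmp C h f = ide C a" "cmp C f h = ide C b"
    using assms(1) by (simp_all add: inverse_arrows_iff)
  have "h = cmp C h (cmp C f g)" using h(1) assms(4) by (simp add: ide_right)
  also have "\<dots> = cmp C (cmp C h f) g" using h(1) assms(1,2) by (simp add: hom_def assoc)
  also have "\<dots> = g" using h assms by (simp add: ide_left)
  finally show "h = g" .
qed

lemma isosI:
  "f \<in> hom C a b \<Longrightarrow> g \<in> hom C b a \<Longrightarrow> cmp C g f = ide C a \<Longrightarrow> cmp C f g = ide C b \<Longrightarrow>
    f \<in> isos C a b"
  by (auto simp: isos_def inverse_arrows_iff)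

lemma isos_hom: "f \<in> isos C a b \<Longrightarrow> f \<in> hom C a b"
  by (simp add: isos_def)

lemma
  assumes "f \<in> isos C a b"
  shows inv_hom: "inv_arr C f \<in> hom C b a"
    and inv_left: "cmp C (inv_arr C f) f = ide C a"
    and inv_right: "cmp C f (inv_arr C f) = ide C b"
proof -
  obtain g where g: "g \<in> hom C b a" "cmp C g f = ide C a" "cmp C f g = ide C b"
    using assms isos_hom[OF assms] by (auto simp: isos_def inverse_arrows_iff)
  moreover have "inv_arr C f = g"
    by (rule inv_arr_eqI[OF isos_hom[OF assms] g])
  ultimately show "inv_arr C f \<in> hom C b a" "cmp C (inv_arr C f) f = ide C a"
    "cmp C f (inv_arr C f) = ide C b" by simp_all
qed

lemma ide_isos: "a \<in> obj C \<Longrightarrow> ide C a \<in> isos C a a"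
  by (rule isosI[of _ _ _ "ide C a"]) (auto simp: ide_left[OF ide_hom])

lemma cmp_isos:
  assumes g: "g \<in> isos C b c" and f: "f \<in> isos C a b"
  shows "cmp C g f \<in> isos C a c"
proof (rule isosI)
  note h = isos_hom[OF f] isos_hom[OF g] inv_hom[OF f] inv_hom[OF g]
  show "cmp C g f \<in> hom C a c" "cmp C (inv_arr C f) (inv_arr C g) \<in> hom C c a"
    using h by auto
  have "cmp C (cmp C (inv_arr C f) (inv_arr C g)) (cmp C g f)
      = cmp C (inv_arr C f) (cmp C (cmp C (inv_arr C g) g) f)"
    using h by (simp add: hom_def cat_simps)
  also have "\<dots> = ide C a"
    using h inv_left[OF f] inv_left[OF g] by (simp add: ide_left)
  finally show "cmp C (cmp C (inv_arr C f) (inv_arr C g)) (cmp C g f) = ide C a" .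
  have "cmp C (cmp C g f) (cmp C (inv_arr C f) (inv_arr C g))
      = cmp C g (cmp C (cmp C f (inv_arr C f)) (inv_arr C g))"
    using h by (simp add: hom_def cat_simps)
  also have "\<dots> = ide C c"
    using h inv_right[OF f] inv_right[OF g] by (simp add: ide_left)
  finally show "cmp C (cmp C g f) (cmp C (inv_arr C f) (inv_arr C g)) = ide C c" .
qed

text \<open>Naturality at the formal inverses \<open>AssocI\<close>, \<open>LunI\<close>,
  \<open>RunI\<close> and naturality of the inverse of a 2-cell both come from a square that is
  already known, by reversing two opposite sides.\<close>

lemma invert_square:
  assumes "r \<in> hom C a b" "r' \<in> hom C a' b'" "k \<in> isos C a a'" "l \<in> isos C b b'"
    and sq: "cmp C r' k = cmp C l r"
  shows "cmp C r (inv_arr C k) = cmp C (inv_arr C l) r'"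
proof -
  note h = assms(1,2) isos_hom[OF assms(3)] isos_hom[OF assms(4)]
    inv_hom[OF assms(3)] inv_hom[OF assms(4)]
  have "cmp C r (inv_arr C k) = cmp C (cmp C (inv_arr C l) l) (cmp C r (inv_arr C k))"
    using h inv_left[OF assms(4)] by (simp add: hom_def cat_simps)
  also have "\<dots> = cmp C (inv_arr C l) (cmp C (cmp C l r) (inv_arr C k))"
    using h by (simp add: hom_def cat_simps)
  also have "\<dots> = cmp C (inv_arr C l) (cmp C (cmp C r' k) (inv_arr C k))"
    by (simp add: sq)
  also have "\<dots> = cmp C (inv_arr C l) (cmp C r' (cmp C k (inv_arr C k)))"
    using h by (simp add: hom_def cat_simps)
  also have "\<dots> = cmp C (inv_arr C l) r'"
    using h inv_right[OF assms(3)] by (simp add: ide_right)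
  finally show ?thesis .
qed

end

lemma
  assumes "cat_functor C D F"
  shows functor_obj: "a \<in> obj C \<Longrightarrow> fob F a \<in> obj D"
    and functor_hom: "f \<in> hom C a b \<Longrightarrow> far F f \<in> hom D (fob F a) (fob F b)"
    and functor_ide: "a \<in> obj C \<Longrightarrow> far F (ide C a) = ide D (fob F a)"
    and functor_cmp: "g \<in> hom C b c \<Longrightarrow> f \<in> hom C a b \<Longrightarrow>
      far F (cmp C g f) = cmp D (far F g) (far F f)"
  using assms by (auto simp: cat_functor_def hom_def)

text \<open>F carries the two inverse equations over. The second conclusion rewrites the value of F
  at an inverse structural 2-cell as an inverse, so that \<open>invert_square\<close> applies to
  it.\<close>

lemma functor_isos:
  assumes "category C" "category D" "cat_functor C D F" "f \<in> isos C a b"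
  shows "far F f \<in> isos D (fob F a) (fob F b)"
    and "far F (inv_arr C f) = inv_arr D (far F f)"
proof -
  interpret C: categ C by unfold_locales fact
  interpret D: categ D by unfold_locales fact
  note h = C.isos_hom[OF assms(4)] C.inv_hom[OF assms(4)]
  have "cmp D (far F (inv_arr C f)) (far F f) = ide D (fob F a)"
    using h C.hom_obj[OF h(1)] assms(4)
    by (simp add: C.inv_left functor_ide[OF assms(3)] flip: functor_cmp[OF assms(3)])
  moreover have "cmp D (far F f) (far F (inv_arr C f)) = ide D (fob F b)"
    using h C.hom_obj[OF h(1)] assms(4)
    by (simp add: C.inv_right functor_ide[OF assms(3)] flip: functor_cmp[OF assms(3)])
  ultimately show "far F f \<in> isos D (fob F a) (fob F b)"
    "far F (inv_arr C f) = inv_arr D (far F f)"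
    using functor_hom[OF assms(3) h(1)] functor_hom[OF assms(3) h(2)]
    by (auto intro: D.isosI simp: D.inv_arr_eqI)
qed

lemma cat_functor_id: "category C \<Longrightarrow> cat_functor C C (functor_id C)"
  unfolding cat_functor_def functor_id_def category_def hom_def by auto

section \<open>The axioms of a monoidal category for arrows with named ends\<close>

section \<open>Monoidal categories\<close>

locale moncateg =
  fixes M :: "('x, 'm) moncat"
  assumes monoidal: "monoidal_category M"
begin

sublocale categ "mcat M"
  using monoidal by unfold_locales (simp add: monoidal_category_def Let_def)

lemma unit_obj: "munit M \<in> obj (mcat M)"
  using monoidal by (simp add: monoidal_category_def Let_def)

lemma tensor_functor: "cat_functor (pair_cat (mcat M) (mcat M)) (mcat M)
    (tensor_functor (mcat M) (mten0 M) (mten1 M))"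
  using monoidal by (simp add: monoidal_category_def Let_def)

lemma ten0_obj: "a \<in> obj (mcat M) \<Longrightarrow> b \<in> obj (mcat M) \<Longrightarrow> mten0 M a b \<in> obj (mcat M)"
  using functor_obj[OF tensor_functor, of "(a, b)"] by (simp add: pair_cat_def tensor_functor_def)

lemma ten1_hom:
  assumes "f \<in> hom (mcat M) a b" "g \<in> hom (mcat M) c d"
  shows "mten1 M f g \<in> hom (mcat M) (mten0 M a c) (mten0 M b d)"
proof -
  have "(f, g) \<in> hom (pair_cat (mcat M) (mcat M)) (a, c) (b, d)"
    using assms by (auto simp: hom_def pair_cat_def)
  from functor_hom[OF tensor_functor this] show ?thesis
    using assms hom_obj[OF assms(1)] hom_obj[OF assms(2)]
    by (auto simp: tensor_functor_def homD)
qed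

lemma ten1_ide:
  assumes "a \<in> obj (mcat M)" "b \<in> obj (mcat M)"
  shows "mten1 M (ide (mcat M) a) (ide (mcat M) b) = ide (mcat M) (mten0 M a b)"
  using functor_ide[OF tensor_functor, of "(a, b)"] assms ide_hom[OF assms(1)] ide_hom[OF assms(2)]
  by (simp add: pair_cat_def tensor_functor_def homD)

lemma ten1_cmp:
  assumes "g \<in> hom (mcat M) b c" "f \<in> hom (mcat M) a b"
    and "g' \<in> hom (mcat M) b' c'" "f' \<in> hom (mcat M) a' b'"
  shows "mten1 M (cmp (mcat M) g f) (cmp (mcat M) g' f')
       = cmp (mcat M) (mten1 M g g') (mten1 M f f')"
proof -
  have h: "(f, f') \<in> hom (pair_cat (mcat M) (mcat M)) (a, a') (b, b')"
    "(g, g') \<in> hom (pair_cat (mcat M) (mcat M)) (b, b') (c, c')"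
    using assms by (auto simp: hom_def pair_cat_def)
  show ?thesis
    using functor_cmp[OF tensor_functor h(2,1)] assms
      cmp_hom[OF assms(1,2)] cmp_hom[OF assms(3,4)]
    by (simp add: tensor_functor_def pair_cat_def homD)
qed

lemma ten1_isos:
  assumes "f \<in> isos (mcat M) a b" "g \<in> isos (mcat M) c d"
  shows "mten1 M f g \<in> isos (mcat M) (mten0 M a c) (mten0 M b d)"
proof (rule isosI)
  note h = isos_hom[OF assms(1)] isos_hom[OF assms(2)] inv_hom[OF assms(1)] inv_hom[OF assms(2)]
  note o = hom_obj[OF h(1)] hom_obj[OF h(2)]
  show "mten1 M f g \<in> hom (mcat M) (mten0 M a c) (mten0 M b d)"
    "mten1 M (inv_arr (mcat M) f) (inv_arr (mcat M) g)
      \<in> hom (mcat M) (mten0 M b d) (mten0 M a c)"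
    using h by (auto intro: ten1_hom)
  show "cmp (mcat M) (mten1 M (inv_arr (mcat M) f) (inv_arr (mcat M) g)) (mten1 M f g)
      = ide (mcat M) (mten0 M a c)"
    using o assms by (simp add: ten1_ide inv_left flip: ten1_cmp[OF h(3,1) h(4,2)])
  show "cmp (mcat M) (mten1 M f g) (mten1 M (inv_arr (mcat M) f) (inv_arr (mcat M) g))
      = ide (mcat M) (mten0 M b d)"
    using o assms by (simp add: ten1_ide inv_right flip: ten1_cmp[OF h(1,3) h(2,4)])
qed

lemma ten1_simps:
  assumes "f \<in> arr (mcat M)" "g \<in> arr (mcat M)"
  shows "mten1 M f g \<in> arr (mcat M)"
    "src (mcat M) (mten1 M f g) = mten0 M (src (mcat M) f) (src (mcat M) g)"
    "tgt (mcat M) (mten1 M f g) = mten0 M (tgt (mcat M) f) (tgt (mcat M) g)"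
  using ten1_hom[OF arr_hom[OF assms(1)] arr_hom[OF assms(2)]] by (simp_all add: hom_def)

lemma assoc_isos:
  "a \<in> obj (mcat M) \<Longrightarrow> b \<in> obj (mcat M) \<Longrightarrow> c \<in> obj (mcat M) \<Longrightarrow>
    massoc M a b c \<in> isos (mcat M) (mten0 M (mten0 M a b) c) (mten0 M a (mten0 M b c))"
  using monoidal by (simp add: monoidal_category_def Let_def)

lemma lun_isos: "a \<in> obj (mcat M) \<Longrightarrow> mlun M a \<in> isos (mcat M) (mten0 M (munit M) a) a"
  using monoidal by (simp add: monoidal_category_def Let_def)

lemma run_isos: "a \<in> obj (mcat M) \<Longrightarrow> mrun M a \<in> isos (mcat M) (mten0 M a (munit M)) a"
  using monoidal by (simp add: monoidal_category_def Let_def)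

lemma assoc_nat:
  assumes "f \<in> hom (mcat M) a a'" "g \<in> hom (mcat M) b b'" "h \<in> hom (mcat M) c c'"
  shows "cmp (mcat M) (massoc M a' b' c') (mten1 M (mten1 M f g) h)
       = cmp (mcat M) (mten1 M f (mten1 M g h)) (massoc M a b c)"
proof -
  have "\<forall>f\<in>arr (mcat M). \<forall>g\<in>arr (mcat M). \<forall>h\<in>arr (mcat M).
      cmp (mcat M) (massoc M (tgt (mcat M) f) (tgt (mcat M) g) (tgt (mcat M) h))
        (mten1 M (mten1 M f g) h) =
      cmp (mcat M) (mten1 M f (mten1 M g h))
        (massoc M (src (mcat M) f) (src (mcat M) g) (src (mcat M) h))"
    using monoidal unfolding monoidal_category_def Let_def by metis
  then show ?thesis
    using assms by (metis homD)
qed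

lemma lun_nat:
  assumes "f \<in> hom (mcat M) a b"
  shows "cmp (mcat M) (mlun M b) (mten1 M (ide (mcat M) (munit M)) f)
       = cmp (mcat M) f (mlun M a)"
  using monoidal assms unfolding monoidal_category_def Let_def by (metis homD)

lemma run_nat:
  assumes "f \<in> hom (mcat M) a b"
  shows "cmp (mcat M) (mrun M b) (mten1 M f (ide (mcat M) (munit M)))
       = cmp (mcat M) f (mrun M a)"
  using monoidal assms unfolding monoidal_category_def Let_def by (metis homD)

lemma pentagon:
  "a \<in> obj (mcat M) \<Longrightarrow> b \<in> obj (mcat M) \<Longrightarrow> c \<in> obj (mcat M) \<Longrightarrow> d \<in> obj (mcat M) \<Longrightarrow>
    cmp (mcat M) (mten1 M (ide (mcat M) a) (massoc M b c d))
      (cmp (mcat M) (massoc M a (mten0 M b c) d) (mten1 M (massoc M a b c) (ide (mcat M) d))) =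
    cmp (mcat M) (massoc M a b (mten0 M c d)) (massoc M (mten0 M a b) c d)"
  using monoidal by (simp add: monoidal_category_def Let_def)

lemma triangle:
  "a \<in> obj (mcat M) \<Longrightarrow> b \<in> obj (mcat M) \<Longrightarrow>
    cmp (mcat M) (mten1 M (ide (mcat M) a) (mlun M b)) (massoc M a (munit M) b)
    = mten1 M (mrun M a) (ide (mcat M) b)"
  using monoidal by (simp add: monoidal_category_def Let_def)

end

section \<open>Formal cells modulo the bicategory axioms\<close>

section \<open>The free bicategory\<close>

lemma formal2_formal1:
  assumes "formal2 G p q s t u"
    and "\<And>p q m x y. m \<in> hom (edge G p q) x y \<Longrightarrow> p \<in> verts G \<Longrightarrow> q \<in> verts G \<Longrightarrow>
      x \<in> obj (edge G p q) \<and> y \<in> obj (edge G p q)"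
  shows "formal1 G p q s \<and> formal1 G p q t"
proof -
  have "p \<in> verts G \<and> q \<in> verts G" if "formal1 G p q t" for p q t
    using that by induction auto
  note verts = this
  from assms show ?thesis
    by induction (auto dest: verts intro: formal1.intros)
qed

lemma formal1_verts: "formal1 G p q t \<Longrightarrow> p \<in> verts G \<and> q \<in> verts G"
  by (induction rule: formal1.induct) auto

text \<open>That the edges are categories makes the relations \<open>gen_ide\<close> and
  \<open>gen_cmp\<close> well typed: identities and composites of generating 2-cells are then arrows
  with the right ends.\<close>

locale cgraph =
  fixes G :: "('p, 'x, 'm) cgraph"
  assumes edges: "p \<in> verts G \<Longrightarrow> q \<in> verts G \<Longrightarrow> category (edge G p q)"
begin

lemma formal2_formal1': "formal2 G p q s t u \<Longrightarrow> formal1 G p q s \<and> formal1 G p q t"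
  by (erule formal2_formal1) (meson categ.hom_obj categ.intro edges)

text \<open>Evaluation of an arrow looks at all members of its class, so each of them must be a
  formal 2-cell with the same two ends.\<close>

lemma formal_eq_formal2:
  "formal_eq G p q s t u v \<Longrightarrow> formal2 G p q s t u \<and> formal2 G p q s t v"
proof (induction rule: formal_eq.induct)
  case (gen_ide p q x)
  then have "ide (edge G p q) x \<in> hom (edge G p q) x x"
    using categ.ide_hom[OF categ.intro, OF edges] by blast
  with gen_ide show ?case by (auto intro: formal1.intros formal2.intros)
next
  case (gen_cmp p q m x y n z)
  then have "cmp (edge G p q) n m \<in> hom (edge G p q) x z"
    using categ.cmp_hom[OF categ.intro, OF edges] by blast
  with gen_cmp show ?case by (auto intro: formal2.intros)
next
  case (lun_nat p q s t u)
  then have "formal1 G p p (Unit p)" "formal1 G p q s" "formal1 G p q t"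
    by (auto dest: formal2_formal1' formal1_verts intro: formal1.unit)
  with lun_nat show ?case by (meson formal2.ide formal2.tens formal2.lun formal2.cmp)
next
  case (run_nat p q s t u)
  then have "formal1 G q q (Unit q)" "formal1 G p q s" "formal1 G p q t"
    by (auto dest: formal2_formal1' formal1_verts intro: formal1.unit)
  with run_nat show ?case by (meson formal2.ide formal2.tens formal2.run formal2.cmp)
next
  case (triangle p q s r t)
  then have "formal1 G q q (Unit q)"
    by (auto dest: formal1_verts intro: formal1.unit)
  with triangle show ?case
    by (meson formal2.ide formal2.tens formal2.run formal2.lun formal2.assoc formal2.cmp)
qed (auto dest: formal2_formal1' simp: formal1_verts
      intro!: formal2.ide formal2.tens formal2.assoc formal2.associ formal2.lun formal2.luni formal2.run formal2.runi
        formal1.intros intro: formal2.cmp)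

lemma fclass_eqI: "formal_eq G p q s t u v \<Longrightarrow> fclass G p q s t u = fclass G p q s t v"
  unfolding fclass_def by (auto intro: formal_eq.trans formal_eq.sym)

lemma fclass_hom: "formal2 G p q s t u \<Longrightarrow> fclass G p q s t u \<in> hom (free_hom G p q) s t"
  by (auto simp: hom_def free_hom_def fclass_def)

lemma free_arrE:
  assumes "f \<in> arr (free_hom G p q)"
  obtains s t u where "formal2 G p q s t u" "f = fclass G p q s t u"
  using assms by (auto simp: free_hom_def)

text \<open>The composite in \<open>free_hom\<close> collects everything related to a composite of
  some pair of representatives; the congruence rule reduces this to one chosen pair.\<close>

lemma free_cmp:
  assumes "formal2 G p q s t u" "formal2 G p q t r v"
  shows "cmp (free_hom G p q) (fclass G p q t r v) (fclass G p q s t u)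
       = fclass G p q s r (CmpC v u)"
proof -
  have "(\<exists>v'. formal_eq G p q t r v v' \<and> (\<exists>u'. formal_eq G p q s t u u' \<and>
      formal_eq G p q s r (CmpC v' u') w)) \<longleftrightarrow> formal_eq G p q s r (CmpC v u) w" for w
    using assms by (meson formal_eq.intros(1-4))
  then show ?thesis by (simp add: free_hom_def fclass_def)
qed

lemma free_tens:
  assumes "formal2 G p q s s' u" "formal2 G q r t t' v"
  shows "bcomp1 (free_struct G) p q r (fclass G p q s s' u) (fclass G q r t t' v)
       = fclass G p r (Tens s t) (Tens s' t') (TensC u v)"
proof -
  have "(\<exists>u'. formal_eq G p q s s' u u' \<and> (\<exists>v'. formal_eq G q r t t' v v' \<and>
      formal_eq G p r (Tens s t) (Tens s' t') (TensC u' v') w))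
      \<longleftrightarrow> formal_eq G p r (Tens s t) (Tens s' t') (TensC u v) w" for w
    using assms by (meson formal_eq.intros(1-3) formal_eq.cong_tens)
  then show ?thesis by (simp add: free_struct_def fclass_def)
qed

lemma free_category: "category (free_hom G p q)"
proof -
  have sel: "obj (free_hom G p q) = {t. formal1 G p q t}"
    "ide (free_hom G p q) = (\<lambda>t. fclass G p q t t (IdeC t))"
    "src (free_hom G p q) (fclass G p q s t u) = s"
    "tgt (free_hom G p q) (fclass G p q s t u) = t" for s t u
    by (simp_all add: free_hom_def fclass_def)
  show ?thesis
    unfolding category_def
  proof (intro conjI ballI impI)
    fix f assume "f \<in> arr (free_hom G p q)"
    then obtain s t u where u: "formal2 G p q s t u" "f = fclass G p q s t u"
      by (rule free_arrE)
    then have st: "formal1 G p q s" "formal1 G p q t" by (auto dest: formal2_formal1')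
    show "src (free_hom G p q) f \<in> obj (free_hom G p q)"
      "tgt (free_hom G p q) f \<in> obj (free_hom G p q)"
      using u st by (simp_all add: sel)
    show "cmp (free_hom G p q) f (ide (free_hom G p q) (src (free_hom G p q) f)) = f"
      using u st
      by (simp add: sel free_cmp[OF formal2.ide]) (blast intro: fclass_eqI formal_eq.cmp_ide_right)
    show "cmp (free_hom G p q) (ide (free_hom G p q) (tgt (free_hom G p q) f)) f = f"
      using u st
      by (simp add: sel free_cmp[OF _ formal2.ide]) (blast intro: fclass_eqI formal_eq.cmp_ide_left)
    fix g assume "g \<in> arr (free_hom G p q)"
    then obtain s' r v where v: "formal2 G p q s' r v" "g = fclass G p q s' r v"
      by (rule free_arrE)
    show "cmp (free_hom G p q) g f
        \<in> hom (free_hom G p q) (src (free_hom G p q) f) (tgt (free_hom G p q) g)"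
      if "tgt (free_hom G p q) f = src (free_hom G p q) g"
      using that u v by (auto simp: sel free_cmp intro!: fclass_hom formal2.cmp)
    fix h assume "h \<in> arr (free_hom G p q)"
    then obtain r' l w where w: "formal2 G p q r' l w" "h = fclass G p q r' l w"
      by (rule free_arrE)
    assume "tgt (free_hom G p q) f = src (free_hom G p q) g \<and>
      tgt (free_hom G p q) g = src (free_hom G p q) h"
    then have "s' = t" "r' = r" using u v w by (simp_all add: sel)
    then have "formal_eq G p q s l (CmpC w (CmpC v u)) (CmpC (CmpC w v) u)"
      using u v w by (auto intro: formal_eq.cmp_assoc)
    then show "cmp (free_hom G p q) h (cmp (free_hom G p q) g f)
        = cmp (free_hom G p q) (cmp (free_hom G p q) h g) f"
      using u v w \<open>s' = t\<close> \<open>r' = r\<close> fclass_eqI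
      by (simp add: free_cmp formal2.cmp[of G p q])
  next
    fix t assume "t \<in> obj (free_hom G p q)"
    then show "ide (free_hom G p q) t \<in> hom (free_hom G p q) t t"
      by (simp add: sel) (intro fclass_hom formal2.ide)
  qed
qed

text \<open>Formal inverses are separate generators, whereas \<open>eval1\<close> interprets them by
  \<open>inv_arr\<close>. In the free bicategory relations such as \<open>assoc_inv_left\<close> and
  \<open>assoc_inv_right\<close> make the two readings agree.\<close>

lemma free_inv:
  assumes "formal2 G p q s t u" "formal2 G p q t s v"
    and "formal_eq G p q s s (CmpC v u) (IdeC s)" "formal_eq G p q t t (CmpC u v) (IdeC t)"
  shows "inv_arr (free_hom G p q) (fclass G p q s t u) = fclass G p q t s v"
proof -
  have "ide (free_hom G p q) = (\<lambda>t. fclass G p q t t (IdeC t))"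
    by (simp add: free_hom_def)
  then show ?thesis
    using assms fclass_eqI[OF assms(3)] fclass_eqI[OF assms(4)]
    by (intro categ.inv_arr_eqI[OF categ.intro[OF free_category]])
      (auto intro: fclass_hom simp: free_cmp)
qed

end

section \<open>Functoriality of the free bicategory for graphs with one vertex\<close>

subsection \<open>Graphs with one vertex\<close>

text \<open>On the one-element type extensionality is no restriction, so by
  \<open>one_map_cases\<close> every graph map between such graphs has this form and amounts to the
  data of a functor.\<close>

definition one_map :: "('x, 'm, 'y, 'n) func \<Rightarrow> (unit, 'x, 'm, unit, 'y, 'n) cgmap" where
  "one_map F = \<lparr>vmap = (\<lambda>_. ()), emap = (\<lambda>_. F)\<rparr>"

lemma one_map_simps [simp]: "vmap (one_map F) p = ()" "emap (one_map F) e = F"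
  by (simp_all add: one_map_def)

lemma one_map_cases: "f = one_map (emap f ((), ()))"
  unfolding one_map_def by (cases f) (auto simp: fun_eq_iff)

lemma cg_comp_one_map: "cg_comp (one_graph C) g (one_map F)
    = one_map (functor_comp C (emap g ((), ())) F)"
  unfolding one_map_def graph_comp_def one_graph_def
  by (auto simp: fun_eq_iff)

lemma cg_id_one_graph: "cg_id (one_graph C) = one_map (functor_id C)"
  unfolding one_map_def graph_id_def one_graph_def by (auto simp: fun_eq_iff)

lemma one_graph_simps [simp]: "verts (one_graph C) = UNIV" "edge (one_graph C) p q = C"
  by (auto simp: one_graph_def)

lemma one_bicat_simps [simp]:
  "bgraph (one_bicat M) = one_graph (mcat M)" "bunit (one_bicat M) p = munit M"
  "bcomp0 (one_bicat M) p q r = mten0 M" "bcomp1 (one_bicat M) p q r = mten1 M"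
  "bassoc (one_bicat M) p q r l = massoc M" "blun (one_bicat M) p q = mlun M"
  "brun (one_bicat M) p q = mrun M"
  by (simp_all add: one_bicat_def)

lemma cgraph_one_graph: "category C \<Longrightarrow> cgraph (one_graph C)"
  by unfold_locales simp

text \<open>\<open>free_map\<close> is defined by evaluation into the free structure along the unit.
  Relabelling by this function and \<open>map_formal2\<close> is the same map on representatives;
  \<open>free_map_fob\<close> and \<open>free_map_far\<close> make the comparison.\<close>

definition map_formal1 :: "('x, 'm, 'y, 'n) func \<Rightarrow> (unit, 'x) tm \<Rightarrow> (unit, 'y) tm" where
  "map_formal1 F = map_tm id (fob F)"

definition map_formal2 ::
  "('x, 'm, 'y, 'n) func \<Rightarrow> (unit, 'x, 'm) ctm \<Rightarrow> (unit, 'y, 'n) ctm" where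
  "map_formal2 F = map_ctm id (fob F) (far F)"

lemma map_formal1_simps [simp]:
  "map_formal1 F (Gen p q x) = Gen p q (fob F x)"
  "map_formal1 F (Unit p) = Unit p"
  "map_formal1 F (Tens s t) = Tens (map_formal1 F s) (map_formal1 F t)"
  by (simp_all add: map_formal1_def)

lemma map_formal2_simps [simp]:
  "map_formal2 F (GenC p q m) = GenC p q (far F m)"
  "map_formal2 F (IdeC t) = IdeC (map_formal1 F t)"
  "map_formal2 F (CmpC v u) = CmpC (map_formal2 F v) (map_formal2 F u)"
  "map_formal2 F (TensC u v) = TensC (map_formal2 F u) (map_formal2 F v)"
  "map_formal2 F (Assoc s t w) = Assoc (map_formal1 F s) (map_formal1 F t) (map_formal1 F w)"
  "map_formal2 F (AssocI s t w) = AssocI (map_formal1 F s) (map_formal1 F t) (map_formal1 F w)"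
  "map_formal2 F (Lun t) = Lun (map_formal1 F t)"
  "map_formal2 F (LunI t) = LunI (map_formal1 F t)"
  "map_formal2 F (Run t) = Run (map_formal1 F t)"
  "map_formal2 F (RunI t) = RunI (map_formal1 F t)"
  by (simp_all add: map_formal1_def map_formal2_def)

lemma formal1_map:
  assumes F: "cat_functor C D F"
  shows "formal1 (one_graph C) p q t \<Longrightarrow> formal1 (one_graph D) p q (map_formal1 F t)"
proof (induction rule: formal1.induct)
  case (gen p q x)
  then show ?case using functor_obj[OF F] by (auto intro: formal1.intros)
qed (auto intro: formal1.intros)

lemma formal2_map:
  assumes F: "cat_functor C D F"
  shows "formal2 (one_graph C) p q s t u
    \<Longrightarrow> formal2 (one_graph D) p q (map_formal1 F s) (map_formal1 F t) (map_formal2 F u)"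
proof (induction rule: formal2.induct)
  case (gen p q m x y)
  then show ?case using functor_hom[OF F] by (auto intro: formal2.intros)
qed (auto intro: formal2.intros formal1_map[OF F])

lemma formal_eq_map:
  assumes F: "cat_functor C D F"
  shows "formal_eq (one_graph C) p q s t u v
    \<Longrightarrow> formal_eq (one_graph D) p q (map_formal1 F s) (map_formal1 F t)
      (map_formal2 F u) (map_formal2 F v)"
proof (induction rule: formal_eq.induct)
  case (gen_ide p q x)
  then show ?case
    using functor_obj[OF F] functor_ide[OF F]
    by (auto intro: formal_eq.gen_ide[of _ "one_graph D", simplified])
next
  case (gen_cmp p q m x y n z)
  then show ?case
    using functor_hom[OF F] functor_cmp[OF F]
    by (auto intro: formal_eq.gen_cmp[of _ "one_graph D", simplified])
next
  case (sym p q s t u v)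
  then show ?case by (blast intro: formal_eq.sym)
next
  case (trans p q s t u v w)
  then show ?case by (blast intro: formal_eq.trans)
qed (simp, (intro formal_eq.intros(1,4-8,11-)), (assumption | rule formal1_map[OF F] formal2_map[OF F])+)+

lemma eval0_free:
  assumes F: "cat_functor C D F" and t: "formal1 (one_graph C) p q t"
  shows "eval0 (free_struct (one_graph D)) (cg_comp (one_graph C) (free_eta (one_graph D)) (one_map F)) t
    = map_formal1 F t"
  using t
proof induction
  case (gen p q x)
  then show ?case using functor_obj[OF F]
    unfolding cg_comp_one_map by (simp add: functor_comp_def free_eta_def)
qed (simp_all add: free_struct_def)

context
  fixes C :: "('x, 'm) cat" and D :: "('y, 'n) cat" and F
  assumes C: "category C" and D: "category D" and F: "cat_functor C D F"
begin

interpretation D: cgraph "one_graph D"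
  by (rule cgraph_one_graph[OF D])

text \<open>Composites are handled by \<open>free_cmp\<close> and \<open>free_tens\<close>. At a
  formal inverse \<open>eval1\<close> yields an \<open>inv_arr\<close>, which
  \<open>free_inv\<close> turns back into the class of a formal inverse.\<close>

lemma eval1_free:
  assumes "formal2 (one_graph C) p q s t u"
  shows "eval1 (free_struct (one_graph D)) (cg_comp (one_graph C) (free_eta (one_graph D)) (one_map F)) u
    = fclass (one_graph D) p q (map_formal1 F s) (map_formal1 F t) (map_formal2 F u)"
proof -
  have sel: "edge (bgraph (free_struct (one_graph D))) p q = free_hom (one_graph D) p q"
    "ide (free_hom (one_graph D) p q) = (\<lambda>t. fclass (one_graph D) p q t t (IdeC t))"
    "bassoc (free_struct (one_graph D)) p q r l a b c
      = fclass (one_graph D) p l (Tens (Tens a b) c) (Tens a (Tens b c)) (Assoc a b c)"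
    "blun (free_struct (one_graph D)) p q a = fclass (one_graph D) p q (Tens (Unit p) a) a (Lun a)"
    "brun (free_struct (one_graph D)) p q a = fclass (one_graph D) p q (Tens a (Unit q)) a (Run a)"
    for p q r l a b c
    by (simp_all add: free_struct_def free_bicat_def free_hom_def)
  have v: "vmap (cg_comp (one_graph C) (free_eta (one_graph D)) (one_map F)) p = p" for p
    by simp
  note map = formal1_map[OF F] formal2_map[OF F]
  show ?thesis
    using assms
  proof (induction rule: formal2.induct)
    case (gen p q m x y)
    then show ?case
      using functor_hom[OF F, of m x y]
      unfolding cg_comp_one_map by (simp add: functor_comp_def free_eta_def homD)
  next
    case (ide p q t)
    then show ?case by (simp add: sel eval0_free[OF F])
  next
    case (cmp p q s t u r v)
    then show ?case by (simp add: sel D.free_cmp map)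
  next
    case (tens p q s s' u r t t' v)
    then show ?case by (simp add: D.free_tens map)
  next
    case (assoc p q s r t l w)
    then show ?case by (simp add: sel eval0_free[OF F])
  next
    case (associ p q s r t l w)
    then show ?case
      using D.free_inv[OF formal2.assoc formal2.associ formal_eq.assoc_inv_left formal_eq.assoc_inv_right,
          OF map(1)[OF associ(1)] map(1)[OF associ(2)] map(1)[OF associ(3)]]
      by (simp add: sel eval0_free[OF F] map)
  next
    case (lun p q t)
    then show ?case by (simp add: sel eval0_free[OF F])
  next
    case (luni p q t)
    then show ?case
      using D.free_inv[OF formal2.lun formal2.luni formal_eq.lun_inv_left formal_eq.lun_inv_right,
          OF map(1)[OF luni]]
      by (simp add: sel eval0_free[OF F] map)
  next
    case (run p q t)
    then show ?case by (simp add: sel eval0_free[OF F])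
  next
    case (runi p q t)
    then show ?case
      using D.free_inv[OF formal2.run formal2.runi formal_eq.run_inv_left formal_eq.run_inv_right,
          OF map(1)[OF runi]]
      by (simp add: sel eval0_free[OF F] map)
  qed
qed

end

lemma free_eval_fob: "formal1 (one_graph C) p q t
    \<Longrightarrow> fob (emap (free_eval (one_graph C) B F) (p, q)) t = eval0 B F t"
  by (simp add: free_eval_def free_hom_def)

text \<open>\<open>free_eval\<close> takes the only element of the image of a class. Constancy of
  \<open>eval1\<close> on the class, the last assumption, lets it be read off from one
  representative.\<close>

lemma free_eval_far:
  assumes "category C" "formal2 (one_graph C) p q s t u"
    and "\<And>v. formal_eq (one_graph C) p q s t u v \<Longrightarrow> eval1 B F v = eval1 B F u"
  shows "far (emap (free_eval (one_graph C) B F) (p, q)) (fclass (one_graph C) p q s t u) = eval1 B F u"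
proof -
  have "fclass (one_graph C) p q s t u \<in> arr (free_hom (one_graph C) p q)"
    using assms(2) by (auto simp: free_hom_def)
  moreover have "eval1 B F ` {v. formal_eq (one_graph C) p q s t u v} = {eval1 B F u}"
    using assms(3) formal_eq.refl[OF assms(2)] by blast
  ultimately show ?thesis
    by (simp add: free_eval_def fclass_def)
qed

lemma free_map_fob:
  assumes "cat_functor C D F" "formal1 (one_graph C) p q t"
  shows "fob (emap (free_map (one_graph C) (one_graph D) (one_map F)) (p, q)) t = map_formal1 F t"
  using assms by (simp only: free_map_def free_eval_fob eval0_free)

lemma free_map_far:
  assumes "category C" "category D" and F: "cat_functor C D F" and u: "formal2 (one_graph C) p q s t u"
  shows "far (emap (free_map (one_graph C) (one_graph D) (one_map F)) (p, q)) (fclass (one_graph C) p q s t u)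
    = fclass (one_graph D) p q (map_formal1 F s) (map_formal1 F t) (map_formal2 F u)"
proof -
  interpret C: cgraph "one_graph C" by (rule cgraph_one_graph) fact
  interpret D: cgraph "one_graph D" by (rule cgraph_one_graph) fact
  note ev = eval1_free[OF assms(1-3)]
  have "eval1 (free_struct (one_graph D)) (cg_comp (one_graph C) (free_eta (one_graph D)) (one_map F)) v
      = eval1 (free_struct (one_graph D)) (cg_comp (one_graph C) (free_eta (one_graph D)) (one_map F)) u"
    if v: "formal_eq (one_graph C) p q s t u v" for v
    unfolding ev[OF u] ev[OF conjunct2[OF C.formal_eq_formal2[OF v]]]
    by (rule D.fclass_eqI[OF formal_eq_map[OF F formal_eq.sym[OF v]]])
  then show ?thesis
    unfolding free_map_def by (subst free_eval_far[OF \<open>category C\<close> u]) (auto simp only: ev[OF u])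
qed

section \<open>Soundness of evaluation for the relations between formal 2-cells\<close>

subsection \<open>Evaluation in a monoidal category\<close>

context moncateg
begin

abbreviation ev0 where "ev0 F \<equiv> eval0 (one_bicat M) (one_map F)"
abbreviation ev1 where "ev1 F \<equiv> eval1 (one_bicat M) (one_map F)"

lemma eval0_obj:
  assumes F: "cat_functor C (mcat M) F"
  shows "formal1 (one_graph C) p q t \<Longrightarrow> ev0 F t \<in> obj (mcat M)"
  by (induction rule: formal1.induct) (auto simp: functor_obj[OF F] unit_obj ten0_obj)

lemma eval1_hom:
  assumes F: "cat_functor C (mcat M) F"
  shows "formal2 (one_graph C) p q s t u \<Longrightarrow> ev1 F u \<in> hom (mcat M) (ev0 F s) (ev0 F t)"
proof (induction rule: formal2.induct)
  case (associ p q s r t l w)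
  then show ?case
    using inv_hom[OF assoc_isos[OF eval0_obj[OF F] eval0_obj[OF F] eval0_obj[OF F]]] by simp
qed (auto simp: functor_hom[OF F] unit_obj ten0_obj eval0_obj[OF F]
    intro!: ide_hom ten1_hom isos_hom[OF assoc_isos] isos_hom[OF lun_isos] isos_hom[OF run_isos]
      inv_hom[OF lun_isos] inv_hom[OF run_isos])

text \<open>Each relation evaluates to a monoidal category axiom, to functoriality of F or of the
  tensor, or to a defining equation of an inverse.\<close>

lemma eval1_cong:
  assumes C: "category C" and F: "cat_functor C (mcat M) F"
  shows "formal_eq (one_graph C) p q s t u v \<Longrightarrow> ev1 F u = ev1 F v"
proof (induction rule: formal_eq.induct)
  case (gen_ide p q x)
  then show ?case by (simp add: functor_ide[OF F])
next
  case (gen_cmp p q m x y n z)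
  then show ?case by (simp add: functor_cmp[OF F])
next
  case (cmp_ide_left p q s t u)
  then show ?case by (simp add: ide_left[OF eval1_hom[OF F]])
next
  case (cmp_ide_right p q s t u)
  then show ?case by (simp add: ide_right[OF eval1_hom[OF F]])
next
  case (cmp_assoc p q s t u r v l w)
  then show ?case by (simp add: assoc_hom[OF eval1_hom[OF F] eval1_hom[OF F] eval1_hom[OF F]])
next
  case (tens_ide p q s r t)
  then show ?case by (simp add: ten1_ide eval0_obj[OF F])
next
  case (tens_cmp p q s s' u s'' u' r t t' v t'' v')
  then show ?case by (simp add: ten1_cmp[OF eval1_hom[OF F] eval1_hom[OF F] eval1_hom[OF F] eval1_hom[OF F]])
next
  case (assoc_nat p q s s' u r t t' v l w w' z)
  then show ?case by (simp add: moncateg.assoc_nat[OF moncateg_axioms eval1_hom[OF F] eval1_hom[OF F] eval1_hom[OF F]])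
next
  case (lun_nat p q s t u)
  then show ?case by (simp add: moncateg.lun_nat[OF moncateg_axioms eval1_hom[OF F]])
next
  case (run_nat p q s t u)
  then show ?case by (simp add: moncateg.run_nat[OF moncateg_axioms eval1_hom[OF F]])
next
  case (assoc_inv_left p q s r t l w)
  then show ?case by (simp add: inv_left[OF assoc_isos] eval0_obj[OF F])
next
  case (assoc_inv_right p q s r t l w)
  then show ?case by (simp add: inv_right[OF assoc_isos] eval0_obj[OF F])
next
  case (lun_inv_left p q t)
  then show ?case by (simp add: inv_left[OF lun_isos] eval0_obj[OF F])
next
  case (lun_inv_right p q t)
  then show ?case by (simp add: inv_right[OF lun_isos] eval0_obj[OF F])
next
  case (run_inv_left p q t)
  then show ?case by (simp add: inv_left[OF run_isos] eval0_obj[OF F])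
next
  case (run_inv_right p q t)
  then show ?case by (simp add: inv_right[OF run_isos] eval0_obj[OF F])
next
  case (pentagon p1 p2 s p3 t p4 w p5 z)
  then show ?case by (simp add: moncateg.pentagon[OF moncateg_axioms eval0_obj[OF F] eval0_obj[OF F] eval0_obj[OF F] eval0_obj[OF F]])
next
  case (triangle p q s r t)
  then show ?case by (simp add: moncateg.triangle[OF moncateg_axioms eval0_obj[OF F] eval0_obj[OF F]])
qed simp_all

lemma eval0_map:
  assumes F: "cat_functor C (mcat M) F"
  shows "formal1 (one_graph C) p q t \<Longrightarrow> ev0 (functor_id (mcat M)) (map_formal1 F t) = ev0 F t"
proof (induction rule: formal1.induct)
  case (gen p q x)
  then show ?case by (simp add: functor_id_def functor_obj[OF F])
qed simp_all

text \<open>Used to compute the action of Y after HV of F: relabelling along F and then evaluating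
  in the target is one evaluation along F.\<close>

lemma eval1_map:
  assumes F: "cat_functor C (mcat M) F"
  shows "formal2 (one_graph C) p q s t u \<Longrightarrow> ev1 (functor_id (mcat M)) (map_formal2 F u) = ev1 F u"
proof (induction rule: formal2.induct)
  case (gen p q m x y)
  then show ?case using functor_hom[OF F, of m x y] by (simp add: functor_id_def homD)
qed (simp_all add: eval0_map[OF F])

lemma free_eval_one_far:
  assumes "formal2 (one_graph (mcat M)) p q s t u"
  shows "far (emap (free_eval (one_graph (mcat M)) (one_bicat M) (cg_id (one_graph (mcat M)))) (p, q))
      (fclass (one_graph (mcat M)) p q s t u) = ev1 (functor_id (mcat M)) u"
  unfolding cg_id_one_graph
  by (rule free_eval_far[OF category assms])
    (rule eval1_cong[OF category cat_functor_id[OF category] formal_eq.sym])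

end

section \<open>Strictness of the horizontal structure, and interchange\<close>

section \<open>Doubly-degenerate \<open>Bicat\<^sub>s\<close>-categories\<close>

lemma vert_simps [simp]:
  "mcat (vert X) = ucat X" "munit (vert X) = uunit X" "mten0 (vert X) = vten0 X"
  "mten1 (vert X) = vten1 X" "massoc (vert X) = vassoc X" "mlun (vert X) = vlun X"
  "mrun (vert X) = vrun X"
  by (simp_all add: vert_def)

lemma hor_simps [simp]:
  "mcat (hor X) = ucat X" "munit (hor X) = uunit X" "mten0 (hor X) = hten0 X"
  "mten1 (hor X) = hten1 X"
  "massoc (hor X) = (\<lambda>a b c. ide (ucat X) (hten0 X (hten0 X a b) c))"
  "mlun (hor X) = ide (ucat X)" "mrun (hor X) = ide (ucat X)"
  by (simp_all add: hor_def)

text \<open>The horizontal value of a row, bracketed to the right and closed by the unit; strictness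
  absorbs the bracketing and the closing unit.\<close>

definition hfold0 :: "('x, 'm) ddbicat \<Rightarrow> 'x list \<Rightarrow> 'x" where
  "hfold0 X xs = foldr (hten0 X) xs (uunit X)"

definition hfold1 :: "('x, 'm) ddbicat \<Rightarrow> 'm list \<Rightarrow> 'm" where
  "hfold1 X fs = foldr (hten1 X) fs (ide (ucat X) (uunit X))"

lemma hfold_simps [simp]:
  "hfold0 X [] = uunit X" "hfold0 X (x # xs) = hten0 X x (hfold0 X xs)"
  "hfold1 X [] = ide (ucat X) (uunit X)" "hfold1 X (f # fs) = hten1 X f (hfold1 X fs)"
  by (simp_all add: hfold0_def hfold1_def)

locale dd =
  fixes X :: "('x, 'm) ddbicat"
  assumes dd: "dd_bicats_category X"
begin

sublocale v: moncateg "vert X"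
  rewrites "mcat (vert X) = ucat X" and "munit (vert X) = uunit X" and "mten0 (vert X) = vten0 X"
    and "mten1 (vert X) = vten1 X" and "massoc (vert X) = vassoc X" and "mlun (vert X) = vlun X"
    and "mrun (vert X) = vrun X"
  using dd by unfold_locales (simp_all add: dd_bicats_category_def)

sublocale h: moncateg "hor X"
  rewrites "mcat (hor X) = ucat X" and "munit (hor X) = uunit X" and "mten0 (hor X) = hten0 X"
    and "mten1 (hor X) = hten1 X"
    and "massoc (hor X) = (\<lambda>a b c. ide (ucat X) (hten0 X (hten0 X a b) c))"
    and "mlun (hor X) = ide (ucat X)" and "mrun (hor X) = ide (ucat X)"
  using dd by unfold_locales (simp_all add: dd_bicats_category_def)

lemma hten0_assoc:
  "a \<in> obj (ucat X) \<Longrightarrow> b \<in> obj (ucat X) \<Longrightarrow> c \<in> obj (ucat X) \<Longrightarrow>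
    hten0 X (hten0 X a b) c = hten0 X a (hten0 X b c)"
  using dd by (simp add: dd_bicats_category_def)

lemma hten0_unit:
  assumes "a \<in> obj (ucat X)"
  shows "hten0 X (uunit X) a = a" "hten0 X a (uunit X) = a"
  using dd assms by (simp_all add: dd_bicats_category_def)

text \<open>Strict unitality is part of the data on objects only. For arrows it is naturality of the
  horizontal unitors, which are identities.\<close>

lemma hten1_unit:
  assumes "f \<in> arr (ucat X)"
  shows "hten1 X (ide (ucat X) (uunit X)) f = f" "hten1 X f (ide (ucat X) (uunit X)) = f"
proof -
  note f = v.arr_hom[OF assms]
  note o = v.hom_obj[OF f] v.unit_obj
  have "hten1 X (ide (ucat X) (uunit X)) f \<in> hom (ucat X) (src (ucat X) f) (tgt (ucat X) f)"
    "hten1 X f (ide (ucat X) (uunit X)) \<in> hom (ucat X) (src (ucat X) f) (tgt (ucat X) f)"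
    using h.ten1_hom[OF v.ide_hom[OF v.unit_obj] f] h.ten1_hom[OF f v.ide_hom[OF v.unit_obj]] o
    by (simp_all add: hten0_unit)
  then show "hten1 X (ide (ucat X) (uunit X)) f = f" "hten1 X f (ide (ucat X) (uunit X)) = f"
    using h.lun_nat[OF f] h.run_nat[OF f] f by (simp_all add: v.ide_left v.ide_right)
qed

lemma hten_strict:
  defines "T \<equiv> tensor_functor (ucat X) (hten0 X) (hten1 X)"
    and "P \<equiv> pair_moncat (vert X) (vert X)"
  shows "\<forall>a\<in>obj (mcat P). \<forall>b\<in>obj (mcat P). fob T (mten0 P a b) = vten0 X (fob T a) (fob T b)"
    and "\<forall>f\<in>arr (mcat P). \<forall>g\<in>arr (mcat P). far T (mten1 P f g) = vten1 X (far T f) (far T g)"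
proof -
  have T: "strict_monoidal_functor P (vert X) T"
    using dd by (simp add: dd_bicats_category_def T_def P_def)
  show "\<forall>a\<in>obj (mcat P). \<forall>b\<in>obj (mcat P). fob T (mten0 P a b) = vten0 X (fob T a) (fob T b)"
    using T unfolding strict_monoidal_functor_def vert_simps by blast
  show "\<forall>f\<in>arr (mcat P). \<forall>g\<in>arr (mcat P). far T (mten1 P f g) = vten1 X (far T f) (far T g)"
    using T unfolding strict_monoidal_functor_def vert_simps by blast
qed

lemma interchange0:
  assumes "a \<in> obj (ucat X)" "b \<in> obj (ucat X)" "c \<in> obj (ucat X)" "d \<in> obj (ucat X)"
  shows "hten0 X (vten0 X a c) (vten0 X b d) = vten0 X (hten0 X a b) (hten0 X c d)"
  using bspec[OF bspec[OF hten_strict(1), of "(a, b)"], of "(c, d)"] assms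
  by (simp add: pair_moncat_def pair_cat_def tensor_functor_def v.ten0_obj)

lemma interchange1:
  assumes "f \<in> arr (ucat X)" "g \<in> arr (ucat X)" "k \<in> arr (ucat X)" "l \<in> arr (ucat X)"
  shows "hten1 X (vten1 X f k) (vten1 X g l) = vten1 X (hten1 X f g) (hten1 X k l)"
  using bspec[OF bspec[OF hten_strict(2), of "(f, g)"], of "(k, l)"] assms
  by (simp add: pair_moncat_def pair_cat_def tensor_functor_def v.ten1_simps)

text \<open>The unit functor from the terminal category is strict monoidal, and in the terminal
  category the tensor and the left unitor of the unique object are trivial.\<close>

lemma vunit: "vten0 X (uunit X) (uunit X) = uunit X" "vlun X (uunit X) = ide (ucat X) (uunit X)"
proof -
  let ?I = "\<lparr>fob = (\<lambda>_. uunit X), far = (\<lambda>_. ide (ucat X) (uunit X))\<rparr> :: (unit, unit, 'x, 'm) func"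
  have I: "strict_monoidal_functor terminal_moncat (vert X) ?I"
    using dd by (simp add: dd_bicats_category_def)
  then have "fob ?I (mten0 terminal_moncat () ()) = mten0 (vert X) (fob ?I ()) (fob ?I ())"
    unfolding strict_monoidal_functor_def by (simp add: terminal_moncat_def terminal_cat_def)
  moreover from I have "far ?I (mlun terminal_moncat ()) = mlun (vert X) (fob ?I ())"
    unfolding strict_monoidal_functor_def terminal_moncat_def terminal_cat_def moncat.simps cat.simps
    by blast
  ultimately show "vten0 X (uunit X) (uunit X) = uunit X" "vlun X (uunit X) = ide (ucat X) (uunit X)"
    by simp_all
qed

lemma hfold0_obj: "set xs \<subseteq> obj (ucat X) \<Longrightarrow> hfold0 X xs \<in> obj (ucat X)"
  by (induction xs) (auto simp: v.unit_obj h.ten0_obj)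

lemma hfold0_append:
  "set xs \<subseteq> obj (ucat X) \<Longrightarrow> set ys \<subseteq> obj (ucat X) \<Longrightarrow>
    hfold0 X (xs @ ys) = hten0 X (hfold0 X xs) (hfold0 X ys)"
  by (induction xs) (auto simp: hten0_unit hfold0_obj hten0_assoc)

end

abbreviation formal_obj :: "('x, 'm) ddbicat \<Rightarrow> (unit, 'x) tm \<Rightarrow> bool" where
  "formal_obj X \<equiv> formal1 (one_graph (ucat X)) () ()"

abbreviation formal_arr ::
  "('x, 'm) ddbicat \<Rightarrow> (unit, 'x) tm \<Rightarrow> (unit, 'x) tm \<Rightarrow> (unit, 'x, 'm) ctm \<Rightarrow> bool" where
  "formal_arr X \<equiv> formal2 (one_graph (ucat X)) () ()"

text \<open>The two ends of \<rho> at a single composite t: its source is \<open>val0 Y F t\<close>,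
  its target is F applied to \<open>ival0 X t\<close>.\<close>

definition val0 :: "('y, 'n) ddbicat \<Rightarrow> ('x, 'm, 'y, 'n) func \<Rightarrow> (unit, 'x) tm \<Rightarrow> 'y" where
  "val0 Y F = eval0 (one_bicat (vert Y)) (one_map F)"

definition val1 :: "('y, 'n) ddbicat \<Rightarrow> ('x, 'm, 'y, 'n) func \<Rightarrow> (unit, 'x, 'm) ctm \<Rightarrow> 'n" where
  "val1 Y F = eval1 (one_bicat (vert Y)) (one_map F)"

abbreviation ival0 :: "('x, 'm) ddbicat \<Rightarrow> (unit, 'x) tm \<Rightarrow> 'x" where
  "ival0 X \<equiv> val0 X (functor_id (ucat X))"

abbreviation ival1 :: "('x, 'm) ddbicat \<Rightarrow> (unit, 'x, 'm) ctm \<Rightarrow> 'm" where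
  "ival1 X \<equiv> val1 X (functor_id (ucat X))"

lemma val0_simps [simp]:
  "val0 Y F (Gen p q x) = fob F x" "val0 Y F (Unit p) = uunit Y"
  "val0 Y F (Tens s t) = vten0 Y (val0 Y F s) (val0 Y F t)"
  by (simp_all add: val0_def)

lemma functor_id_simps [simp]:
  "x \<in> obj C \<Longrightarrow> fob (functor_id C) x = x" "f \<in> arr C \<Longrightarrow> far (functor_id C) f = f"
  by (simp_all add: functor_id_def)

lemma val1_simps [simp]:
  "val1 Y F (GenC p q m) = far F m" "val1 Y F (IdeC t) = ide (ucat Y) (val0 Y F t)"
  "val1 Y F (CmpC v u) = cmp (ucat Y) (val1 Y F v) (val1 Y F u)"
  "val1 Y F (TensC u v) = vten1 Y (val1 Y F u) (val1 Y F v)"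
  "val1 Y F (Assoc s t w) = vassoc Y (val0 Y F s) (val0 Y F t) (val0 Y F w)"
  "val1 Y F (AssocI s t w) = inv_arr (ucat Y) (vassoc Y (val0 Y F s) (val0 Y F t) (val0 Y F w))"
  "val1 Y F (Lun t) = vlun Y (val0 Y F t)"
  "val1 Y F (LunI t) = inv_arr (ucat Y) (vlun Y (val0 Y F t))"
  "val1 Y F (Run t) = vrun Y (val0 Y F t)"
  "val1 Y F (RunI t) = inv_arr (ucat Y) (vrun Y (val0 Y F t))"
  by (simp_all add: val0_def val1_def)

text \<open>
  An object of \<open>HV(HV X)\<close> is a list of formal vertical composites of rows, a row being an object of
  \<open>HV X\<close>. The rows of one composite have the same length \<open>k\<close>, recorded by the vertex \<open>cell k\<close>. On
  such composites \<open>flatten\<close> and \<open>collapse\<close> are the multiplication of \<open>HV\<close> and \<open>HV\<close> of the action, and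
  \<open>paste\<close> is the 2-cell \<open>\<beta> * HV(\<rho>)\<close>.
\<close>

type_synonym hv_vert = "unit list \<times> unit list"

definition cell :: "nat \<Rightarrow> hv_vert" where
  "cell k = (replicate (Suc k) (), replicate k ())"

lemma length_snd_cell [simp]: "length (snd (cell k)) = k"
  by (simp add: cell_def)

primrec grid :: "('x, 'm) ddbicat \<Rightarrow> nat \<Rightarrow> (hv_vert, (unit, 'x) tm list) tm \<Rightarrow> bool" where
  "grid X k (Gen p q ts) \<longleftrightarrow> p = cell k \<and> q = cell k \<and> length ts = k \<and> list_all (formal_obj X) ts"
| "grid X k (Unit p) \<longleftrightarrow> p = cell k"
| "grid X k (Tens S T) \<longleftrightarrow> grid X k S \<and> grid X k T"

primrec flatten :: "(hv_vert, (unit, 'x) tm list) tm \<Rightarrow> (unit, 'x) tm list" where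
  "flatten (Gen p q ts) = ts"
| "flatten (Unit p) = replicate (length (snd p)) (Unit ())"
| "flatten (Tens S T) = map2 Tens (flatten S) (flatten T)"

primrec collapse :: "('x, 'm) ddbicat \<Rightarrow> (hv_vert, (unit, 'x) tm list) tm \<Rightarrow> (unit, 'x) tm" where
  "collapse X (Gen p q ts) = Gen () () (hfold0 X (map (ival0 X) ts))"
| "collapse X (Unit p) = Unit ()"
| "collapse X (Tens S T) = Tens (collapse X S) (collapse X T)"

primrec paste ::
  "('y, 'n) ddbicat \<Rightarrow> ((unit, 'x) tm list \<Rightarrow> 'n) \<Rightarrow> (hv_vert, (unit, 'x) tm list) tm \<Rightarrow> 'n" where
  "paste Y R (Gen p q ts) = R ts"
| "paste Y R (Unit p) = ide (ucat Y) (uunit Y)"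
| "paste Y R (Tens S T) = vten1 Y (paste Y R S) (paste Y R T)"

text \<open>
  A weak map \<open>(F, \<rho>)\<close> in terms of the components of \<open>\<rho>\<close> at rows: invertibility, naturality, the
  multiplication axiom and the unit axiom.
\<close>

definition weak_family ::
  "('x, 'm) ddbicat \<Rightarrow> ('y, 'n) ddbicat \<Rightarrow> ('x, 'm, 'y, 'n) func \<Rightarrow> ((unit, 'x) tm list \<Rightarrow> 'n) \<Rightarrow> bool"
where
  "weak_family X Y F R \<longleftrightarrow>
     cat_functor (ucat X) (ucat Y) F \<and>
     (\<forall>ts. list_all (formal_obj X) ts \<longrightarrow>
        R ts \<in> isos (ucat Y) (hfold0 Y (map (val0 Y F) ts)) (fob F (hfold0 X (map (ival0 X) ts)))) \<and>
     (\<forall>as. list_all (\<lambda>a. formal_arr X (fst a) (fst (snd a)) (snd (snd a))) as \<longrightarrow>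
        cmp (ucat Y) (R (map (\<lambda>a. fst (snd a)) as)) (hfold1 Y (map (\<lambda>a. val1 Y F (snd (snd a))) as)) =
        cmp (ucat Y) (far F (hfold1 X (map (\<lambda>a. ival1 X (snd (snd a))) as))) (R (map fst as))) \<and>
     (\<forall>ks Ss. list_all2 (grid X) ks Ss \<longrightarrow>
        cmp (ucat Y) (R (map (collapse X) Ss)) (hfold1 Y (map (paste Y R) Ss)) =
        R (concat (map flatten Ss))) \<and>
     (\<forall>a\<in>obj (ucat X). R [Gen () () a] = ide (ucat Y) (fob F a))"

context dd
begin

lemma val0_obj: "cat_functor C (ucat X) F \<Longrightarrow> formal1 (one_graph C) p q t \<Longrightarrow> val0 X F t \<in> obj (ucat X)"
  unfolding val0_def by (rule v.eval0_obj)

lemma val1_hom: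
  "cat_functor C (ucat X) F \<Longrightarrow> formal2 (one_graph C) p q s t u \<Longrightarrow>
    val1 X F u \<in> hom (ucat X) (val0 X F s) (val0 X F t)"
  unfolding val0_def val1_def by (rule v.eval1_hom)

lemmas ival0_obj = val0_obj[OF cat_functor_id[OF v.category]]
lemmas ival1_hom = val1_hom[OF cat_functor_id[OF v.category]]

lemma row_obj:
  "cat_functor C (ucat X) F \<Longrightarrow> list_all (formal1 (one_graph C) p q) ts \<Longrightarrow>
    hfold0 X (map (val0 X F) ts) \<in> obj (ucat X)"
  by (rule hfold0_obj) (auto simp: list_all_iff intro: val0_obj)

lemmas irow_obj = row_obj[OF cat_functor_id[OF v.category]]

end

locale dd_pair = X: dd X + Y: dd Y
  for X :: "('x, 'm) ddbicat" and Y :: "('y, 'n) ddbicat"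
begin

abbreviation cmpY (infixr "\<cdot>" 55) where "cmpY \<equiv> cmp (ucat Y)"
abbreviation vtenY (infixr "\<oslash>" 60) where "vtenY \<equiv> vten1 Y"
abbreviation htenY (infixr "\<parallel>" 60) where "htenY \<equiv> hten1 Y"

end

section \<open>Constraints as values of a weak family at two generators\<close>

subsection \<open>From weak maps to constraints\<close>

locale dd_family = dd_pair +
  fixes F and R
  assumes weak: "weak_family X Y F R"
begin

lemma F_functor: "cat_functor (ucat X) (ucat Y) F"
  using weak by (simp add: weak_family_def)

lemma R_isos: "list_all (formal_obj X) ts \<Longrightarrow>
    R ts \<in> isos (ucat Y) (hfold0 Y (map (val0 Y F) ts)) (fob F (hfold0 X (map (ival0 X) ts)))"
  using weak by (simp add: weak_family_def)

lemma R_hom: "list_all (formal_obj X) ts \<Longrightarrow>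
    R ts \<in> hom (ucat Y) (hfold0 Y (map (val0 Y F) ts)) (fob F (hfold0 X (map (ival0 X) ts)))"
  by (rule Y.v.isos_hom[OF R_isos])

lemma R_nat: "list_all (\<lambda>a. formal_arr X (fst a) (fst (snd a)) (snd (snd a))) as \<Longrightarrow>
    R (map (\<lambda>a. fst (snd a)) as) \<cdot> hfold1 Y (map (\<lambda>a. val1 Y F (snd (snd a))) as) =
    far F (hfold1 X (map (\<lambda>a. ival1 X (snd (snd a))) as)) \<cdot> R (map fst as)"
  using weak by (simp add: weak_family_def)

lemma R_mult: "list_all2 (grid X) ks Ss \<Longrightarrow>
    R (map (collapse X) Ss) \<cdot> hfold1 Y (map (paste Y R) Ss) = R (concat (map flatten Ss))"
  using weak by (simp add: weak_family_def)

lemma R_gen: "a \<in> obj (ucat X) \<Longrightarrow> R [Gen () () a] = ide (ucat Y) (fob F a)"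
  using weak by (simp add: weak_family_def)

lemma gen: "a \<in> obj (ucat X) \<Longrightarrow> formal_obj X (Gen () () a)"
  by (auto intro: formal1.gen)

lemma R1_hom: "formal_obj X t \<Longrightarrow> R [t] \<in> hom (ucat Y) (val0 Y F t) (fob F (ival0 X t))"
  using R_hom[of "[t]"] by (simp add: Y.hten0_unit X.hten0_unit Y.val0_obj[OF F_functor] X.ival0_obj)

lemma R1_nat:
  assumes "formal_arr X s t u"
  shows "R [t] \<cdot> val1 Y F u = far F (ival1 X u) \<cdot> R [s]"
  using R_nat[of "[(s, t, u)]"] assms Y.val1_hom[OF F_functor assms] X.ival1_hom[OF assms]
  by (simp add: Y.hten1_unit X.hten1_unit homD)

text \<open>This is the multiplication axiom at a grid with one column: its two rows are [s] and
  [t], and it flattens to [s/t].\<close>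

lemma R_tens:
  assumes "formal_obj X s" "formal_obj X t"
  shows "R [Tens s t] = R [Tens (Gen () () (ival0 X s)) (Gen () () (ival0 X t))] \<cdot> (R [s] \<oslash> R [t])"
proof -
  have "R [s] \<oslash> R [t] \<in> arr (ucat Y)"
    using assms[THEN R1_hom] by (simp add: homD Y.v.ten1_simps)
  then show ?thesis
    using R_mult[of "[1]" "[Tens (Gen (cell 1) (cell 1) [s]) (Gen (cell 1) (cell 1) [t])]"] assms
    by (simp add: Y.hten1_unit X.hten0_unit X.ival0_obj)
qed

text \<open>The formal unit of width zero collapses to a formal unit but flattens to the empty row,
  so the multiplication axiom identifies the vertical and the horizontal unit constraint.\<close>

lemma R_unit: "R [Unit ()] = R []"
proof -
  have "R [Unit ()] \<in> hom (ucat Y) (uunit Y) (fob F (uunit X))"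
    using R1_hom[of "Unit ()"] by (simp add: formal1.unit)
  then show ?thesis
    using R_mult[of "[0]" "[Unit (cell 0)]"]
    by (simp add: Y.hten1_unit Y.v.ide_simps Y.v.unit_obj Y.v.ide_right)
qed

text \<open>This is the multiplication axiom at two grids of height one, where flattening is
  concatenation. The horizontal fold ends in an identity, which \<open>hten1_unit\<close>
  removes.\<close>

lemma R_append:
  assumes "list_all (formal_obj X) ts" "list_all (formal_obj X) us"
  shows "R (ts @ us) = R [Gen () () (hfold0 X (map (ival0 X) ts)),
      Gen () () (hfold0 X (map (ival0 X) us))] \<cdot> (R ts \<parallel> R us)"
proof -
  let ?n = "cell (length ts)" and ?m = "cell (length us)"
  show ?thesis
    using R_mult[of "[length ts, length us]" "[Gen ?n ?n ts, Gen ?m ?m us]"] assms R_hom[OF assms(2)]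
    by (simp add: Y.hten1_unit homD)
qed

abbreviation vcon where "vcon a b \<equiv> R [Tens (Gen () () a) (Gen () () b)]"
abbreviation hcon where "hcon a b \<equiv> R [Gen () () a, Gen () () b]"

lemma vcon_isos:
  assumes "a \<in> obj (ucat X)" "b \<in> obj (ucat X)"
  shows "vcon a b \<in> isos (ucat Y) (vten0 Y (fob F a) (fob F b)) (fob F (vten0 X a b))"
  using R_isos[of "[Tens (Gen () () a) (Gen () () b)]"] assms functor_obj[OF F_functor]
  by (simp add: formal1.tens[OF gen gen] Y.hten0_unit X.hten0_unit Y.v.ten0_obj X.v.ten0_obj)

lemma hcon_isos:
  assumes "a \<in> obj (ucat X)" "b \<in> obj (ucat X)"
  shows "hcon a b \<in> isos (ucat Y) (hten0 Y (fob F a) (fob F b)) (fob F (hten0 X a b))"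
  using R_isos[of "[Gen () () a, Gen () () b]"] assms functor_obj[OF F_functor]
  by (simp add: gen Y.hten0_unit X.hten0_unit)

lemma unit_isos: "R [] \<in> isos (ucat Y) (uunit Y) (fob F (uunit X))"
  using R_isos[of "[]"] by simp

text \<open>Each coherence axiom is naturality of R at one structural 2-cell on generators, with
  both ends expanded by \<open>R_tens\<close>. A generator contributes an identity by
  \<open>R_gen\<close>, a formal unit contributes the value at the empty row by
  \<open>R_unit\<close>.\<close>

lemma vert_monoidal:
  "monoidal_functor (vert X) (vert Y) F (\<lambda>(a, b)\<in>obj (ucat X) \<times> obj (ucat X). vcon a b) (R [])"
  unfolding monoidal_functor_def Let_def vert_simps
proof (intro conjI ballI F_functor restrict_extensional unit_isos)
  fix a b assume a: "a \<in> obj (ucat X)" and b: "b \<in> obj (ucat X)"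
  then show "(\<lambda>(a, b)\<in>obj (ucat X) \<times> obj (ucat X). vcon a b) (a, b)
      \<in> isos (ucat Y) (vten0 Y (fob F a) (fob F b)) (fob F (vten0 X a b))"
    by (simp add: vcon_isos)
next
  fix f g assume f: "f \<in> arr (ucat X)" and g: "g \<in> arr (ucat X)"
  note u = formal2.tens[OF formal2.gen formal2.gen, of "()" "one_graph (ucat X)" "()" f _ _ "()" g,
      simplified, OF X.v.arr_hom[OF f] X.v.arr_hom[OF g]]
  show "(\<lambda>(a, b)\<in>obj (ucat X) \<times> obj (ucat X). vcon a b) (tgt (ucat X) f, tgt (ucat X) g) \<cdot>
      (far F f \<oslash> far F g) = far F (vten1 X f g) \<cdot>
      (\<lambda>(a, b)\<in>obj (ucat X) \<times> obj (ucat X). vcon a b) (src (ucat X) f, src (ucat X) g)"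
    using R1_nat[OF u] f g by (simp add: X.v.arr_obj)
next
  fix a b c assume a: "a \<in> obj (ucat X)" and b: "b \<in> obj (ucat X)" and c: "c \<in> obj (ucat X)"
  note u = formal2.assoc[OF gen[OF a] gen[OF b] gen[OF c]]
  have o: "fob F a \<in> obj (ucat Y)" "fob F b \<in> obj (ucat Y)" "fob F c \<in> obj (ucat Y)"
    using a b c functor_obj[OF F_functor] by auto
  have "R [Tens (Gen () () a) (Tens (Gen () () b) (Gen () () c))]
      = vcon a (vten0 X b c) \<cdot> (ide (ucat Y) (fob F a) \<oslash> vcon b c)"
    "R [Tens (Tens (Gen () () a) (Gen () () b)) (Gen () () c)]
      = vcon (vten0 X a b) c \<cdot> (vcon a b \<oslash> ide (ucat Y) (fob F c))"
    using a b c R_tens[OF gen formal1.tens[OF gen gen], of a b c]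
      R_tens[OF formal1.tens[OF gen gen] gen, of a b c]
    by (simp_all add: R_gen)
  with R1_nat[OF u]
  show "far F (vassoc X a b c) \<cdot>
      (\<lambda>(a, b)\<in>obj (ucat X) \<times> obj (ucat X). vcon a b) (vten0 X a b, c) \<cdot>
      ((\<lambda>(a, b)\<in>obj (ucat X) \<times> obj (ucat X). vcon a b) (a, b) \<oslash> ide (ucat Y) (fob F c)) =
      (\<lambda>(a, b)\<in>obj (ucat X) \<times> obj (ucat X). vcon a b) (a, vten0 X b c) \<cdot>
      (ide (ucat Y) (fob F a) \<oslash> (\<lambda>(a, b)\<in>obj (ucat X) \<times> obj (ucat X). vcon a b) (b, c)) \<cdot>
      vassoc Y (fob F a) (fob F b) (fob F c)"
    using a b c o vcon_isos[THEN Y.v.isos_hom, of a "vten0 X b c"] vcon_isos[THEN Y.v.isos_hom, of b c]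
      Y.v.isos_hom[OF Y.v.assoc_isos[OF o]]
    by (simp add: X.v.ten0_obj hom_def Y.v.cat_simps Y.v.ten1_simps)
next
  fix a assume a: "a \<in> obj (ucat X)"
  have o: "fob F a \<in> obj (ucat Y)" using a functor_obj[OF F_functor] by auto
  have U: "formal_obj X (Unit ())" by (simp add: formal1.unit)
  have "R [Tens (Unit ()) (Gen () () a)] = vcon (uunit X) a \<cdot> (R [] \<oslash> ide (ucat Y) (fob F a))"
    "R [Tens (Gen () () a) (Unit ())] = vcon a (uunit X) \<cdot> (ide (ucat Y) (fob F a) \<oslash> R [])"
    using a R_tens[OF U gen, of a] R_tens[OF gen U, of a] by (simp_all add: R_gen R_unit)
  with R1_nat[OF formal2.lun[OF gen[OF a]]] R1_nat[OF formal2.run[OF gen[OF a]]]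
  show "far F (vlun X a) \<cdot> (\<lambda>(a, b)\<in>obj (ucat X) \<times> obj (ucat X). vcon a b) (uunit X, a) \<cdot>
      (R [] \<oslash> ide (ucat Y) (fob F a)) = vlun Y (fob F a)"
    "far F (vrun X a) \<cdot> (\<lambda>(a, b)\<in>obj (ucat X) \<times> obj (ucat X). vcon a b) (a, uunit X) \<cdot>
      (ide (ucat Y) (fob F a) \<oslash> R []) = vrun Y (fob F a)"
    using a o Y.v.isos_hom[OF Y.v.lun_isos[OF o]] Y.v.isos_hom[OF Y.v.run_isos[OF o]]
    by (simp_all add: R_gen X.v.unit_obj Y.v.ide_left)
qed

text \<open>The horizontal associator is an identity, so associativity compares two expressions for
  R at a row of three generators, split after the first or after the second. The unit axioms split
  off an empty row.\<close>

lemma hor_monoidal: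
  "monoidal_functor (hor X) (hor Y) F (\<lambda>(a, b)\<in>obj (ucat X) \<times> obj (ucat X). hcon a b) (R [])"
  unfolding monoidal_functor_def Let_def hor_simps
proof (intro conjI ballI F_functor restrict_extensional unit_isos)
  fix a b assume a: "a \<in> obj (ucat X)" and b: "b \<in> obj (ucat X)"
  then show "(\<lambda>(a, b)\<in>obj (ucat X) \<times> obj (ucat X). hcon a b) (a, b)
      \<in> isos (ucat Y) (hten0 Y (fob F a) (fob F b)) (fob F (hten0 X a b))"
    by (simp add: hcon_isos)
next
  fix f g assume f: "f \<in> arr (ucat X)" and g: "g \<in> arr (ucat X)"
  note u = formal2.gen[of "()" "one_graph (ucat X)" "()", simplified, OF X.v.arr_hom[OF f]]
    formal2.gen[of "()" "one_graph (ucat X)" "()", simplified, OF X.v.arr_hom[OF g]]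
  show "(\<lambda>(a, b)\<in>obj (ucat X) \<times> obj (ucat X). hcon a b) (tgt (ucat X) f, tgt (ucat X) g) \<cdot>
      (far F f \<parallel> far F g) = far F (hten1 X f g) \<cdot>
      (\<lambda>(a, b)\<in>obj (ucat X) \<times> obj (ucat X). hcon a b) (src (ucat X) f, src (ucat X) g)"
    using R_nat[of "[(_, _, GenC () () f), (_, _, GenC () () g)]", simplified, OF conjI[OF u]] f g
      functor_hom[OF F_functor X.v.arr_hom[OF g]]
    by (simp add: X.v.arr_obj X.hten1_unit Y.hten1_unit homD)
next
  fix a b c assume a: "a \<in> obj (ucat X)" and b: "b \<in> obj (ucat X)" and c: "c \<in> obj (ucat X)"
  have o: "fob F a \<in> obj (ucat Y)" "fob F b \<in> obj (ucat Y)" "fob F c \<in> obj (ucat Y)"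
    using a b c functor_obj[OF F_functor] by auto
  have 1: "R [Gen () () a, Gen () () b, Gen () () c]
      = hcon a (hten0 X b c) \<cdot> (ide (ucat Y) (fob F a) \<parallel> hcon b c)"
    using a b c R_append[of "[Gen () () a]" "[Gen () () b, Gen () () c]"]
    by (simp add: gen R_gen X.hten0_unit X.h.ten0_obj)
  have 2: "R [Gen () () a, Gen () () b, Gen () () c]
      = hcon (hten0 X a b) c \<cdot> (hcon a b \<parallel> ide (ucat Y) (fob F c))"
    using a b c R_append[of "[Gen () () a, Gen () () b]" "[Gen () () c]"]
    by (simp add: gen R_gen X.hten0_unit X.h.ten0_obj)
  show "far F (ide (ucat X) (hten0 X (hten0 X a b) c)) \<cdot>
      (\<lambda>(a, b)\<in>obj (ucat X) \<times> obj (ucat X). hcon a b) (hten0 X a b, c) \<cdot>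
      ((\<lambda>(a, b)\<in>obj (ucat X) \<times> obj (ucat X). hcon a b) (a, b) \<parallel> ide (ucat Y) (fob F c)) =
      (\<lambda>(a, b)\<in>obj (ucat X) \<times> obj (ucat X). hcon a b) (a, hten0 X b c) \<cdot>
      (ide (ucat Y) (fob F a) \<parallel> (\<lambda>(a, b)\<in>obj (ucat X) \<times> obj (ucat X). hcon a b) (b, c)) \<cdot>
      ide (ucat Y) (hten0 Y (hten0 Y (fob F a) (fob F b)) (fob F c))"
    using a b c o hcon_isos[THEN Y.v.isos_hom, of a "hten0 X b c"] hcon_isos[THEN Y.v.isos_hom, of b c]
      hcon_isos[THEN Y.v.isos_hom, of "hten0 X a b" c] hcon_isos[THEN Y.v.isos_hom, of a b] 1 2
    by (simp add: X.h.ten0_obj Y.h.ten0_obj hom_def Y.v.cat_simps Y.h.ten1_simps functor_ide[OF F_functor]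
        X.hten0_assoc Y.hten0_assoc functor_obj[OF F_functor])
next
  fix a assume a: "a \<in> obj (ucat X)"
  have o: "fob F a \<in> obj (ucat Y)" using a functor_obj[OF F_functor] by auto
  have "R [Gen () () a] = hcon (uunit X) a \<cdot> (R [] \<parallel> ide (ucat Y) (fob F a))"
    "R [Gen () () a] = hcon a (uunit X) \<cdot> (ide (ucat Y) (fob F a) \<parallel> R [])"
    using a R_append[of "[]" "[Gen () () a]"] R_append[of "[Gen () () a]" "[]"]
    by (simp_all add: gen R_gen X.hten0_unit)
  then show "far F (ide (ucat X) a) \<cdot> (\<lambda>(a, b)\<in>obj (ucat X) \<times> obj (ucat X). hcon a b) (uunit X, a) \<cdot>
      (R [] \<parallel> ide (ucat Y) (fob F a)) = ide (ucat Y) (fob F a)"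
    "far F (ide (ucat X) a) \<cdot> (\<lambda>(a, b)\<in>obj (ucat X) \<times> obj (ucat X). hcon a b) (a, uunit X) \<cdot>
      (ide (ucat Y) (fob F a) \<parallel> R []) = ide (ucat Y) (fob F a)"
    using a o by (simp_all add: R_gen X.v.unit_obj functor_ide[OF F_functor] Y.v.ide_left[OF Y.v.ide_hom])
qed

lemma interaction:
  "interaction X Y (\<lambda>(a, b)\<in>obj (ucat X) \<times> obj (ucat X). vcon a b)
    (\<lambda>(a, b)\<in>obj (ucat X) \<times> obj (ucat X). hcon a b)"
  unfolding interaction_def
proof (intro ballI)
  fix a b c d
  assume a: "a \<in> obj (ucat X)" and b: "b \<in> obj (ucat X)" and c: "c \<in> obj (ucat X)" and d: "d \<in> obj (ucat X)"
  let ?G = "\<lambda>x y. Gen (cell 2) (cell 2) [Gen () () x, Gen () () y]"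
  let ?t = "\<lambda>x y. Tens (Gen () () x) (Gen () () y)"
  have "hcon a b \<oslash> hcon c d \<in> arr (ucat Y)"
    using a b c d by (intro Y.v.ten1_simps homD(1)[OF hcon_isos[THEN Y.v.isos_hom]])
  \<comment> \<open>Rows first: the grid of width two with rows (a, b) and (c, d).\<close>
  then have "R [?t a c, ?t b d] = vcon (hten0 X a b) (hten0 X c d) \<cdot> (hcon a b \<oslash> hcon c d)"
    using a b c d R_mult[of "[2]" "[Tens (?G a b) (?G c d)]"]
    by (simp add: gen X.hten0_unit Y.hten1_unit)
  \<comment> \<open>Columns first: the same row split between its two entries.\<close>
  moreover have "R [?t a c, ?t b d] = hcon (vten0 X a c) (vten0 X b d) \<cdot> (vcon a c \<parallel> vcon b d)"
    using a b c d R_append[of "[?t a c]" "[?t b d]"]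
    by (simp add: formal1.tens[OF gen gen] X.v.ten0_obj X.hten0_unit)
  ultimately show "(\<lambda>(a, b)\<in>obj (ucat X) \<times> obj (ucat X). vcon a b) (hten0 X a b, hten0 X c d) \<cdot>
      ((\<lambda>(a, b)\<in>obj (ucat X) \<times> obj (ucat X). hcon a b) (a, b) \<oslash>
       (\<lambda>(a, b)\<in>obj (ucat X) \<times> obj (ucat X). hcon a b) (c, d)) =
      (\<lambda>(a, b)\<in>obj (ucat X) \<times> obj (ucat X). hcon a b) (vten0 X a c, vten0 X b d) \<cdot>
      ((\<lambda>(a, b)\<in>obj (ucat X) \<times> obj (ucat X). vcon a b) (a, c) \<parallel>
       (\<lambda>(a, b)\<in>obj (ucat X) \<times> obj (ucat X). vcon a b) (b, d))"
    using a b c d by (simp add: X.v.ten0_obj X.h.ten0_obj)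
qed

end

text \<open>\<open>R_append\<close> peels a row down to single composites and \<open>R_tens\<close>
  peels a composite down to generators and units. What remains are the three given kinds of values
  and the identities at generators.\<close>

lemma (in dd_pair) weak_family_unique:
  assumes R: "weak_family X Y F R" and R': "weak_family X Y F R'"
    and v: "\<And>a b. a \<in> obj (ucat X) \<Longrightarrow> b \<in> obj (ucat X) \<Longrightarrow>
      R [Tens (Gen () () a) (Gen () () b)] = R' [Tens (Gen () () a) (Gen () () b)]"
    and h: "\<And>a b. a \<in> obj (ucat X) \<Longrightarrow> b \<in> obj (ucat X) \<Longrightarrow>
      R [Gen () () a, Gen () () b] = R' [Gen () () a, Gen () () b]"
    and unit: "R [] = R' []" and ts: "list_all (formal_obj X) ts"
  shows "R ts = R' ts"
proof -
  interpret R: dd_family X Y F R by unfold_locales fact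
  interpret R': dd_family X Y F R' by unfold_locales fact
  have 1: "R [t] = R' [t]" if "formal1 (one_graph (ucat X)) p q t" for p q t
    using that
  proof induction
    case (gen p q x)
    then show ?case by (simp add: R.R_gen R'.R_gen)
  next
    case (unit p)
    then show ?case by (simp add: R.R_unit R'.R_unit assms(5))
  next
    case (tens p q s r t)
    then show ?case by (simp add: R.R_tens R'.R_tens v X.ival0_obj)
  qed
  show ?thesis
    using ts
  proof (induction ts)
    case Nil
    then show ?case by (simp add: unit)
  next
    case (Cons t ts)
    then show ?case
      using R.R_append[of "[t]" ts] R'.R_append[of "[t]" ts] 1[of "()" "()" t]
      by (simp add: h X.irow_obj X.hten0_unit X.ival0_obj)
  qed
qed

section \<open>The weak family built from constraints by recursion\<close>

subsection \<open>From constraints to weak maps\<close>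

text \<open>Stated for arbitrary monoidal categories so as to serve both (F, v, \<eta>) and (F, h,
  \<eta>).\<close>

locale monfunct = M: moncateg M + N: moncateg N
  for M :: "('x, 'm) moncat" and N :: "('y, 'n) moncat" +
  fixes F \<phi> \<eta>
  assumes monoidal: "monoidal_functor M N F \<phi> \<eta>"
begin

lemma F_functor: "cat_functor (mcat M) (mcat N) F"
  using monoidal by (simp add: monoidal_functor_def Let_def)

lemma phi_isos: "a \<in> obj (mcat M) \<Longrightarrow> b \<in> obj (mcat M) \<Longrightarrow>
    \<phi> (a, b) \<in> isos (mcat N) (mten0 N (fob F a) (fob F b)) (fob F (mten0 M a b))"
  using monoidal by (simp add: monoidal_functor_def Let_def)

lemmas phi_hom = N.isos_hom[OF phi_isos]

lemma eta_isos: "\<eta> \<in> isos (mcat N) (munit N) (fob F (munit M))"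
  using monoidal by (simp add: monoidal_functor_def Let_def)

lemmas eta_hom = N.isos_hom[OF eta_isos]

lemma phi_nat:
  assumes "f \<in> hom (mcat M) a a'" "g \<in> hom (mcat M) b b'"
  shows "cmp (mcat N) (\<phi> (a', b')) (mten1 N (far F f) (far F g))
       = cmp (mcat N) (far F (mten1 M f g)) (\<phi> (a, b))"
  using monoidal assms unfolding monoidal_functor_def Let_def by (metis homD)

lemma phi_assoc: "a \<in> obj (mcat M) \<Longrightarrow> b \<in> obj (mcat M) \<Longrightarrow> c \<in> obj (mcat M) \<Longrightarrow>
    cmp (mcat N) (far F (massoc M a b c))
      (cmp (mcat N) (\<phi> (mten0 M a b, c)) (mten1 N (\<phi> (a, b)) (ide (mcat N) (fob F c)))) =
    cmp (mcat N) (\<phi> (a, mten0 M b c))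
      (cmp (mcat N) (mten1 N (ide (mcat N) (fob F a)) (\<phi> (b, c)))
        (massoc N (fob F a) (fob F b) (fob F c)))"
  using monoidal by (simp add: monoidal_functor_def Let_def)

lemma phi_lun: "a \<in> obj (mcat M) \<Longrightarrow>
    cmp (mcat N) (far F (mlun M a))
      (cmp (mcat N) (\<phi> (munit M, a)) (mten1 N \<eta> (ide (mcat N) (fob F a)))) = mlun N (fob F a)"
  using monoidal by (simp add: monoidal_functor_def Let_def)

lemma phi_run: "a \<in> obj (mcat M) \<Longrightarrow>
    cmp (mcat N) (far F (mrun M a))
      (cmp (mcat N) (\<phi> (a, munit M)) (mten1 N (ide (mcat N) (fob F a)) \<eta>)) = mrun N (fob F a)"
  using monoidal by (simp add: monoidal_functor_def Let_def)

lemmas arrow_simps = hom_def N.cat_simps N.ten1_simps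

text \<open>Two commuting squares are tensored and pasted onto a naturality square of \<phi>. This
  gives the tensor case of naturality in a composite and the induction step along a row.\<close>

lemma ten_square:
  assumes r: "r \<in> hom (mcat N) x (fob F a)" "r' \<in> hom (mcat N) x' (fob F a')"
    and s: "s \<in> hom (mcat N) y (fob F b)" "s' \<in> hom (mcat N) y' (fob F b')"
    and u: "u \<in> hom (mcat N) x x'" "f \<in> hom (mcat M) a a'"
      "cmp (mcat N) r' u = cmp (mcat N) (far F f) r"
    and w: "w \<in> hom (mcat N) y y'" "g \<in> hom (mcat M) b b'"
      "cmp (mcat N) s' w = cmp (mcat N) (far F g) s"
  shows "cmp (mcat N) (cmp (mcat N) (\<phi> (a', b')) (mten1 N r' s')) (mten1 N u w)
    = cmp (mcat N) (far F (mten1 M f g)) (cmp (mcat N) (\<phi> (a, b)) (mten1 N r s))"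
proof -
  note hs = r s u(1,2) w(1,2) phi_hom[of a b] phi_hom[of a' b']
    functor_hom[OF F_functor u(2)] functor_hom[OF F_functor w(2)]
    functor_hom[OF F_functor M.ten1_hom[OF u(2) w(2)]]
    M.hom_obj[OF u(2)] M.hom_obj[OF w(2)]
  have "cmp (mcat N) (cmp (mcat N) (\<phi> (a', b')) (mten1 N r' s')) (mten1 N u w)
      = cmp (mcat N) (\<phi> (a', b')) (mten1 N (cmp (mcat N) r' u) (cmp (mcat N) s' w))"
    using hs by (simp add: arrow_simps N.ten1_cmp[OF r(2) u(1) s(2) w(1)])
  also have "\<dots> = cmp (mcat N) (cmp (mcat N) (\<phi> (a', b')) (mten1 N (far F f) (far F g))) (mten1 N r s)"
    using hs unfolding u(3) w(3)
    by (simp add: arrow_simps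
        N.ten1_cmp[OF functor_hom[OF F_functor u(2)] r(1) functor_hom[OF F_functor w(2)] s(1)])
  also have "\<dots> = cmp (mcat N) (far F (mten1 M f g)) (cmp (mcat N) (\<phi> (a, b)) (mten1 N r s))"
    unfolding phi_nat[OF u(2) w(2)] using hs by (simp add: arrow_simps)
  finally show ?thesis .
qed

text \<open>The associativity axiom speaks of identities at F a, F b, F c. Precomposing with r, s,
  t, which pass through the associator by naturality, gives the form met in recursive definitions.
  For the horizontal structure it becomes \<open>h_assoc\<close>.\<close>

lemma assoc_square:
  assumes o: "a \<in> obj (mcat M)" "b \<in> obj (mcat M)" "c \<in> obj (mcat M)"
    and r: "r \<in> hom (mcat N) x (fob F a)" "s \<in> hom (mcat N) y (fob F b)" "t \<in> hom (mcat N) z (fob F c)"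
  shows "cmp (mcat N) (cmp (mcat N) (\<phi> (a, mten0 M b c))
        (mten1 N r (cmp (mcat N) (\<phi> (b, c)) (mten1 N s t)))) (massoc N x y z)
    = cmp (mcat N) (far F (massoc M a b c)) (cmp (mcat N) (\<phi> (mten0 M a b, c))
        (mten1 N (cmp (mcat N) (\<phi> (a, b)) (mten1 N r s)) t))"
proof -
  note o' = functor_obj[OF F_functor o(1)] functor_obj[OF F_functor o(2)] functor_obj[OF F_functor o(3)]
  note x = r[THEN N.hom_obj(1)]
  note hs = o o' x r o'[THEN N.ide_hom] phi_hom[OF o(1,2)] phi_hom[OF o(2,3)]
    phi_hom[OF M.ten0_obj[OF o(1,2)] o(3)] phi_hom[OF o(1) M.ten0_obj[OF o(2,3)]]
    N.isos_hom[OF N.assoc_isos[OF o']] N.isos_hom[OF N.assoc_isos[OF x]]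
    functor_hom[OF F_functor M.isos_hom[OF M.assoc_isos[OF o]]]
  have 1: "mten1 N r (cmp (mcat N) (\<phi> (b, c)) (mten1 N s t))
      = cmp (mcat N) (mten1 N (ide (mcat N) (fob F a)) (\<phi> (b, c))) (mten1 N r (mten1 N s t))"
    using N.ten1_cmp[OF N.ide_hom[OF o'(1)] r(1) phi_hom[OF o(2,3)] N.ten1_hom[OF r(2,3)]]
    by (simp add: N.ide_left[OF r(1)])
  have 2: "mten1 N (cmp (mcat N) (\<phi> (a, b)) (mten1 N r s)) t
      = cmp (mcat N) (mten1 N (\<phi> (a, b)) (ide (mcat N) (fob F c))) (mten1 N (mten1 N r s) t)"
    using N.ten1_cmp[OF phi_hom[OF o(1,2)] N.ten1_hom[OF r(1,2)] N.ide_hom[OF o'(3)] r(3)]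
    by (simp add: N.ide_left[OF r(3)])
  have "cmp (mcat N) (cmp (mcat N) (\<phi> (a, mten0 M b c))
        (mten1 N r (cmp (mcat N) (\<phi> (b, c)) (mten1 N s t)))) (massoc N x y z)
      = cmp (mcat N) (\<phi> (a, mten0 M b c)) (cmp (mcat N) (mten1 N (ide (mcat N) (fob F a)) (\<phi> (b, c)))
        (cmp (mcat N) (mten1 N r (mten1 N s t)) (massoc N x y z)))"
    unfolding 1 using hs by (simp add: arrow_simps M.ten0_obj)
  also have "\<dots> = cmp (mcat N) (cmp (mcat N) (\<phi> (a, mten0 M b c))
        (cmp (mcat N) (mten1 N (ide (mcat N) (fob F a)) (\<phi> (b, c))) (massoc N (fob F a) (fob F b) (fob F c))))
        (mten1 N (mten1 N r s) t)"
    unfolding N.assoc_nat[OF r, symmetric] using hs by (simp add: arrow_simps M.ten0_obj)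
  also have "\<dots> = cmp (mcat N) (far F (massoc M a b c)) (cmp (mcat N) (\<phi> (mten0 M a b, c))
        (mten1 N (cmp (mcat N) (\<phi> (a, b)) (mten1 N r s)) t))"
    unfolding phi_assoc[OF o, symmetric] 2 using hs by (simp add: arrow_simps M.ten0_obj)
  finally show ?thesis .
qed

text \<open>Tensoring \<eta> with r factors through \<eta> tensored with an identity; naturality of
  the unitor then reduces each square to a unit axiom.\<close>

lemma
  assumes o: "a \<in> obj (mcat M)" and r: "r \<in> hom (mcat N) x (fob F a)"
  shows lun_square: "cmp (mcat N) r (mlun N x)
      = cmp (mcat N) (far F (mlun M a)) (cmp (mcat N) (\<phi> (munit M, a)) (mten1 N \<eta> r))"
    and run_square: "cmp (mcat N) r (mrun N x)
      = cmp (mcat N) (far F (mrun M a)) (cmp (mcat N) (\<phi> (a, munit M)) (mten1 N r \<eta>))"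
proof -
  note o' = functor_obj[OF F_functor o]
  note hs = o o' N.hom_obj[OF r] r eta_hom N.ide_hom[OF o'] N.ide_hom[OF N.unit_obj]
    phi_hom[OF M.unit_obj o] phi_hom[OF o M.unit_obj]
    functor_hom[OF F_functor M.isos_hom[OF M.lun_isos[OF o]]]
    functor_hom[OF F_functor M.isos_hom[OF M.run_isos[OF o]]]
  have 1: "mten1 N \<eta> r
      = cmp (mcat N) (mten1 N \<eta> (ide (mcat N) (fob F a))) (mten1 N (ide (mcat N) (munit N)) r)"
    using N.ten1_cmp[OF eta_hom N.ide_hom[OF N.unit_obj] N.ide_hom[OF o'] r]
    by (simp add: N.ide_left[OF r] N.ide_right[OF eta_hom])
  show "cmp (mcat N) r (mlun N x)
      = cmp (mcat N) (far F (mlun M a)) (cmp (mcat N) (\<phi> (munit M, a)) (mten1 N \<eta> r))"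
    unfolding N.lun_nat[OF r, symmetric] phi_lun[OF o, symmetric] 1 using hs
    by (simp add: arrow_simps M.ten0_obj)
  have 2: "mten1 N r \<eta>
      = cmp (mcat N) (mten1 N (ide (mcat N) (fob F a)) \<eta>) (mten1 N r (ide (mcat N) (munit N)))"
    using N.ten1_cmp[OF N.ide_hom[OF o'] r eta_hom N.ide_hom[OF N.unit_obj]]
    by (simp add: N.ide_left[OF r] N.ide_right[OF eta_hom])
  show "cmp (mcat N) r (mrun N x)
      = cmp (mcat N) (far F (mrun M a)) (cmp (mcat N) (\<phi> (a, munit M)) (mten1 N r \<eta>))"
    unfolding N.run_nat[OF r, symmetric] phi_run[OF o, symmetric] 2 using hs
    by (simp add: arrow_simps M.ten0_obj)
qed

end

text \<open>The clauses are forced: they are \<open>R_gen\<close>, \<open>R_unit\<close> and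
  \<open>R_tens\<close> read as a recursion.\<close>

primrec vcell :: "('x, 'm) ddbicat \<Rightarrow> ('y, 'n) ddbicat \<Rightarrow> ('x, 'm, 'y, 'n) func \<Rightarrow>
    ('x \<times> 'x \<Rightarrow> 'n) \<Rightarrow> 'n \<Rightarrow> (unit, 'x) tm \<Rightarrow> 'n" where
  "vcell X Y F v \<eta> (Gen p q a) = ide (ucat Y) (fob F a)"
| "vcell X Y F v \<eta> (Unit p) = \<eta>"
| "vcell X Y F v \<eta> (Tens s t) =
     cmp (ucat Y) (v (ival0 X s, ival0 X t)) (vten1 Y (vcell X Y F v \<eta> s) (vcell X Y F v \<eta> t))"

text \<open>Since the recursion ends at the empty row, every row carries a last factor \<eta>; the
  horizontal right unit axiom cancels it, see \<open>r_single\<close>.\<close>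

primrec hcell :: "('x, 'm) ddbicat \<Rightarrow> ('y, 'n) ddbicat \<Rightarrow> ('x, 'm, 'y, 'n) func \<Rightarrow>
    ('x \<times> 'x \<Rightarrow> 'n) \<Rightarrow> ('x \<times> 'x \<Rightarrow> 'n) \<Rightarrow> 'n \<Rightarrow> (unit, 'x) tm list \<Rightarrow> 'n" where
  "hcell X Y F v h \<eta> [] = \<eta>"
| "hcell X Y F v h \<eta> (t # ts) =
     cmp (ucat Y) (h (ival0 X t, hfold0 X (map (ival0 X) ts)))
       (hten1 Y (vcell X Y F v \<eta> t) (hcell X Y F v h \<eta> ts))"

context dd
begin

lemma hfold0_units: "hfold0 X (replicate k (uunit X)) = uunit X"
  by (induction k) (simp_all add: hten0_unit v.unit_obj)

text \<open>Interchange on objects, one column at a time; the empty row is where 1/1 = 1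
  enters.\<close>

lemma hfold0_map2:
  assumes F: "cat_functor C (ucat X) F" and "length ss = length ts"
    and "list_all (formal1 (one_graph C) () ()) ss" "list_all (formal1 (one_graph C) () ()) ts"
  shows "hfold0 X (map (val0 X F) (map2 Tens ss ts))
    = vten0 X (hfold0 X (map (val0 X F) ss)) (hfold0 X (map (val0 X F) ts))"
  using assms(2-)
  by (induction rule: list_induct2)
    (simp_all add: vunit interchange0 val0_obj[OF F] row_obj[OF F])

end

lemma grid_flatten:
  "grid X k S \<Longrightarrow> list_all (formal_obj X) (flatten S) \<and> length (flatten S) = k"
  by (induction S) (auto simp: list_all_length intro: formal1.intros)

context dd
begin

lemma collapse_obj: "grid X k S \<Longrightarrow> formal_obj X (collapse X S)"
  by (induction S) (auto intro!: formal1.intros simp: irow_obj)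

text \<open>Evaluating rows first or columns first gives the same object, so both sides of the
  multiplication axiom end at the same place.\<close>

lemma ival0_collapse: "grid X k S \<Longrightarrow> ival0 X (collapse X S) = hfold0 X (map (ival0 X) (flatten S))"
proof (induction S)
  case (Unit p)
  then show ?case by (simp add: hfold0_units)
next
  case (Tens S T)
  then show ?case
    using grid_flatten[of X k S] grid_flatten[of X k T]
    by (simp add: hfold0_map2[OF cat_functor_id[OF v.category]] del: map_map)
qed (simp add: irow_obj)

end

lemma (in dd) formal_arr_objs:
  "formal2 (one_graph (ucat X)) p q s t u \<Longrightarrow>
    formal1 (one_graph (ucat X)) p q s \<and> formal1 (one_graph (ucat X)) p q t"
  by (rule cgraph.formal2_formal1'[OF cgraph_one_graph[OF v.category]])

lemma (in dd_pair) fold_homs: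
  assumes F: "cat_functor (ucat X) (ucat Y) F"
    and "list_all (\<lambda>a. formal_arr X (fst a) (fst (snd a)) (snd (snd a))) as"
  shows "hfold1 Y (map (\<lambda>a. val1 Y F (snd (snd a))) as)
      \<in> hom (ucat Y) (hfold0 Y (map (val0 Y F) (map fst as)))
          (hfold0 Y (map (val0 Y F) (map (\<lambda>a. fst (snd a)) as)))"
    and "hfold1 X (map (\<lambda>a. ival1 X (snd (snd a))) as)
      \<in> hom (ucat X) (hfold0 X (map (ival0 X) (map fst as)))
          (hfold0 X (map (ival0 X) (map (\<lambda>a. fst (snd a)) as)))"
  using assms(2)
  by (induction as)
    (auto intro!: Y.h.ten1_hom Y.val1_hom[OF F] Y.v.ide_hom Y.v.unit_obj
      X.h.ten1_hom X.ival1_hom X.v.ide_hom X.v.unit_obj)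

locale dd_constrained = dd_pair +
  fixes F v h \<eta>
  assumes vmon: "monoidal_functor (vert X) (vert Y) F v \<eta>"
    and hmon: "monoidal_functor (hor X) (hor Y) F h \<eta>"
    and inter: "interaction X Y v h"
begin

sublocale v: monfunct "vert X" "vert Y" F v \<eta>
  rewrites "mcat (vert X) = ucat X" and "munit (vert X) = uunit X" and "mten0 (vert X) = vten0 X"
    and "mten1 (vert X) = vten1 X" and "massoc (vert X) = vassoc X" and "mlun (vert X) = vlun X"
    and "mrun (vert X) = vrun X"
    and "mcat (vert Y) = ucat Y" and "munit (vert Y) = uunit Y" and "mten0 (vert Y) = vten0 Y"
    and "mten1 (vert Y) = vten1 Y" and "massoc (vert Y) = vassoc Y" and "mlun (vert Y) = vlun Y"
    and "mrun (vert Y) = vrun Y"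
  by unfold_locales (simp_all add: vmon)

sublocale h: monfunct "hor X" "hor Y" F h \<eta>
  rewrites "mcat (hor X) = ucat X" and "munit (hor X) = uunit X" and "mten0 (hor X) = hten0 X"
    and "mten1 (hor X) = hten1 X"
    and "massoc (hor X) = (\<lambda>a b c. ide (ucat X) (hten0 X (hten0 X a b) c))"
    and "mlun (hor X) = ide (ucat X)" and "mrun (hor X) = ide (ucat X)"
    and "mcat (hor Y) = ucat Y" and "munit (hor Y) = uunit Y" and "mten0 (hor Y) = hten0 Y"
    and "mten1 (hor Y) = hten1 Y"
    and "massoc (hor Y) = (\<lambda>a b c. ide (ucat Y) (hten0 Y (hten0 Y a b) c))"
    and "mlun (hor Y) = ide (ucat Y)" and "mrun (hor Y) = ide (ucat Y)"
  by unfold_locales (simp_all add: hmon)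

abbreviation "r1 \<equiv> vcell X Y F v \<eta>"
abbreviation "r \<equiv> hcell X Y F v h \<eta>"
abbreviation "row ts \<equiv> hfold0 X (map (ival0 X) ts)"
abbreviation "Frow ts \<equiv> hfold0 Y (map (val0 Y F) ts)"

lemmas F_functor = v.F_functor
lemmas arrow_simps = hom_def Y.v.cat_simps Y.v.ten1_simps Y.h.ten1_simps

lemma r1_isos: "formal1 (one_graph (ucat X)) p q t \<Longrightarrow> r1 t \<in> isos (ucat Y) (val0 Y F t) (fob F (ival0 X t))"
  by (induction rule: formal1.induct)
    (auto intro!: Y.v.ide_isos Y.v.cmp_isos Y.v.ten1_isos v.phi_isos v.eta_isos X.ival0_obj
      functor_obj[OF F_functor])

lemma r_isos: "list_all (formal_obj X) ts \<Longrightarrow> r ts \<in> isos (ucat Y) (Frow ts) (fob F (row ts))"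
  by (induction ts)
    (auto intro!: Y.v.cmp_isos Y.h.ten1_isos h.phi_isos v.eta_isos X.ival0_obj X.irow_obj r1_isos)

lemmas r1_hom = Y.v.isos_hom[OF r1_isos]
lemmas r_hom = Y.v.isos_hom[OF r_isos]

text \<open>The induction runs over formal 2-cells rather than classes. Structural 2-cells have
  their squares from the coherence axioms of (F, v, \<eta>), and formal inverses have those squares
  inverted.\<close>

lemma r1_nat:
  "formal2 (one_graph (ucat X)) p q s t u \<Longrightarrow> r1 t \<cdot> val1 Y F u = far F (ival1 X u) \<cdot> r1 s"
proof (induction rule: formal2.induct)
  case (gen p q m x y)
  then show ?case
    using functor_hom[OF F_functor, of m x y] by (simp add: Y.v.ide_left Y.v.ide_right homD(1))
next
  case (ide p q t)
  then show ?case
    using r1_hom[OF ide] by (simp add: Y.v.ide_left Y.v.ide_right functor_ide[OF F_functor] X.ival0_obj)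
next
  case (cmp p q s t u l w)
  note h = X.ival1_hom[OF cmp(1)] X.ival1_hom[OF cmp(2)]
  note hs = h[THEN functor_hom[OF F_functor]] Y.val1_hom[OF F_functor cmp(1)]
    Y.val1_hom[OF F_functor cmp(2)] X.formal_arr_objs[OF cmp(1)] X.formal_arr_objs[OF cmp(2)]
  have "r1 l \<cdot> val1 Y F w \<cdot> val1 Y F u = (r1 l \<cdot> val1 Y F w) \<cdot> val1 Y F u"
    using hs r1_hom[of p q l] by (simp add: arrow_simps)
  also have "\<dots> = far F (ival1 X w) \<cdot> (r1 t \<cdot> val1 Y F u)"
    using hs r1_hom[of p q t] unfolding cmp.IH(2) by (simp add: arrow_simps)
  also have "\<dots> = far F (ival1 X w) \<cdot> far F (ival1 X u) \<cdot> r1 s"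
    by (simp add: cmp.IH)
  also have "\<dots> = far F (cmp (ucat X) (ival1 X w) (ival1 X u)) \<cdot> r1 s"
    using hs r1_hom[of p q s] by (simp add: functor_cmp[OF F_functor h(2,1)] arrow_simps)
  finally show ?case by simp
next
  case (tens p q s s' u l t t' w)
  note o = X.formal_arr_objs[OF tens(1)] X.formal_arr_objs[OF tens(2)]
  show ?case
    using v.ten_square[OF r1_hom r1_hom r1_hom r1_hom Y.val1_hom[OF F_functor tens(1)] X.ival1_hom[OF tens(1)]
        tens.IH(1) Y.val1_hom[OF F_functor tens(2)] X.ival1_hom[OF tens(2)] tens.IH(2)] o by simp
next
  case (assoc p q s l t m w)
  show ?case
    using v.assoc_square[OF X.ival0_obj X.ival0_obj X.ival0_obj r1_hom r1_hom r1_hom, OF assoc assoc] by simp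
next
  case (associ p q s l t m w)
  note t = formal1.tens[OF formal1.tens[OF associ(1,2)] associ(3)]
    formal1.tens[OF associ(1) formal1.tens[OF associ(2,3)]]
  note a = Y.v.assoc_isos[OF associ[THEN Y.val0_obj[OF F_functor]]]
    X.v.assoc_isos[OF associ[THEN X.ival0_obj]]
  note Fa = functor_isos[OF X.v.category Y.v.category F_functor a(2)]
  have "r1 (Tens s (Tens t w)) \<cdot> vassoc Y (val0 Y F s) (val0 Y F t) (val0 Y F w)
      = far F (vassoc X (ival0 X s) (ival0 X t) (ival0 X w)) \<cdot> r1 (Tens (Tens s t) w)"
    using v.assoc_square[OF X.ival0_obj X.ival0_obj X.ival0_obj r1_hom r1_hom r1_hom, OF associ associ]
    by simp
  with Y.v.invert_square[OF t[THEN r1_hom], simplified, OF a(1) Fa(1)]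
  show ?case by (simp add: Fa(2))
next
  case (lun p q t)
  show ?case using v.lun_square[OF X.ival0_obj r1_hom, OF lun lun] by simp
next
  case (luni p q t)
  note a = Y.v.lun_isos[OF luni[THEN Y.val0_obj[OF F_functor]]] X.v.lun_isos[OF luni[THEN X.ival0_obj]]
  note Fa = functor_isos[OF X.v.category Y.v.category F_functor a(2)]
  have "formal1 (one_graph (ucat X)) p q (Tens (Unit p) t)"
    by (rule formal1.tens[OF formal1.unit luni]) simp
  from Y.v.invert_square[OF r1_hom[OF this] r1_hom[OF luni], simplified, OF a(1) Fa(1)]
  show ?case using v.lun_square[OF X.ival0_obj r1_hom, OF luni luni] by (simp add: Fa(2))
next
  case (run p q t)
  show ?case using v.run_square[OF X.ival0_obj r1_hom, OF run run] by simp
next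
  case (runi p q t)
  note a = Y.v.run_isos[OF runi[THEN Y.val0_obj[OF F_functor]]] X.v.run_isos[OF runi[THEN X.ival0_obj]]
  note Fa = functor_isos[OF X.v.category Y.v.category F_functor a(2)]
  have "formal1 (one_graph (ucat X)) p q (Tens t (Unit q))"
    by (rule formal1.tens[OF runi formal1.unit]) simp
  from Y.v.invert_square[OF r1_hom[OF this] r1_hom[OF runi], simplified, OF a(1) Fa(1)]
  show ?case using v.run_square[OF X.ival0_obj r1_hom, OF runi runi] by (simp add: Fa(2))
qed

lemma r_nat:
  assumes "list_all (\<lambda>a. formal_arr X (fst a) (fst (snd a)) (snd (snd a))) as"
  shows "r (map (\<lambda>a. fst (snd a)) as) \<cdot> hfold1 Y (map (\<lambda>a. val1 Y F (snd (snd a))) as) =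
    far F (hfold1 X (map (\<lambda>a. ival1 X (snd (snd a))) as)) \<cdot> r (map fst as)"
  using assms
proof (induction as)
  case Nil
  then show ?case
    using v.eta_hom by (simp add: Y.v.ide_left Y.v.ide_right functor_ide[OF F_functor] X.v.unit_obj)
next
  case (Cons x as)
  obtain s t u where x: "x = (s, t, u)" by (cases x)
  with Cons have u: "formal_arr X s t u" and as: "list_all (\<lambda>a. formal_arr X (fst a) (fst (snd a)) (snd (snd a))) as"
    by auto
  have st: "formal_obj X s" "formal_obj X t" using X.formal_arr_objs[OF u] by auto
  have "list_all (formal_obj X) (map fst as)" "list_all (formal_obj X) (map (\<lambda>a. fst (snd a)) as)"
    using as X.formal_arr_objs by (auto simp: list_all_iff)
  note st' = this[THEN r_hom]
  show ?case
    using h.ten_square[OF r1_hom[OF st(1)] r1_hom[OF st(2)] st' Y.val1_hom[OF F_functor u]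
      X.ival1_hom[OF u] r1_nat[OF u] fold_homs[OF F_functor as] Cons.IH[OF as]] by (simp add: x)
qed

text \<open>The horizontal unitors are identities, so the unit square degenerates to a
  cancellation.\<close>

lemma h_lun: "a \<in> obj (ucat X) \<Longrightarrow> k \<in> hom (ucat Y) x (fob F a) \<Longrightarrow> h (uunit X, a) \<cdot> (\<eta> \<parallel> k) = k"
  using h.lun_square[of a k x] h.phi_hom[OF X.v.unit_obj, of a] v.eta_hom Y.v.hom_obj(1)[of k x]
  by (simp add: functor_ide[OF F_functor] arrow_simps X.hten0_unit Y.hten0_unit)

lemma h_run: "a \<in> obj (ucat X) \<Longrightarrow> k \<in> hom (ucat Y) x (fob F a) \<Longrightarrow> h (a, uunit X) \<cdot> (k \<parallel> \<eta>) = k"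
  using h.run_square[of a k x] h.phi_hom[OF _ X.v.unit_obj, of a] v.eta_hom Y.v.hom_obj(1)[of k x]
  by (simp add: functor_ide[OF F_functor] arrow_simps X.hten0_unit Y.hten0_unit)

lemma h_assoc:
  assumes o: "a \<in> obj (ucat X)" "b \<in> obj (ucat X)" "c \<in> obj (ucat X)"
    and k: "k \<in> hom (ucat Y) x (fob F a)" "l \<in> hom (ucat Y) y (fob F b)" "m \<in> hom (ucat Y) z (fob F c)"
  shows "h (a, hten0 X b c) \<cdot> (k \<parallel> (h (b, c) \<cdot> (l \<parallel> m))) = h (hten0 X a b, c) \<cdot> ((h (a, b) \<cdot> (k \<parallel> l)) \<parallel> m)"
  using h.assoc_square[OF assms] o k[THEN Y.v.hom_obj(1)] k h.phi_hom[OF o(1) X.h.ten0_obj[OF o(2,3)]]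
    h.phi_hom[OF X.h.ten0_obj[OF o(1,2)] o(3)] h.phi_hom[OF o(1,2)] h.phi_hom[OF o(2,3)]
  by (simp add: functor_ide[OF F_functor] arrow_simps X.hten0_assoc Y.hten0_assoc X.h.ten0_obj)

text \<open>This is the left unit square at the object 1 with \<eta> itself as the arrow, where
  strictness of the unit makes both unitors identities. It starts the induction in
  \<open>r_map2\<close>.\<close>

lemma v_unit: "v (uunit X, uunit X) \<cdot> (\<eta> \<oslash> \<eta>) = \<eta>"
proof -
  have "v (uunit X, uunit X) \<cdot> (\<eta> \<oslash> \<eta>) \<in> hom (ucat Y) (uunit Y) (fob F (uunit X))"
    using Y.v.cmp_hom[OF v.phi_hom[OF X.v.unit_obj X.v.unit_obj] Y.v.ten1_hom[OF v.eta_hom v.eta_hom]]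
    by (simp add: X.vunit Y.vunit)
  then show ?thesis
    using v.lun_square[OF X.v.unit_obj v.eta_hom] v.eta_hom
    by (simp add: X.vunit Y.vunit functor_ide[OF F_functor] X.v.unit_obj Y.v.ide_left Y.v.ide_right)
qed

lemma r_single: "formal_obj X t \<Longrightarrow> r [t] = r1 t"
  using h_run[OF X.ival0_obj r1_hom] by simp

text \<open>The recursion brackets h to the right; each head of the first row is moved across by
  \<open>h_assoc\<close>, and an empty first row is absorbed by the left unit axiom.\<close>

lemma r_append:
  assumes "list_all (formal_obj X) ts" "list_all (formal_obj X) us"
  shows "r (ts @ us) = h (row ts, row us) \<cdot> (r ts \<parallel> r us)"
  using assms(1)
proof (induction ts)
  case Nil
  then show ?case using h_lun[OF X.irow_obj r_hom, OF assms(2) assms(2)] by simp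
next
  case (Cons t ts)
  then have t: "formal_obj X t" and ts: "list_all (formal_obj X) ts" by auto
  have "row (ts @ us) = hten0 X (row ts) (row us)"
    using ts assms(2) by (auto simp: X.hfold0_append list_all_iff intro!: X.ival0_obj X.hfold0_append)
  then show ?case
    using h_assoc[OF X.ival0_obj[OF t] X.irow_obj[OF ts] X.irow_obj[OF assms(2)] r1_hom[OF t]
      r_hom[OF ts] r_hom[OF assms(2)]] Cons by simp
qed

lemma r_units: "r (replicate k (Unit p)) = \<eta>"
proof (induction k)
  case (Suc k)
  then show ?case using h_lun[OF X.v.unit_obj v.eta_hom] by (simp add: X.hfold0_units)
qed simp

text \<open>Two rows are stacked one column at a time, and the interaction axiom is used once for
  each column, to trade v on columns for h on rows.\<close>

lemma r_map2:
  assumes "length ss = length ts" "list_all (formal_obj X) ss" "list_all (formal_obj X) ts"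
  shows "r (map2 Tens ss ts) = v (row ss, row ts) \<cdot> (r ss \<oslash> r ts)"
  using assms
proof (induction rule: list_induct2)
  case Nil
  then show ?case by (simp add: v_unit)
next
  case (Cons s ss t ts)
  then have t: "formal_obj X s" "formal_obj X t" "list_all (formal_obj X) ss" "list_all (formal_obj X) ts"
    by auto
  let ?a = "ival0 X s" and ?b = "row ss" and ?c = "ival0 X t" and ?d = "row ts"
  have o: "?a \<in> obj (ucat X)" "?b \<in> obj (ucat X)" "?c \<in> obj (ucat X)" "?d \<in> obj (ucat X)"
    using t by (auto intro: X.ival0_obj X.irow_obj)
  note k = r1_hom[OF t(1)] r_hom[OF t(3)] r1_hom[OF t(2)] r_hom[OF t(4)]
  note p = v.phi_hom[OF o(1,3)] v.phi_hom[OF o(2,4)] h.phi_hom[OF o(1,2)] h.phi_hom[OF o(3,4)]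
    h.phi_hom[OF X.v.ten0_obj[OF o(1,3)] X.v.ten0_obj[OF o(2,4)]]
    v.phi_hom[OF X.h.ten0_obj[OF o(1,2)] X.h.ten0_obj[OF o(3,4)]]
  note Fo = o[THEN functor_obj[OF F_functor]] k[THEN Y.v.hom_obj(1)]
  have row: "row (map2 Tens ss ts) = vten0 X ?b ?d"
    using X.hfold0_map2[OF cat_functor_id[OF X.v.category] Cons(1) t(3,4)] by simp
  have "r (map2 Tens (s # ss) (t # ts))
      = h (vten0 X ?a ?c, vten0 X ?b ?d) \<cdot> ((v (?a, ?c) \<cdot> (r1 s \<oslash> r1 t)) \<parallel> (v (?b, ?d) \<cdot> (r ss \<oslash> r ts)))"
    using Cons.IH t row by simp
  \<comment> \<open>Functoriality of the horizontal tensor pulls out the two values of v.\<close>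
  also have "\<dots> = h (vten0 X ?a ?c, vten0 X ?b ?d) \<cdot> (v (?a, ?c) \<parallel> v (?b, ?d)) \<cdot> ((r1 s \<oslash> r1 t) \<parallel> (r ss \<oslash> r ts))"
    by (simp add: Y.h.ten1_cmp[OF p(1) Y.v.ten1_hom[OF k(1,3)] p(2) Y.v.ten1_hom[OF k(2,4)]])
  \<comment> \<open>Interchange of arrows regroups the four remaining factors from columns into
    rows.\<close>
  also have "\<dots> = (h (vten0 X ?a ?c, vten0 X ?b ?d) \<cdot> (v (?a, ?c) \<parallel> v (?b, ?d))) \<cdot> ((r1 s \<parallel> r ss) \<oslash> (r1 t \<parallel> r ts))"
    using k p by (simp add: Y.interchange1 homD(1)) (simp add: arrow_simps Y.interchange0 Fo)
  \<comment> \<open>The interaction axiom at the values of the two heads and of the two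
    tails.\<close>
  also have "h (vten0 X ?a ?c, vten0 X ?b ?d) \<cdot> (v (?a, ?c) \<parallel> v (?b, ?d))
      = v (hten0 X ?a ?b, hten0 X ?c ?d) \<cdot> (h (?a, ?b) \<oslash> h (?c, ?d))"
    using inter o by (simp add: interaction_def)
  also have "\<dots> \<cdot> ((r1 s \<parallel> r ss) \<oslash> (r1 t \<parallel> r ts))
      = v (hten0 X ?a ?b, hten0 X ?c ?d) \<cdot> (h (?a, ?b) \<oslash> h (?c, ?d)) \<cdot> ((r1 s \<parallel> r ss) \<oslash> (r1 t \<parallel> r ts))"
    using k p by (simp add: arrow_simps Fo)
  also have "\<dots> = v (hten0 X ?a ?b, hten0 X ?c ?d) \<cdot> ((h (?a, ?b) \<cdot> (r1 s \<parallel> r ss)) \<oslash> (h (?c, ?d) \<cdot> (r1 t \<parallel> r ts)))"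
    by (simp add: Y.v.ten1_cmp[OF p(3) Y.h.ten1_hom[OF k(1,2)] p(4) Y.h.ten1_hom[OF k(3,4)]])
  finally show ?case by simp
qed

lemma paste_hom:
  "grid X k S \<Longrightarrow> paste Y r S \<in> hom (ucat Y) (Frow (flatten S)) (val0 Y F (collapse X S))"
proof (induction S)
  case (Gen p q ts)
  then show ?case using r_hom[of ts] by simp
next
  case (Unit p)
  then show ?case
    by (auto simp: Y.hfold0_units intro: Y.v.ide_hom Y.v.unit_obj)
next
  case (Tens S T)
  then show ?case
    using grid_flatten[of X k S] grid_flatten[of X k T]
    by (auto simp: Y.hfold0_map2[OF F_functor] simp del: map_map intro: Y.v.ten1_hom)
qed

text \<open>The multiplication axiom for a single grid, by induction on its vertical structure:
  \<open>r_map2\<close> treats a vertical composition and \<open>r_units\<close> a formal unit of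
  any width.\<close>

lemma r_flatten: "grid X k S \<Longrightarrow> r (flatten S) = r1 (collapse X S) \<cdot> paste Y r S"
proof (induction S)
  case (Gen p q ts)
  then show ?case using r_hom[of ts] by (simp add: Y.v.ide_left)
next
  case (Unit p)
  then show ?case using v.eta_hom by (simp add: r_units Y.v.ide_right)
next
  case (Tens S T)
  then have S: "grid X k S" and T: "grid X k T" by auto
  note f = grid_flatten[OF S] grid_flatten[OF T]
  note c = S[THEN X.collapse_obj] T[THEN X.collapse_obj]
  note hs = c[THEN r1_hom] paste_hom[OF S] paste_hom[OF T]
    v.phi_hom[OF X.ival0_obj[OF c(1)] X.ival0_obj[OF c(2)]]
  show ?case
    using f Tens.IH S T hs
    by (simp add: r_map2 X.ival0_collapse[symmetric] Y.v.ten1_cmp[OF hs(1,3) hs(2,4)]) (simp add: arrow_simps)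
qed

text \<open>The additional conjuncts type the composites and match the two horizontal values; the
  induction step uses them to apply functoriality of the horizontal tensor.\<close>

lemma r_mult:
  "list_all2 (grid X) ks Ss \<Longrightarrow>
    r (map (collapse X) Ss) \<cdot> hfold1 Y (map (paste Y r) Ss) = r (concat (map flatten Ss))
    \<and> list_all (formal_obj X) (concat (map flatten Ss)) \<and> row (concat (map flatten Ss)) = row (map (collapse X) Ss)
    \<and> hfold1 Y (map (paste Y r) Ss) \<in> hom (ucat Y) (Frow (concat (map flatten Ss))) (Frow (map (collapse X) Ss))
    \<and> list_all (formal_obj X) (map (collapse X) Ss)"
proof (induction rule: list_all2_induct)
  case Nil
  show ?case using v.eta_hom by (auto simp: Y.v.ide_right intro: Y.v.ide_hom Y.v.unit_obj)
next
  case (Cons k ks S Ss)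
  let ?fs = "concat (map flatten Ss)"
  note f = conjunct1[OF grid_flatten[OF Cons(1)]]
  note c = X.collapse_obj[OF Cons(1)]
  from Cons have fs: "list_all (formal_obj X) ?fs" "row ?fs = row (map (collapse X) Ss)"
    and cs: "list_all (formal_obj X) (map (collapse X) Ss)"
    and IH: "r (map (collapse X) Ss) \<cdot> hfold1 Y (map (paste Y r) Ss) = r ?fs"
    and p: "hfold1 Y (map (paste Y r) Ss) \<in> hom (ucat Y) (Frow ?fs) (Frow (map (collapse X) Ss))"
    by auto
  have o: "set (map (ival0 X) (flatten S)) \<subseteq> obj (ucat X)" "set (map (ival0 X) ?fs) \<subseteq> obj (ucat X)"
    "set (map (val0 Y F) (flatten S)) \<subseteq> obj (ucat Y)" "set (map (val0 Y F) ?fs) \<subseteq> obj (ucat Y)"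
    using f fs(1) by (auto simp: list_all_iff intro: X.ival0_obj Y.val0_obj[OF F_functor])
  note rows = X.hfold0_append[OF o(1,2)] Y.hfold0_append[OF o(3,4)]
  note hs = r1_hom[OF c] paste_hom[OF Cons(1)] r_hom[OF cs] p
    h.phi_hom[OF X.ival0_obj[OF c] X.irow_obj[OF cs]]
  have "r (flatten S @ ?fs) = h (ival0 X (collapse X S), row (map (collapse X) Ss))
      \<cdot> ((r1 (collapse X S) \<cdot> paste Y r S) \<parallel> (r (map (collapse X) Ss) \<cdot> hfold1 Y (map (paste Y r) Ss)))"
    unfolding r_append[OF f fs(1)] IH
    by (simp only: fs X.ival0_collapse[OF Cons(1)] r_flatten[OF Cons(1)])
  also have "\<dots> = r (map (collapse X) (S # Ss)) \<cdot> hfold1 Y (map (paste Y r) (S # Ss))"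
    unfolding Y.h.ten1_cmp[OF hs(1,2) hs(3,4)] using hs by (simp add: arrow_simps)
  finally show ?case
    using f fs c cs rows Y.h.ten1_hom[OF hs(2,4)] X.ival0_collapse[OF Cons(1)] by simp
qed

lemma hcell_weak_family: "weak_family X Y F r"
  unfolding weak_family_def
  using F_functor r_isos r_nat r_mult r_single
  by (auto simp: formal1.gen simp del: hcell.simps)

end

section \<open>Components of graph maps and 2-cells over a single 0-cell\<close>

section \<open>Weak maps of \<open>HV\<close>-algebras in components\<close>

text \<open>All graphs below have a single 0-cell, whence the fixed argument \<open>((), ())\<close>.\<close>

definition vc where "vc \<Phi> c = vmap (emap \<Phi> ((), ())) c"
definition oc where "oc \<Phi> c d x = fob (emap (emap \<Phi> ((), ())) (c, d)) x"
definition ac where "ac \<Phi> c d f = far (emap (emap \<Phi> ((), ())) (c, d)) f"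
definition tc where "tc \<tau> c d x = \<tau> ((), ()) (c, d) x"

abbreviation (input) hg where "hg A \<equiv> edge A () ()"

lemma graph_simps [simp]:
  "verts (V A) = verts A" "verts (H A) = verts A" "verts (HV A) = verts A"
  "edge (V A) a b = free_bicat (edge A a b)"
  "verts (free_bicat G) = verts G" "edge (free_bicat G) = free_hom G"
  "verts (dd_graph X) = {()}" "edge (dd_graph X) a b = one_graph (ucat X)"
  by (auto simp: V_def H_def HV_def free_bicat_def dd_graph_def)

lemma
  assumes "() \<in> verts A" "c \<in> verts (hg A)" "d \<in> verts (hg A)"
  shows vc_comp: "vc (cgg_comp A g f) c = vc g (vc f c)"
    and oc_comp: "x \<in> obj (edge (hg A) c d) \<Longrightarrow>
      oc (cgg_comp A g f) c d x = oc g (vc f c) (vc f d) (oc f c d x)"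
    and ac_comp: "m \<in> arr (edge (hg A) c d) \<Longrightarrow>
      ac (cgg_comp A g f) c d m = ac g (vc f c) (vc f d) (ac f c d m)"
  using assms by (simp_all add: vc_def oc_def ac_def graph_comp_def functor_comp_def)

lemma
  assumes "() \<in> verts A" "c \<in> verts (hg A)" "d \<in> verts (hg A)" "x \<in> obj (edge (hg A) c d)"
  shows tc_whiskR: "tc (cgg_whiskR A \<tau>' \<Phi>') c d x = tc \<tau>' (vc \<Phi>' c) (vc \<Phi>' d) (oc \<Phi>' c d x)"
    and tc_whiskL: "tc (cgg_whiskL A K \<Phi>'' \<tau>'') c d x = ac K (vc \<Phi>'' c) (vc \<Phi>'' d) (tc \<tau>'' c d x)"
    and tc_vcomp: "tc (cgg_vcomp A B \<Phi> \<sigma> \<tau>) c d x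
      = cmp (edge (edge B (vmap \<Phi> ()) (vmap \<Phi> ())) (vc \<Phi> c) (vc \<Phi> d)) (tc \<sigma> c d x) (tc \<tau> c d x)"
    and tc_id2: "tc (cgg_id2 A B' \<Psi>) c d x
      = ide (edge (edge B' (vmap \<Psi> ()) (vmap \<Psi> ())) (vc \<Psi> c) (vc \<Psi> d)) (oc \<Psi> c d x)"
  using assms
  by (simp_all add: vc_def oc_def ac_def tc_def graph_whiskR_def nat_whiskR_def graph_whiskL_def
      nat_whiskL_def graph_vcomp_def nat_vcomp_def graph_id2_def nat_id_def)

text \<open>The extensionality part of being a 2-cell. The outermost layer is indexed by pairs over
  the one-element type, where extensionality is automatic.\<close>

definition shape :: "(unit, 'p, 'x, 'm) cggraph \<Rightarrow> (unit, 'p, 'x, 'n) cgg2cell \<Rightarrow> bool" where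
  "shape A \<tau> \<longleftrightarrow> \<tau> ((), ()) \<in> extensional (verts (hg A) \<times> verts (hg A)) \<and>
     (\<forall>c\<in>verts (hg A). \<forall>d\<in>verts (hg A). \<tau> ((), ()) (c, d) \<in> extensional (obj (edge (hg A) c d)))"

lemma shape_eq_iff:
  assumes "shape A \<sigma>" "shape A \<tau>"
  shows "\<sigma> = \<tau> \<longleftrightarrow> (\<forall>c\<in>verts (hg A). \<forall>d\<in>verts (hg A). \<forall>x\<in>obj (edge (hg A) c d). tc \<sigma> c d x = tc \<tau> c d x)"
proof
  assume eq: "\<forall>c\<in>verts (hg A). \<forall>d\<in>verts (hg A). \<forall>x\<in>obj (edge (hg A) c d). tc \<sigma> c d x = tc \<tau> c d x"
  have "\<sigma> ((), ()) = \<tau> ((), ())"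
  proof (rule extensionalityI)
    show "\<sigma> ((), ()) \<in> extensional (verts (hg A) \<times> verts (hg A))"
      "\<tau> ((), ()) \<in> extensional (verts (hg A) \<times> verts (hg A))"
      using assms by (simp_all add: shape_def)
    fix e assume e: "e \<in> verts (hg A) \<times> verts (hg A)"
    then obtain c d where cd: "e = (c, d)" "c \<in> verts (hg A)" "d \<in> verts (hg A)" by auto
    show "\<sigma> ((), ()) e = \<tau> ((), ()) e"
      unfolding cd(1)
      by (rule extensionalityI[of _ "obj (edge (hg A) c d)"])
        (use assms cd eq in \<open>simp_all add: shape_def tc_def\<close>)
  qed
  then show "\<sigma> = \<tau>" by (auto simp: fun_eq_iff)
qed simp

lemma shape_ops:
  assumes "() \<in> verts A"
  shows "shape A (cgg_whiskR A \<tau>' \<Phi>')" "shape A (cgg_vcomp A B \<Phi> \<sigma> \<tau>)" "shape A (cgg_id2 A B' \<Psi>)"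
  using assms
  by (auto simp: shape_def graph_whiskR_def nat_whiskR_def graph_vcomp_def nat_vcomp_def graph_id2_def nat_id_def)

lemma cgg_2cell_iff:
  fixes A :: "(unit, 'p, 'x, 'm) cggraph" and B :: "(unit, unit, 'y, 'n) cggraph"
  assumes "() \<in> verts A"
  shows "cgg_2cell A B \<Phi> \<Psi> \<tau> \<longleftrightarrow> shape A \<tau> \<and>
    (\<forall>c\<in>verts (hg A). \<forall>d\<in>verts (hg A).
      (\<forall>x\<in>obj (edge (hg A) c d). tc \<tau> c d x \<in> hom (hg (hg B)) (oc \<Phi> c d x) (oc \<Psi> c d x)) \<and>
      (\<forall>f\<in>arr (edge (hg A) c d).
        cmp (hg (hg B)) (tc \<tau> c d (tgt (edge (hg A) c d) f)) (ac \<Phi> c d f) =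
        cmp (hg (hg B)) (ac \<Psi> c d f) (tc \<tau> c d (src (edge (hg A) c d) f))))"
proof -
  have U: "verts A = UNIV" using assms by auto
  show ?thesis
    unfolding graph_2cell_def nat_trans_def shape_def U by (auto simp: tc_def oc_def ac_def)
qed

section \<open>Vertices and hom-categories of HA over a single 0-cell\<close>

subsection \<open>The graphs \<open>HA\<close>\<close>

text \<open>This is what reduces paths of 0-cells and lists of 1-cells to natural numbers.\<close>

lemma unit_list_eqI: "length xs = length ys \<Longrightarrow> xs = (ys :: unit list)"
  by (rule nth_equalityI) simp_all

lemma unit_map [simp]: "map f xs = (xs :: unit list)"
  by (rule unit_list_eqI) simp

lemma H_verts:
  assumes "() \<in> verts A"
  shows "(os, ps) \<in> verts (hg (H A)) \<longleftrightarrow> length os = Suc (length ps) \<and> set ps \<subseteq> verts (hg A)"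
proof -
  have U: "verts A = UNIV" using assms by auto
  have "(os, ps) \<in> verts (hg (H A)) \<longleftrightarrow>
      os \<noteq> [] \<and> length os - 1 = length ps \<and> (\<forall>i<length ps. ps ! i \<in> verts (hg A))"
    by (auto simp: U H_def coprod_graph_def prod_graph_def paths_def legs_def list_all2_conv_all_nth)
  also have "\<dots> \<longleftrightarrow> length os = Suc (length ps) \<and> set ps \<subseteq> verts (hg A)"
    unfolding subset_iff in_set_conv_nth by (cases os) auto
  finally show ?thesis .
qed

text \<open>The coproduct compares paths; over one 0-cell these agree as soon as their lengths do,
  and otherwise the hom-category is empty.\<close>

lemma H_edge:
  assumes "() \<in> verts A" "(os, ps) \<in> verts (hg (H A))" "(os', qs) \<in> verts (hg (H A))"
  shows "edge (hg (H A)) (os, ps) (os', qs) =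
    (if length ps = length qs
     then prod_cat (map (\<lambda>i. edge (hg A) (ps ! i) (qs ! i)) [0..<length ps]) else empty_cat)"
proof -
  have "os = os' \<longleftrightarrow> length ps = length qs"
    using assms(2,3) unfolding H_verts[OF assms(1)] by (auto intro: unit_list_eqI)
  then show ?thesis
    using assms(2,3) unfolding H_verts[OF assms(1)]
    by (auto simp: H_def coprod_graph_def prod_graph_def legs_def intro!: arg_cong[where f = prod_cat])
qed

lemma H_obj:
  assumes "() \<in> verts A" "c \<in> verts (hg (H A))" "d \<in> verts (hg (H A))"
  shows "xs \<in> obj (edge (hg (H A)) c d) \<longleftrightarrow>
    length (snd c) = length (snd d) \<and> length xs = length (snd c) \<and>
    (\<forall>i<length (snd c). xs ! i \<in> obj (edge (hg A) (snd c ! i) (snd d ! i)))"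
  using H_edge[OF assms(1), of "fst c" "snd c" "fst d" "snd d"] assms(2,3)
  by (auto simp: prod_cat_def empty_cat_def Let_def list_all2_conv_all_nth)

lemma
  assumes "() \<in> verts A"
  shows vc_H_map: "(os, ps) \<in> verts (hg (H A)) \<Longrightarrow> vc (H_map A \<Phi>) (os, ps) = (os, map (vc \<Phi>) ps)"
    and oc_H_map: "c \<in> verts (hg (H A)) \<Longrightarrow> d \<in> verts (hg (H A)) \<Longrightarrow> xs \<in> obj (edge (hg (H A)) c d) \<Longrightarrow>
      oc (H_map A \<Phi>) c d xs = map (\<lambda>i. oc \<Phi> (snd c ! i) (snd d ! i) (xs ! i)) [0..<length xs]"
    and ac_H_map: "c \<in> verts (hg (H A)) \<Longrightarrow> d \<in> verts (hg (H A)) \<Longrightarrow> fs \<in> arr (edge (hg (H A)) c d) \<Longrightarrow>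
      ac (H_map A \<Phi>) c d fs = map (\<lambda>i. ac \<Phi> (snd c ! i) (snd d ! i) (fs ! i)) [0..<length fs]"
    and tc_H_map2: "c \<in> verts (hg (H A)) \<Longrightarrow> d \<in> verts (hg (H A)) \<Longrightarrow> xs \<in> obj (edge (hg (H A)) c d) \<Longrightarrow>
      tc (H_map2 A \<tau>) c d xs = map (\<lambda>i. tc \<tau> (snd c ! i) (snd d ! i) (xs ! i)) [0..<length xs]"
proof -
  show "vc (H_map A \<Phi>) (os, ps) = (os, map (vc \<Phi>) ps)" if "(os, ps) \<in> verts (hg (H A))"
    using assms that by (auto simp: vc_def H_map_def Let_def intro: nth_equalityI)
qed (use assms in \<open>auto simp: oc_def ac_def tc_def H_map_def H_map2_def Let_def split_beta\<close>)

lemma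
  assumes "() \<in> verts A" "c \<in> verts (hg (H (H A)))" "d \<in> verts (hg (H (H A)))"
  shows vc_H_mu: "vc (H_mu A) c = (concat (map (butlast \<circ> fst) (snd c)) @ [last (fst c)], concat (map snd (snd c)))"
    and oc_H_mu: "xs \<in> obj (edge (hg (H (H A))) c d) \<Longrightarrow> oc (H_mu A) c d xs = concat xs"
  using assms by (auto simp: vc_def oc_def H_mu_def Let_def split_beta)

section \<open>The source and the target of \<rho> computed on rows\<close>

subsection \<open>The action on a doubly-degenerate category and its maps\<close>

definition two_map :: "('x, 'm, 'y, 'n) func \<Rightarrow> (unit, unit, 'x, 'm, unit, unit, 'y, 'n) cggmap" where
  "two_map F = \<lparr>vmap = (\<lambda>_. ()), emap = (\<lambda>_. one_map F)\<rparr>"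

lemma two_map_simps [simp]: "vmap (two_map F) p = ()" "emap (two_map F) e = one_map F"
  "oc (two_map F) c d x = fob F x" "ac (two_map F) c d m = far F m"
  by (simp_all add: two_map_def oc_def ac_def)

lemma two_map_cases: "f = two_map (emap (emap f ((), ())) ((), ()))"
  using one_map_cases[of "emap f ((), ())"]
  unfolding two_map_def by (cases f) (auto simp: fun_eq_iff)

text \<open>A formal 2-cell is packed with its two ends, so that an arrow of HV X is named by a list
  of triples.\<close>

definition cls :: "('x, 'm) ddbicat \<Rightarrow> (unit, 'x) tm \<times> (unit, 'x) tm \<times> (unit, 'x, 'm) ctm \<Rightarrow>
    (unit, 'x, 'm) farr" where
  "cls X a = fclass (one_graph (ucat X)) () () (fst a) (fst (snd a)) (snd (snd a))"

abbreviation formal_arrs where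
  "formal_arrs X as \<equiv> list_all (\<lambda>a. formal_arr X (fst a) (fst (snd a)) (snd (snd a))) as"

lemma cell_eq [simp]: "cell k = cell l \<longleftrightarrow> k = l"
  by (metis length_snd_cell)

lemma hv_verts: "c \<in> verts (hg (HV (dd_graph X))) \<longleftrightarrow> (\<exists>k. c = cell k)"
proof -
  obtain os ps where c: "c = (os, ps)" by (cases c)
  have "c = cell k \<longleftrightarrow> length os = Suc k \<and> length ps = k" for k
    unfolding c cell_def by (auto intro: unit_list_eqI)
  then show ?thesis
    unfolding c HV_def by (subst H_verts) auto
qed

lemma cell_vert: "cell k \<in> verts (hg (HV (dd_graph X)))"
  by (auto simp: hv_verts)

lemma cell_vertH: "cell k \<in> verts (hg (H (dd_graph X)))"
  unfolding cell_def by (subst H_verts) auto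

lemma hv_edge: "edge (hg (HV (dd_graph X))) (cell k) (cell l) =
    (if k = l then prod_cat (replicate k (free_hom (one_graph (ucat X)) () ())) else empty_cat)"
proof -
  have "map (\<lambda>i. free_hom (one_graph (ucat X)) () ()) [0..<n]
      = replicate n (free_hom (one_graph (ucat X)) () ())" for n
    by (simp add: map_replicate_const)
  then show ?thesis
    using H_edge[of "V (dd_graph X)" "fst (cell k)" "snd (cell k)" "fst (cell l)" "snd (cell l)"]
      cell_vert[of k X] cell_vert[of l X]
    by (simp add: HV_def cell_def)
qed

lemma hv_obj: "ts \<in> obj (edge (hg (HV (dd_graph X))) (cell k) (cell l)) \<longleftrightarrow>
    k = l \<and> length ts = k \<and> list_all (formal_obj X) ts"
  by (auto simp: hv_edge prod_cat_def empty_cat_def Let_def list_all2_conv_all_nth list_all_length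
      free_hom_def)

lemma arr_free_hom: "arr (free_hom (one_graph (ucat X)) () ())
    = cls X ` {a. formal_arr X (fst a) (fst (snd a)) (snd (snd a))}"
  by (auto simp: free_hom_def cls_def image_def)

text \<open>An arrow is a row of classes. A representative of each turns it into a row of formal
  2-cells, the form in which \<open>weak_family\<close> states naturality.\<close>

lemma hv_arr: "fs \<in> arr (edge (hg (HV (dd_graph X))) (cell k) (cell l)) \<longleftrightarrow>
    k = l \<and> (\<exists>as. length as = k \<and> formal_arrs X as \<and> fs = map (cls X) as)"
proof -
  let ?S = "{a. formal_arr X (fst a) (fst (snd a)) (snd (snd a))}"
  have 1: "list_all2 (\<lambda>C f. f \<in> arr C) (replicate k (free_hom (one_graph (ucat X)) () ())) fs
      \<longleftrightarrow> length fs = k \<and> set fs \<subseteq> cls X ` ?S"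
    unfolding arr_free_hom[symmetric]
    by (auto simp: list_all2_conv_all_nth set_conv_nth)
  have "set fs \<subseteq> cls X ` ?S \<longleftrightarrow> fs \<in> map (cls X) ` lists ?S"
    unfolding lists_image[symmetric] by (simp add: lists_eq_set)
  also have "\<dots> \<longleftrightarrow> (\<exists>as. formal_arrs X as \<and> fs = map (cls X) as)"
    unfolding image_iff lists_eq_set list_all_iff by blast
  finally show ?thesis
    unfolding hv_edge using 1
    by (cases "k = l") (auto simp: prod_cat_def empty_cat_def Let_def simp del: list_all_iff)
qed

lemma hv_ends:
  assumes "length as = k"
  shows "src (edge (hg (HV (dd_graph X))) (cell k) (cell k)) (map (cls X) as) = map fst as"
    and "tgt (edge (hg (HV (dd_graph X))) (cell k) (cell k)) (map (cls X) as) = map (\<lambda>a. fst (snd a)) as"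
  using assms
  by (auto simp: hv_edge prod_cat_def Let_def cls_def fclass_def free_hom_def intro!: nth_equalityI)

lemma vc_unit [simp]: "vc \<Phi> c = ()"
  by simp

lemma vc_H_map_cell:
  fixes \<Phi> :: "(unit, unit, 'x, 'm, unit, unit, 'y, 'n) cggmap"
  shows "() \<in> verts A \<Longrightarrow> cell k \<in> verts (hg (H A)) \<Longrightarrow> vc (H_map A \<Phi>) (cell k) = cell k"
  unfolding cell_def by (subst vc_H_map) auto

context dd
begin

lemma V_action:
  shows "formal_obj X t \<Longrightarrow> oc (dd_V_action X) () () t = ival0 X t"
    and "formal_arr X (fst a) (fst (snd a)) (snd (snd a)) \<Longrightarrow>
      ac (dd_V_action X) () () (cls X a) = ival1 X (snd (snd a))"
proof -
  show "oc (dd_V_action X) () () t = ival0 X t" if "formal_obj X t"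
    using that by (simp add: oc_def dd_V_action_def free_eval_fob cg_id_one_graph val0_def)
  show "ac (dd_V_action X) () () (cls X a) = ival1 X (snd (snd a))"
    if "formal_arr X (fst a) (fst (snd a)) (snd (snd a))"
    using v.free_eval_one_far[OF that] by (simp add: ac_def dd_V_action_def cls_def val1_def)
qed

lemma H_action:
  shows "length xs = k \<Longrightarrow> set xs \<subseteq> obj (ucat X) \<Longrightarrow> oc (dd_H_action X) (cell k) (cell k) xs = hfold0 X xs"
    and "length fs = k \<Longrightarrow> set fs \<subseteq> arr (ucat X) \<Longrightarrow> ac (dd_H_action X) (cell k) (cell k) fs = hfold1 X fs"
proof -
  have e: "edge (hg (H (dd_graph X))) (cell k) (cell k) = prod_cat (replicate k (ucat X))"
    using H_edge[of "dd_graph X" "fst (cell k)" "snd (cell k)" "fst (cell k)" "snd (cell k)"]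
      cell_vertH[of k X] by (simp add: map_replicate_const cell_def)
  show "oc (dd_H_action X) (cell k) (cell k) xs = hfold0 X xs"
    if "length xs = k" "set xs \<subseteq> obj (ucat X)"
  proof -
    have "xs \<in> obj (edge (hg (H (dd_graph X))) (cell k) (cell k))"
      unfolding e using that by (auto simp: prod_cat_def Let_def list_all2_conv_all_nth)
    then show ?thesis
      by (simp add: oc_def dd_H_action_def Let_def cell_vertH hfold0_def)
  qed
  show "ac (dd_H_action X) (cell k) (cell k) fs = hfold1 X fs"
    if "length fs = k" "set fs \<subseteq> arr (ucat X)"
  proof -
    have "fs \<in> arr (edge (hg (H (dd_graph X))) (cell k) (cell k))"
      unfolding e using that by (auto simp: prod_cat_def Let_def list_all2_conv_all_nth)
    then show ?thesis
      by (simp add: ac_def dd_H_action_def Let_def cell_vertH hfold1_def)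
  qed
qed

lemma oc_action:
  assumes "length ts = k" "list_all (formal_obj X) ts"
  shows "oc (dd_action X) (cell k) (cell k) ts = hfold0 X (map (ival0 X) ts)"
proof -
  have ts: "ts \<in> obj (edge (hg (HV (dd_graph X))) (cell k) (cell k))"
    using assms by (simp add: hv_obj)
  have "oc (H_map (V (dd_graph X)) (dd_V_action X)) (cell k) (cell k) ts = map (ival0 X) ts"
    using ts cell_vert[of k X] assms unfolding HV_def
    by (subst oc_H_map) (auto intro!: nth_equalityI simp: V_action list_all_length)
  moreover have "set (map (ival0 X) ts) \<subseteq> obj (ucat X)"
    using assms by (auto simp: list_all_iff ival0_obj)
  ultimately show ?thesis
    using ts cell_vert[of k X] assms unfolding dd_action_def
    by (subst oc_comp) (auto simp: vc_H_map_cell[of "V (dd_graph X)" k] H_action HV_def)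
qed

lemma ac_action:
  assumes "length as = k" "formal_arrs X as"
  shows "ac (dd_action X) (cell k) (cell k) (map (cls X) as) = hfold1 X (map (\<lambda>a. ival1 X (snd (snd a))) as)"
proof -
  have fs: "map (cls X) as \<in> arr (edge (hg (HV (dd_graph X))) (cell k) (cell k))"
    using assms by (auto simp: hv_arr)
  have "ac (H_map (V (dd_graph X)) (dd_V_action X)) (cell k) (cell k) (map (cls X) as)
      = map (\<lambda>a. ival1 X (snd (snd a))) as"
    using fs cell_vert[of k X] assms unfolding HV_def
    by (subst ac_H_map) (auto intro!: nth_equalityI simp: V_action(2) list_all_length split: prod.splits)
  moreover have "set (map (\<lambda>a. ival1 X (snd (snd a))) as) \<subseteq> arr (ucat X)"
    using assms by (auto simp: list_all_iff dest!: ival1_hom homD(1))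
  ultimately show ?thesis
    using fs cell_vert[of k X] assms unfolding dd_action_def
    by (subst ac_comp) (auto simp: vc_H_map_cell[of "V (dd_graph X)" k] H_action HV_def)
qed

end

context dd_pair
begin

lemma V_map_components:
  assumes F: "cat_functor (ucat X) (ucat Y) F"
  shows "formal_obj X t \<Longrightarrow> oc (V_map (dd_graph X) (dd_graph Y) (two_map F)) () () t = map_formal1 F t"
    and "formal_arr X (fst a) (fst (snd a)) (snd (snd a)) \<Longrightarrow>
      ac (V_map (dd_graph X) (dd_graph Y) (two_map F)) () () (cls X a)
      = cls Y (map_formal1 F (fst a), map_formal1 F (fst (snd a)), map_formal2 F (snd (snd a)))"
  using free_map_fob[OF F, of "()" "()" t]
    free_map_far[OF X.v.category Y.v.category F, of "()" "()" "fst a" "fst (snd a)" "snd (snd a)"]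
  by (simp_all add: oc_def ac_def V_map_def cls_def)

abbreviation "act_Tf F \<equiv> cgg_comp (HV (dd_graph X)) (dd_action Y) (HV_map (dd_graph X) (dd_graph Y) (two_map F))"
abbreviation "f_act F \<equiv> cgg_comp (HV (dd_graph X)) (two_map F) (dd_action X)"

context
  fixes F assumes F: "cat_functor (ucat X) (ucat Y) F"
begin

text \<open>This is the source of \<rho> at a row; the passage through formal composites over Y is
  removed by \<open>eval0_map\<close>.\<close>

lemma oc_act_Tf:
  assumes "length ts = k" "list_all (formal_obj X) ts"
  shows "oc (act_Tf F) (cell k) (cell k) ts = hfold0 Y (map (val0 Y F) ts)"
proof -
  have ts: "ts \<in> obj (edge (hg (HV (dd_graph X))) (cell k) (cell k))"
    using assms by (simp add: hv_obj)
  have "oc (HV_map (dd_graph X) (dd_graph Y) (two_map F)) (cell k) (cell k) ts = map (map_formal1 F) ts"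
    using ts cell_vert[of k X] assms unfolding HV_def HV_map_def
    by (subst oc_H_map) (auto intro!: nth_equalityI simp: V_map_components[OF F] list_all_length)
  moreover have "list_all (formal_obj Y) (map (map_formal1 F) ts)"
    using assms by (auto simp: list_all_iff intro: formal1_map[OF F])
  moreover have "map (ival0 Y) (map (map_formal1 F) ts) = map (val0 Y F) ts"
    using assms Y.v.eval0_map[OF F] by (auto simp: list_all_iff val0_def)
  moreover have "vc (HV_map (dd_graph X) (dd_graph Y) (two_map F)) (cell k) = cell k"
    using cell_vert[of k X] unfolding HV_map_def HV_def by (subst vc_H_map_cell) auto
  ultimately show ?thesis
    using ts cell_vert[of k X] assms
    by (subst oc_comp) (auto simp: Y.oc_action simp del: map_map)
qed

lemma ac_act_Tf:
  assumes "length as = k" "formal_arrs X as"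
  shows "ac (act_Tf F) (cell k) (cell k) (map (cls X) as) = hfold1 Y (map (\<lambda>a. val1 Y F (snd (snd a))) as)"
proof -
  have fs: "map (cls X) as \<in> arr (edge (hg (HV (dd_graph X))) (cell k) (cell k))"
    using assms by (auto simp: hv_arr)
  define bs where "bs = map (\<lambda>a. (map_formal1 F (fst a), map_formal1 F (fst (snd a)), map_formal2 F (snd (snd a)))) as"
  have "ac (HV_map (dd_graph X) (dd_graph Y) (two_map F)) (cell k) (cell k) (map (cls X) as) = map (cls Y) bs"
    using fs cell_vert[of k X] assms unfolding HV_def HV_map_def bs_def
    by (subst ac_H_map) (auto intro!: nth_equalityI simp: V_map_components(2)[OF F] list_all_length split: prod.splits)
  moreover have "formal_arrs Y bs" "length bs = k"
    using assms by (auto simp: list_all_iff bs_def intro: formal2_map[OF F])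
  moreover have "map (\<lambda>a. ival1 Y (snd (snd a))) bs = map (\<lambda>a. val1 Y F (snd (snd a))) as"
    using assms Y.v.eval1_map[OF F] by (auto simp: list_all_iff val1_def bs_def)
  moreover have "vc (HV_map (dd_graph X) (dd_graph Y) (two_map F)) (cell k) = cell k"
    using cell_vert[of k X] unfolding HV_map_def HV_def by (subst vc_H_map_cell) auto
  ultimately show ?thesis
    using fs cell_vert[of k X] assms
    by (subst ac_comp) (auto simp: Y.ac_action simp del: map_map)
qed

lemma oc_f_act:
  assumes "length ts = k" "list_all (formal_obj X) ts"
  shows "oc (f_act F) (cell k) (cell k) ts = fob F (hfold0 X (map (ival0 X) ts))"
  using assms cell_vert[of k X] by (subst oc_comp) (auto simp: hv_obj X.oc_action)

lemma ac_f_act: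
  assumes "length as = k" "formal_arrs X as"
  shows "ac (f_act F) (cell k) (cell k) (map (cls X) as) = far F (hfold1 X (map (\<lambda>a. ival1 X (snd (snd a))) as))"
  using assms cell_vert[of k X] by (subst ac_comp) (auto simp: hv_arr X.ac_action)

end

end

section \<open>Formal composites of rows as grids, and the multiplication on them\<close>

subsection \<open>The multiplication\<close>

lemma grid_ends: "grid X k S \<Longrightarrow> t_src S = cell k \<and> t_tgt S = cell k"
  by (induction S) auto

text \<open>Generators exist only from a vertex \<open>cell k\<close> to itself, as the other
  hom-categories are empty; composability then forces one width throughout.\<close>

lemma formal1_hv:
  "formal1 (hg (HV (dd_graph X))) c d S \<longleftrightarrow> (\<exists>k. c = cell k \<and> d = cell k \<and> grid X k S)"
proof
  assume "formal1 (hg (HV (dd_graph X))) c d S"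
  then show "\<exists>k. c = cell k \<and> d = cell k \<and> grid X k S"
    by induction (auto simp: hv_verts hv_obj)
next
  have "grid X k S \<Longrightarrow> formal1 (hg (HV (dd_graph X))) (cell k) (cell k) S" for k
    by (induction S) (auto intro!: formal1.intros cell_vert simp: hv_obj)
  then show "\<exists>k. c = cell k \<and> d = cell k \<and> grid X k S \<Longrightarrow> formal1 (hg (HV (dd_graph X))) c d S"
    by auto
qed

text \<open>A vertex of HV(HV X) is a list of widths, one for each grid of a list of grids.\<close>

definition cells :: "nat list \<Rightarrow> unit list \<times> hv_vert list" where
  "cells ks = (replicate (Suc (length ks)) (), map cell ks)"

lemma snd_cells [simp]: "snd (cells ks) = map cell ks"
  by (simp add: cells_def)

lemma hvv_verts: "c \<in> verts (hg (HV (HV (dd_graph X)))) \<longleftrightarrow> (\<exists>ks. c = cells ks)"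
proof -
  obtain os ps where c: "c = (os, ps)" by (cases c)
  have "set ps \<subseteq> range cell \<longleftrightarrow> (\<exists>ks. ps = map cell ks)"
    using lists_image[of cell UNIV] by (auto simp: lists_eq_set image_def)
  moreover have "verts (hg (HV (dd_graph X))) = range cell"
    by (auto simp: hv_verts)
  moreover have "(os, ps) = cells ks \<longleftrightarrow> length os = Suc (length ps) \<and> ps = map cell ks" for ks
    unfolding cells_def by (auto intro: unit_list_eqI)
  ultimately show ?thesis
    unfolding c HV_def[of "HV _"] by (subst H_verts) auto
qed

lemma cells_vert: "cells ks \<in> verts (hg (HV (HV (dd_graph X))))"
  by (auto simp: hvv_verts)

lemma hvv_obj: "Ss \<in> obj (edge (hg (HV (HV (dd_graph X)))) (cells ks) (cells ls)) \<longleftrightarrow>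
    ks = ls \<and> list_all2 (grid X) ks Ss"
proof -
  have "Ss \<in> obj (edge (hg (HV (HV (dd_graph X)))) (cells ks) (cells ls)) \<longleftrightarrow>
      length ks = length ls \<and> length Ss = length ks \<and>
      (\<forall>i<length ks. formal1 (hg (HV (dd_graph X))) (cell (ks ! i)) (cell (ls ! i)) (Ss ! i))"
    using H_obj[of "V (HV (dd_graph X))" "cells ks" "cells ls" Ss] cells_vert[of ks X] cells_vert[of ls X]
    by (auto simp: HV_def[of "HV _"] free_hom_def)
  also have "\<dots> \<longleftrightarrow> ks = ls \<and> list_all2 (grid X) ks Ss"
    unfolding formal1_hv by (auto simp: list_all2_conv_all_nth list_eq_iff_nth_eq)
  finally show ?thesis .
qed

lemma oc_V_map:
  assumes "() \<in> verts A" "formal1 (hg A) p q t"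
  shows "oc (V_map A B \<Phi>) p q t = eval0 (free_struct (edge B (vmap \<Phi> ()) (vmap \<Phi> ())))
    (cg_comp (hg A) (free_eta (edge B (vmap \<Phi> ()) (vmap \<Phi> ()))) (emap \<Phi> ((), ()))) t"
  using assms formal1_verts[OF assms(2)]
  by (simp add: oc_def V_map_def free_map_def free_eval_def free_hom_def)

lemma tc_V_map2:
  assumes "() \<in> verts A" "formal1 (hg A) p q t"
  shows "tc (V_map2 A B \<Phi> \<tau>) p q t = eval_2cell (free_struct (edge B (vmap \<Phi> ()) (vmap \<Phi> ())))
    (cg_comp (hg A) (free_eta (edge B (vmap \<Phi> ()) (vmap \<Phi> ()))) (emap \<Phi> ((), ())))
    (cg_whiskL (hg A) (free_eta (edge B (vmap \<Phi> ()) (vmap \<Phi> ()))) (emap \<Phi> ((), ())) (\<tau> ((), ()))) t"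
  using assms formal1_verts[OF assms(2)]
  by (simp add: tc_def V_map2_def free_map2_def free_hom_def)

lemma component_tc: "component \<rho> ts = tc \<rho> (cell (length ts)) (cell (length ts)) ts"
  by (simp add: component_def tc_def cell_def Let_def)

lemma cg_comp_fob:
  "c \<in> verts A \<Longrightarrow> d \<in> verts A \<Longrightarrow> x \<in> obj (edge A c d) \<Longrightarrow>
    fob (emap (cg_comp A g f) (c, d)) x = fob (emap g (vmap f c, vmap f d)) (fob (emap f (c, d)) x)"
  by (simp add: graph_comp_def functor_comp_def)

lemma (in dd) oc_V_map_action:
  assumes "grid X k S"
  shows "oc (V_map (HV (dd_graph X)) (dd_graph X) (dd_action X)) (cell k) (cell k) S = collapse X S"
proof -
  let ?Q = "hg (HV (dd_graph X))" and ?G = "one_graph (ucat X)"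
  have "eval0 (free_struct ?G) (cg_comp ?Q (free_eta ?G) (emap (dd_action X) ((), ()))) S = collapse X S"
    using assms
  proof (induction S)
    case (Gen p q ts)
    then have ts: "ts \<in> obj (edge ?Q (cell k) (cell k))" "hfold0 X (map (ival0 X) ts) \<in> obj (ucat X)"
      by (auto simp: hv_obj irow_obj)
    have "fob (emap (emap (dd_action X) ((), ())) (cell k, cell k)) ts = hfold0 X (map (ival0 X) ts)"
      using oc_action[of ts k] Gen by (simp add: oc_def)
    with Gen ts show ?case
      by (simp add: cg_comp_fob free_eta_def cell_vert)
  qed (auto simp: free_struct_def)
  moreover have "formal1 ?Q (cell k) (cell k) S"
    using assms by (auto simp: formal1_hv)
  ultimately show ?thesis by (subst oc_V_map) auto
qed

lemma map_nth_cells: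
  assumes "list_all2 (grid X) ks Ss" and "\<And>k S. grid X k S \<Longrightarrow> S \<in> set Ss \<Longrightarrow> g (cell k) (cell k) S = g' S"
  shows "map (\<lambda>i. g (snd (cells ks) ! i) (snd (cells ks) ! i) (Ss ! i)) [0..<length Ss] = map g' Ss"
  using assms by (auto simp: list_all2_conv_all_nth intro!: nth_equalityI)

lemma vc_H_map_cells:
  assumes "\<And>k. vc \<Phi> (cell k) = cell k"
  shows "vc (H_map (V (HV (dd_graph X))) \<Phi>) (cells ks) = cells ks"
  using assms hvv_verts[of "cells ks" X]
  by (simp add: cells_def HV_def[of "HV _"]) (subst vc_H_map, auto)

lemma vc_H_map_cells_unit:
  fixes X :: "('x, 'm) ddbicat"
    and \<Phi> :: "(unit, hv_vert, (hv_vert, (unit, 'x) tm list) tm,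
      (hv_vert, (unit, 'x) tm list, (unit, 'x, 'm) farr list) farr, unit, unit, 'y, 'n) cggmap"
  shows "vc (H_map (V (HV (dd_graph X))) \<Phi>) (cells ks) = cell (length ks)"
  using hvv_verts[of "cells ks" X]
  by (simp add: cells_def HV_def[of "HV _"]) (subst vc_H_map, auto simp: cell_def intro: unit_list_eqI)

lemma oc_HV_map_action:
  assumes "dd_bicats_category X" "list_all2 (grid X) ks Ss"
  shows "oc (HV_map (HV (dd_graph X)) (dd_graph X) (dd_action X)) (cells ks) (cells ks) Ss = map (collapse X) Ss"
proof -
  interpret dd X by unfold_locales fact
  have "oc (HV_map (HV (dd_graph X)) (dd_graph X) (dd_action X)) (cells ks) (cells ks) Ss
      = map (\<lambda>i. oc (V_map (HV (dd_graph X)) (dd_graph X) (dd_action X)) (snd (cells ks) ! i)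
        (snd (cells ks) ! i) (Ss ! i)) [0..<length Ss]"
    unfolding HV_map_def using hvv_verts[of "cells ks" X] hvv_obj[of Ss X ks ks] assms(2)
    by (subst oc_H_map) (auto simp: HV_def[of "HV _"])
  also have "\<dots> = map (collapse X) Ss"
    by (rule map_nth_cells[OF assms(2)]) (rule oc_V_map_action)
  finally show ?thesis .
qed

lemma oc_V_eta: "() \<in> verts A \<Longrightarrow> p \<in> verts (hg A) \<Longrightarrow> q \<in> verts (hg A) \<Longrightarrow> x \<in> obj (edge (hg A) p q) \<Longrightarrow>
    oc (V_eta A) p q x = Gen p q x"
  by (simp add: oc_def V_eta_def free_eta_def)

lemma free_hom_obj: "t \<in> obj (free_hom G p q) \<longleftrightarrow> formal1 G p q t"
  by (simp add: free_hom_def)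

text \<open>The width is read off from the first vertex, since a coproduct composes inside one
  summand.\<close>

lemma HV_struct_cell:
  "bunit (HV_struct (V (dd_graph X)) () ()) (cell k) = replicate k (Unit ())"
  "bcomp0 (HV_struct (V (dd_graph X)) () ()) (cell k) c d xs ys = map (\<lambda>i. Tens (xs ! i) (ys ! i)) [0..<k]"
  by (auto simp: HV_struct_def coprod_bicat_def prod_bicat_def legs_def free_struct_def cell_def Let_def
      split_beta intro!: nth_equalityI)

text \<open>The distributive law produces a row of composites of composites, which \<open>\<mu>\<close> of \<open>V\<close> then flattens.\<close>

lemma dist_flatten:
  assumes "grid X k S"
  defines "xs \<equiv> oc (dist (V (dd_graph X))) (cell k) (cell k) S"
  shows "length xs = k \<and> list_all (formal1 (free_bicat (one_graph (ucat X))) () ()) xs \<and>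
    map (oc (V_mu (dd_graph X)) () ()) xs = flatten S"
proof -
  let ?VA = "V (dd_graph X)" and ?G = "one_graph (ucat X)"
  let ?F = "emap (H_map ?VA (V_eta ?VA)) ((), ())"
  have vF: "vmap ?F (cell k) = cell k" for k
    using vc_H_map_cell[of ?VA k "V_eta ?VA"] cell_vert[of k X] by (simp add: vc_def HV_def)
  have mu: "oc (V_mu (dd_graph X)) () () x = eval0 (free_struct ?G) (cg_id (free_bicat ?G)) x"
    if "formal1 (free_bicat ?G) () () x" for x
    using that by (simp add: oc_def V_mu_def free_mu_def free_eval_def free_hom_def[of "free_bicat _"])
  have 1: "length (eval0 (HV_struct ?VA () ()) ?F S) = k \<and>
      list_all (formal1 (free_bicat ?G) () ()) (eval0 (HV_struct ?VA () ()) ?F S) \<and>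
      map (eval0 (free_struct ?G) (cg_id (free_bicat ?G))) (eval0 (HV_struct ?VA () ()) ?F S) = flatten S"
    using assms(1)
  proof (induction S)
    case (Gen p q ts)
    then have ts: "ts \<in> obj (edge (hg (H ?VA)) (cell k) (cell k))"
      by (simp add: hv_obj flip: HV_def)
    have "fob (emap ?F (cell k, cell k)) ts = oc (H_map ?VA (V_eta ?VA)) (cell k) (cell k) ts"
      by (simp add: oc_def)
    also have "\<dots> = map (Gen () ()) ts"
      using ts cell_vert[of k X] Gen unfolding HV_def
      by (subst oc_H_map)
        (auto simp: oc_V_eta free_hom_obj list_all_length intro!: nth_equalityI)
    finally have "eval0 (HV_struct ?VA () ()) ?F (Gen p q ts) = map (Gen () ()) ts"
      using Gen by simp
    moreover have "list_all (formal1 (free_bicat ?G) () ()) (map (Gen () ()) ts)"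
      using Gen by (auto simp: list_all_iff free_hom_obj intro!: formal1.gen)
    moreover have "map (eval0 (free_struct ?G) (cg_id (free_bicat ?G))) (map (Gen () ()) ts) = ts"
      using Gen by (auto simp: graph_id_def functor_id_def free_hom_obj list_all_iff intro!: map_idI)
    ultimately show ?case using Gen by simp
  next
    case (Unit p)
    then show ?case
      by (auto simp: vF HV_struct_cell list_all_iff free_struct_def intro: formal1.unit)
  next
    case (Tens S T)
    then have S: "grid X k S" and T: "grid X k T" by auto
    note ends = grid_ends[OF S] grid_ends[OF T]
    let ?e = "eval0 (HV_struct ?VA () ()) ?F" and ?mu = "eval0 (free_struct ?G) (cg_id (free_bicat ?G))"
    have IH: "length (?e S) = k" "list_all (formal1 (free_bicat ?G) () ()) (?e S)" "map ?mu (?e S) = flatten S"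
      "length (?e T) = k" "list_all (formal1 (free_bicat ?G) () ()) (?e T)" "map ?mu (?e T) = flatten T"
      using Tens.IH(1)[OF S] Tens.IH(2)[OF T] by auto
    have e: "?e (Tens S T) = map (\<lambda>i. Tens (?e S ! i) (?e T ! i)) [0..<k]"
      by (simp add: ends vF HV_struct_cell)
    have "map ?mu (?e (Tens S T)) = map2 Tens (map ?mu (?e S)) (map ?mu (?e T))"
      unfolding e using IH(1,4) by (intro nth_equalityI) (auto simp: free_struct_def)
    then have "map ?mu (?e (Tens S T)) = flatten (Tens S T)"
      by (simp only: IH flatten.simps)
    moreover have "list_all (formal1 (free_bicat ?G) () ()) (?e (Tens S T))"
      unfolding e using IH by (auto simp: list_all_length intro: formal1.tens)
    moreover have "length (?e (Tens S T)) = k"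
      unfolding e by simp
    ultimately show ?case by blast
  qed
  have "formal1 (hg (H ?VA)) (cell k) (cell k) S"
    using assms(1) by (auto simp: formal1_hv simp flip: HV_def)
  then have "xs = eval0 (HV_struct ?VA () ()) ?F S"
    using cell_vert[of k X] unfolding xs_def
    by (simp add: oc_def dist_def free_eval_def free_hom_obj HV_def)
  with 1 show ?thesis by (auto simp: list_all_iff mu cong: map_cong)
qed

lemma concat_unit_cells:
  "(concat (map (butlast \<circ> fst) (map cell ks)) @ [u], concat (map snd (map cell ks))) = cell (sum_list ks)"
proof -
  have "length (fst (cell k)) = Suc k" for k
    by (simp add: cell_def)
  then show ?thesis
    by (intro prod_eqI unit_list_eqI) (simp_all add: length_concat comp_def)
qed

text \<open>The three factors are computed in turn: the distributive law makes each grid a row of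
  composites of composites, concatenation joins the rows, and \<mu> of V flattens every
  entry.\<close>

lemma HV_mu_components:
  assumes S: "list_all2 (grid X) ks Ss"
  shows "vc (HV_mu (dd_graph X)) (cells ks) = cell (sum_list ks)"
    and "oc (HV_mu (dd_graph X)) (cells ks) (cells ks) Ss = concat (map flatten Ss)"
proof -
  let ?A = "dd_graph X" and ?c = "cells ks"
  let ?N1 = "H_map (V (HV ?A)) (dist (V ?A))"
  let ?N2 = "cgg_comp (HV (HV ?A)) (H_mu (V (V ?A))) ?N1"
  have c: "?c \<in> verts (hg (HV (HV ?A)))" by (auto simp: hvv_verts)
  have Ss: "Ss \<in> obj (edge (hg (HV (HV ?A))) ?c ?c)" using S by (simp add: hvv_obj)
  have vdist: "vc (dist (V ?A)) (cell k) = cell k" for k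
    using vc_H_map_cell[of "V ?A" k "V_eta (V ?A)"] cell_vert[of k X]
    by (simp add: vc_def dist_def free_eval_def HV_def)
  have v1: "vc ?N1 ?c = ?c" by (rule vc_H_map_cells[OF vdist])
  \<comment> \<open>\<open>map_nth_cells\<close> asks for a function of the grid alone, so its width
    is recovered as the length of its flattening.\<close>
  define d where "d S = oc (dist (V ?A)) (cell (length (flatten S))) (cell (length (flatten S))) S" for S
  have o1: "oc ?N1 ?c ?c Ss = map d Ss"
  proof -
    have "oc ?N1 ?c ?c Ss = map (\<lambda>i. oc (dist (V ?A)) (snd ?c ! i) (snd ?c ! i) (Ss ! i)) [0..<length Ss]"
      using c Ss by (subst oc_H_map) (auto simp: HV_def[of "HV _"])
    also have "\<dots> = map d Ss"
      by (rule map_nth_cells[OF S]) (auto simp: d_def dest: grid_flatten)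
    finally show ?thesis .
  qed
  have d: "length (d S) = k \<and> list_all (formal1 (free_bicat (one_graph (ucat X))) () ()) (d S) \<and>
      map (oc (V_mu ?A) () ()) (d S) = flatten S" if "grid X k S" for k S
    using dist_flatten[OF that] grid_flatten[OF that] by (simp add: d_def)
  have cellV: "cell k \<in> verts (hg (H (V (V ?A))))" for k
    unfolding cell_def by (subst H_verts) auto
  have objV: "xs \<in> obj (edge (hg (H (V (V ?A)))) (cell k) (cell k)) \<longleftrightarrow>
      length xs = k \<and> list_all (formal1 (free_bicat (one_graph (ucat X))) () ()) xs" for xs k
    using H_obj[of "V (V ?A)" "cell k" "cell k" xs] cellV[of k]
    by (auto simp: free_hom_obj list_all_length cell_def)
  have cV: "?c \<in> verts (hg (H (H (V (V ?A)))))"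
    unfolding cells_def by (subst H_verts) (auto simp: cellV)
  have dV: "map d Ss \<in> obj (edge (hg (H (H (V (V ?A))))) ?c ?c)"
    using H_obj[of "H (V (V ?A))" ?c ?c "map d Ss"] cV S d
    by (auto simp: objV list_all2_conv_all_nth)
  have v2: "vc ?N2 ?c = cell (sum_list ks)"
    using c cV by (simp add: vc_comp v1 vc_H_mu concat_unit_cells del: map_map)
  have o2: "oc ?N2 ?c ?c Ss = concat (map d Ss)"
    using c Ss cV dV by (simp add: oc_comp v1 o1 oc_H_mu)
  have len: "length (concat (map d Ss)) = sum_list ks \<and>
      list_all (formal1 (free_bicat (one_graph (ucat X))) () ()) (concat (map d Ss)) \<and>
      map (oc (V_mu ?A) () ()) (concat (map d Ss)) = concat (map flatten Ss)"
    using S by (induction rule: list_all2_induct) (use d in auto)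
  have o2V: "concat (map d Ss) \<in> obj (edge (hg (H (V (V ?A)))) (cell (sum_list ks)) (cell (sum_list ks)))"
    using len by (simp add: objV)
  show "vc (HV_mu ?A) ?c = cell (sum_list ks)"
    unfolding HV_mu_def using c cellV
    by (simp add: vc_comp[of "HV (HV ?A)"] v2 vc_H_map_cell)
  show "oc (HV_mu ?A) ?c ?c Ss = concat (map flatten Ss)"
  proof -
    have "oc (HV_mu ?A) ?c ?c Ss = oc (H_map (V (V ?A)) (V_mu ?A)) (cell (sum_list ks)) (cell (sum_list ks)) (concat (map d Ss))"
      unfolding HV_mu_def using c Ss by (subst oc_comp) (auto simp: v2 o2)
    also have "\<dots> = map (oc (V_mu ?A) () ()) (concat (map d Ss))"
      using o2V cellV by (subst oc_H_map) (auto intro!: nth_equalityI)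
    finally show ?thesis using len by simp
  qed
qed

section \<open>The axioms of a weak map as conditions on components\<close>

subsection \<open>The conditions on a weak map\<close>

text \<open>Cutting off the values outside the domain gives \<open>shape\<close>, so that equal
  components yield equal 2-cells.\<close>

definition mk_cell :: "('x, 'm) ddbicat \<Rightarrow> ((unit, 'x) tm list \<Rightarrow> 'n) \<Rightarrow>
    (unit, hv_vert, (unit, 'x) tm list, 'n) cgg2cell" where
  "mk_cell X R = (\<lambda>_. \<lambda>(c, d)\<in>verts (hg (HV (dd_graph X))) \<times> verts (hg (HV (dd_graph X))).
     \<lambda>ts\<in>obj (edge (hg (HV (dd_graph X))) c d). R ts)"

lemma shape_mk_cell: "shape (HV (dd_graph X)) (mk_cell X R)"
  by (auto simp: shape_def mk_cell_def)

lemma component_mk_cell: "list_all (formal_obj X) ts \<Longrightarrow> component (mk_cell X R) ts = R ts"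
  by (simp add: component_tc tc_def mk_cell_def cell_vert hv_obj)

lemma shape_component_eqI:
  assumes "shape (HV (dd_graph X)) \<sigma>" "shape (HV (dd_graph X)) \<tau>"
    and "\<And>ts. list_all (formal_obj X) ts \<Longrightarrow> component \<sigma> ts = component \<tau> ts"
  shows "\<sigma> = \<tau>"
  using assms by (auto simp: shape_eq_iff[OF assms(1,2)] hv_verts hv_obj component_tc)

text \<open>Only the hom-categories from \<open>cell k\<close> to itself are inhabited, so
  quantification over pairs of vertices becomes quantification over rows of all lengths.\<close>

lemma hv_2cell_iff:
  "cgg_2cell (HV (dd_graph X)) (dd_graph Y) \<Phi> \<Psi> \<tau> \<longleftrightarrow> shape (HV (dd_graph X)) \<tau> \<and>
    (\<forall>ts. list_all (formal_obj X) ts \<longrightarrow> component \<tau> ts \<in> hom (ucat Y)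
      (oc \<Phi> (cell (length ts)) (cell (length ts)) ts) (oc \<Psi> (cell (length ts)) (cell (length ts)) ts)) \<and>
    (\<forall>as. formal_arrs X as \<longrightarrow>
      cmp (ucat Y) (component \<tau> (map (\<lambda>a. fst (snd a)) as))
        (ac \<Phi> (cell (length as)) (cell (length as)) (map (cls X) as)) =
      cmp (ucat Y) (ac \<Psi> (cell (length as)) (cell (length as)) (map (cls X) as))
        (component \<tau> (map fst as)))"
proof -
  have obj: "(\<forall>c\<in>verts (hg (HV (dd_graph X))). \<forall>d\<in>verts (hg (HV (dd_graph X))).
      \<forall>x\<in>obj (edge (hg (HV (dd_graph X))) c d). P c d x) \<longleftrightarrow>
      (\<forall>ts. list_all (formal_obj X) ts \<longrightarrow> P (cell (length ts)) (cell (length ts)) ts)" for P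
    by (auto simp: hv_verts hv_obj)
  have arr: "(\<forall>c\<in>verts (hg (HV (dd_graph X))). \<forall>d\<in>verts (hg (HV (dd_graph X))).
      \<forall>f\<in>arr (edge (hg (HV (dd_graph X))) c d). P c d f) \<longleftrightarrow>
      (\<forall>as. formal_arrs X as \<longrightarrow> P (cell (length as)) (cell (length as)) (map (cls X) as))" for P
  proof (intro iffI allI impI ballI)
    fix as assume "\<forall>c\<in>verts (hg (HV (dd_graph X))). \<forall>d\<in>verts (hg (HV (dd_graph X))).
      \<forall>f\<in>arr (edge (hg (HV (dd_graph X))) c d). P c d f" and "formal_arrs X as"
    then show "P (cell (length as)) (cell (length as)) (map (cls X) as)"
      using cell_vert[of "length as" X] hv_arr[of "map (cls X) as" X "length as" "length as"] by blast
  next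
    fix c d f assume P: "\<forall>as. formal_arrs X as \<longrightarrow> P (cell (length as)) (cell (length as)) (map (cls X) as)"
      and "c \<in> verts (hg (HV (dd_graph X)))" "d \<in> verts (hg (HV (dd_graph X)))"
      and f: "f \<in> arr (edge (hg (HV (dd_graph X))) c d)"
    then obtain k l where c: "c = cell k" and d: "d = cell l" unfolding hv_verts by blast
    from f show "P c d f" unfolding c d hv_arr using P by blast
  qed
  show ?thesis
    unfolding cgg_2cell_iff[of "HV (dd_graph X)", simplified] ball_conj_distrib obj arr
    by (simp add: hv_ends component_tc)
qed

text \<open>The components of \<open>mk_cell\<close> are known to agree with the recursive family on
  rows of formal 1-cells, and the conditions evaluate the family at such rows only.\<close>

lemma weak_family_cong:
  assumes "\<And>ts. list_all (formal_obj X) ts \<Longrightarrow> R ts = R' ts" and X: "dd_bicats_category X"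
  shows "weak_family X Y F R \<longleftrightarrow> weak_family X Y F R'"
proof -
  interpret dd X by unfold_locales fact
  have p: "paste Y R S = paste Y R' S" if "grid X k S" for k S
    using that by (induction S) (auto simp: assms(1))
  have "list_all (formal_obj X) (map (collapse X) Ss) \<and> list_all (formal_obj X) (concat (map flatten Ss))
      \<and> hfold1 Y (map (paste Y R) Ss) = hfold1 Y (map (paste Y R') Ss)"
    if "list_all2 (grid X) ks Ss" for ks Ss
    using that by (induction rule: list_all2_induct) (auto simp: p collapse_obj dest: grid_flatten)
  moreover have "list_all (formal_obj X) (map fst as) \<and> list_all (formal_obj X) (map (\<lambda>a. fst (snd a)) as)"
    if "formal_arrs X as" for as
    using that formal_arr_objs by (auto simp: list_all_iff)
  moreover have "list_all (formal_obj X) [Gen () () a]" if "a \<in> obj (ucat X)" for a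
    using that by (auto intro: formal1.gen)
  ultimately show ?thesis
    unfolding weak_family_def by (simp add: assms(1) cong: conj_cong imp_cong)
qed

context dd_pair
begin

context
  fixes F assumes F: "cat_functor (ucat X) (ucat Y) F"
begin

abbreviation (input) "src_row ts \<equiv> hfold0 Y (map (val0 Y F) ts)"
abbreviation (input) "tgt_row ts \<equiv> fob F (hfold0 X (map (ival0 X) ts))"

lemma two_cell_iff:
  "cgg_2cell (HV (dd_graph X)) (dd_graph Y) (act_Tf F) (f_act F) \<rho> \<longleftrightarrow> shape (HV (dd_graph X)) \<rho> \<and>
    (\<forall>ts. list_all (formal_obj X) ts \<longrightarrow> component \<rho> ts \<in> hom (ucat Y) (src_row ts) (tgt_row ts)) \<and>
    (\<forall>as. formal_arrs X as \<longrightarrow>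
      component \<rho> (map (\<lambda>a. fst (snd a)) as) \<cdot> hfold1 Y (map (\<lambda>a. val1 Y F (snd (snd a))) as) =
      far F (hfold1 X (map (\<lambda>a. ival1 X (snd (snd a))) as)) \<cdot> component \<rho> (map fst as))"
  by (simp add: hv_2cell_iff oc_act_Tf[OF F] oc_f_act[OF F] ac_act_Tf[OF F] ac_f_act[OF F] cong: imp_cong)

lemma vcomp_eq_id_iff:
  "cgg_vcomp (HV (dd_graph X)) (dd_graph Y) \<Phi> \<sigma> \<tau> = cgg_id2 (HV (dd_graph X)) (dd_graph Y) \<Phi> \<longleftrightarrow>
    (\<forall>ts. list_all (formal_obj X) ts \<longrightarrow> component \<sigma> ts \<cdot> component \<tau> ts
      = ide (ucat Y) (oc \<Phi> (cell (length ts)) (cell (length ts)) ts))"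
  by (subst shape_eq_iff[OF shape_ops(2,3)])
    (auto simp: hv_verts hv_obj tc_vcomp tc_id2 cell_vert component_tc)

text \<open>Componentwise inverses are again natural, by \<open>invert_square\<close>.\<close>

lemma invertible_iff:
  assumes \<rho>: "cgg_2cell (HV (dd_graph X)) (dd_graph Y) (act_Tf F) (f_act F) \<rho>"
  shows "(\<exists>\<sigma>. cgg_2cell (HV (dd_graph X)) (dd_graph Y) (f_act F) (act_Tf F) \<sigma> \<and>
      cgg_vcomp (HV (dd_graph X)) (dd_graph Y) (act_Tf F) \<sigma> \<rho> = cgg_id2 (HV (dd_graph X)) (dd_graph Y) (act_Tf F) \<and>
      cgg_vcomp (HV (dd_graph X)) (dd_graph Y) (f_act F) \<rho> \<sigma> = cgg_id2 (HV (dd_graph X)) (dd_graph Y) (f_act F))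
    \<longleftrightarrow> (\<forall>ts. list_all (formal_obj X) ts \<longrightarrow> component \<rho> ts \<in> isos (ucat Y) (src_row ts) (tgt_row ts))"
    (is "(\<exists>\<sigma>. ?inv \<sigma>) \<longleftrightarrow> ?isos")
proof
  note hom = \<rho>[unfolded two_cell_iff]
  assume "\<exists>\<sigma>. ?inv \<sigma>"
  then obtain \<sigma> where "?inv \<sigma>" by blast
  then show ?isos
    using hom unfolding vcomp_eq_id_iff
    by (auto simp: hv_2cell_iff oc_act_Tf[OF F] oc_f_act[OF F] intro!: Y.v.isosI[of _ _ _ "component \<sigma> _"])
next
  note hom = \<rho>[unfolded two_cell_iff]
  assume iso: ?isos
  define \<sigma> where "\<sigma> = mk_cell X (\<lambda>ts. inv_arr (ucat Y) (component \<rho> ts))"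
  have \<sigma>: "component \<sigma> ts = inv_arr (ucat Y) (component \<rho> ts)" if "list_all (formal_obj X) ts" for ts
    unfolding \<sigma>_def by (rule component_mk_cell[OF that])
  have "component \<sigma> (map (\<lambda>a. fst (snd a)) as) \<cdot> far F (hfold1 X (map (\<lambda>a. ival1 X (snd (snd a))) as))
      = hfold1 Y (map (\<lambda>a. val1 Y F (snd (snd a))) as) \<cdot> component \<sigma> (map fst as)"
    if as: "formal_arrs X as" for as
  proof -
    have o: "list_all (formal_obj X) (map fst as)" "list_all (formal_obj X) (map (\<lambda>a. fst (snd a)) as)"
      using as X.formal_arr_objs by (auto simp: list_all_iff)
    note fold = fold_homs[OF F as]
    show ?thesis
      unfolding \<sigma>[OF o(1)] \<sigma>[OF o(2)] using iso o as hom
      by (intro Y.v.invert_square[OF fold(1) functor_hom[OF F fold(2)], symmetric]) (auto simp del: map_map)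
  qed
  moreover have "shape (HV (dd_graph X)) \<sigma>"
    unfolding \<sigma>_def by (rule shape_mk_cell)
  ultimately have "?inv \<sigma>"
    unfolding vcomp_eq_id_iff hv_2cell_iff using iso
    by (simp add: \<sigma> Y.v.inv_hom Y.v.inv_left Y.v.inv_right oc_act_Tf[OF F] oc_f_act[OF F] ac_act_Tf[OF F]
        ac_f_act[OF F] cong: imp_cong)
      (auto intro: Y.v.inv_left Y.v.inv_right)
  then show "\<exists>\<sigma>. ?inv \<sigma>" by blast
qed

text \<open>V of \<rho> at a grid is a class of formal 2-cells over Y whose generators are
  components of \<rho>. Some representative is enough, because the action of Y depends on its value,
  and that value is \<open>paste\<close>.\<close>

lemma tc_V_map2_row:
  assumes \<rho>: "\<forall>ts. list_all (formal_obj X) ts \<longrightarrow> component \<rho> ts \<in> arr (ucat Y)"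
    and S: "grid X k S"
  shows "\<exists>a. formal_arr Y (fst a) (fst (snd a)) (snd (snd a)) \<and>
    tc (V_map2 (HV (dd_graph X)) (dd_graph Y) (act_Tf F) \<rho>) (cell k) (cell k) S = cls Y a \<and>
    ival1 Y (snd (snd a)) = paste Y (component \<rho>) S"
proof -
  let ?Q = "hg (HV (dd_graph X))" and ?G = "one_graph (ucat Y)" and ?\<Phi> = "emap (act_Tf F) ((), ())"
  let ?e = "eval_2cell (free_struct ?G) (cg_comp ?Q (free_eta ?G) ?\<Phi>)
    (cg_whiskL ?Q (free_eta ?G) ?\<Phi> (\<rho> ((), ())))"
  interpret G: cgraph ?G by (rule cgraph_one_graph[OF Y.v.category])
  have "\<exists>a. formal_arr Y (fst a) (fst (snd a)) (snd (snd a)) \<and> ?e S = cls Y a \<and>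
      ival1 Y (snd (snd a)) = paste Y (component \<rho>) S"
    using S
  proof (induction S)
    case (Gen p q ts)
    let ?m = "component \<rho> ts"
    have m: "?m \<in> arr (ucat Y)" using Gen \<rho> by simp
    have "cg_whiskL ?Q (free_eta ?G) ?\<Phi> (\<rho> ((), ())) (cell k, cell k) ts
        = fclass ?G () () (Gen () () (src (ucat Y) ?m)) (Gen () () (tgt (ucat Y) ?m)) (GenC () () ?m)"
      using Gen m by (simp add: graph_whiskL_def nat_whiskL_def cell_vert hv_obj component_tc tc_def free_eta_def)
    moreover have "formal_arr Y (Gen () () (src (ucat Y) ?m)) (Gen () () (tgt (ucat Y) ?m)) (GenC () () ?m)"
      using Y.v.arr_hom[OF m] by (auto intro: formal2.gen)
    ultimately show ?case
      using Gen m
      by (intro exI[of _ "(Gen () () (src (ucat Y) ?m), Gen () () (tgt (ucat Y) ?m), GenC () () ?m)"])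
        (simp add: cls_def)
  next
    case (Unit p)
    have "formal_arr Y (Unit ()) (Unit ()) (IdeC (Unit ()))"
      by (intro formal2.ide formal1.unit) simp
    then show ?case
      by (intro exI[of _ "(Unit (), Unit (), IdeC (Unit ()))"])
        (simp add: cls_def free_struct_def free_hom_def free_bicat_def)
  next
    case (Tens S T)
    then obtain a b where
      a: "formal_arr Y (fst a) (fst (snd a)) (snd (snd a))" "?e S = cls Y a"
        "ival1 Y (snd (snd a)) = paste Y (component \<rho>) S" and
      b: "formal_arr Y (fst b) (fst (snd b)) (snd (snd b))" "?e T = cls Y b"
        "ival1 Y (snd (snd b)) = paste Y (component \<rho>) T"
      by auto
    have "?e (Tens S T) = bcomp1 (free_struct ?G) () () () (?e S) (?e T)"
      by simp
    also have "\<dots> = cls Y (Tens (fst a) (fst b), Tens (fst (snd a)) (fst (snd b)), TensC (snd (snd a)) (snd (snd b)))"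
      unfolding a(2) b(2) cls_def using G.free_tens[OF a(1) b(1)] by simp
    finally show ?case
      using a b
      by (intro exI[of _ "(Tens (fst a) (fst b), Tens (fst (snd a)) (fst (snd b)), TensC (snd (snd a)) (snd (snd b)))"])
        (auto intro: formal2.tens)
  qed
  moreover have "formal1 ?Q (cell k) (cell k) S"
    using S by (auto simp: formal1_hv)
  ultimately show ?thesis by (subst tc_V_map2) auto
qed

lemma vc_HV_map_cells: "vc (HV_map (HV (dd_graph X)) B \<Phi>) (cells ks) = cell (length ks)"
  unfolding HV_map_def by (rule vc_H_map_cells_unit)

lemma paste_component:
  assumes \<rho>: "\<forall>ts. list_all (formal_obj X) ts \<longrightarrow> component \<rho> ts \<in> arr (ucat Y)"
    and S: "list_all2 (grid X) ks Ss"
  shows "tc (cgg_whiskL (HV (HV (dd_graph X))) (dd_action Y) (HV_map (HV (dd_graph X)) (dd_graph Y) (act_Tf F))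
      (HV_map2 (HV (dd_graph X)) (dd_graph Y) (act_Tf F) \<rho>)) (cells ks) (cells ks) Ss
    = hfold1 Y (map (paste Y (component \<rho>)) Ss)"
proof -
  let ?t = "\<lambda>c. tc (V_map2 (HV (dd_graph X)) (dd_graph Y) (act_Tf F) \<rho>) c c"
  let ?P = "\<lambda>k S a. formal_arr Y (fst a) (fst (snd a)) (snd (snd a)) \<and> ?t (cell k) S = cls Y a \<and>
    ival1 Y (snd (snd a)) = paste Y (component \<rho>) S"
  have Ss: "Ss \<in> obj (edge (hg (HV (HV (dd_graph X)))) (cells ks) (cells ks))"
    using S by (simp add: hvv_obj)
  \<comment> \<open>One representative is chosen for each grid, again with the width recovered from
    the flattening.\<close>
  define a where "a S = (SOME a. ?P (length (flatten S)) S a)" for S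
  have a: "?P k S (a S)" if "grid X k S" for k S
    using someI_ex[OF tc_V_map2_row[OF \<rho> that]] grid_flatten[OF that] unfolding a_def by auto
  have "tc (HV_map2 (HV (dd_graph X)) (dd_graph Y) (act_Tf F) \<rho>) (cells ks) (cells ks) Ss
      = map (\<lambda>i. tc (V_map2 (HV (dd_graph X)) (dd_graph Y) (act_Tf F) \<rho>) (snd (cells ks) ! i) (snd (cells ks) ! i) (Ss ! i))
        [0..<length Ss]"
    unfolding HV_map2_def using Ss cells_vert[of ks X]
    by (subst tc_H_map2) (auto simp: HV_def[of "HV _"])
  also have "\<dots> = map (\<lambda>S. cls Y (a S)) Ss"
    by (rule map_nth_cells[OF S]) (use a in blast)
  finally have 1: "tc (HV_map2 (HV (dd_graph X)) (dd_graph Y) (act_Tf F) \<rho>) (cells ks) (cells ks) Ss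
      = map (cls Y) (map a Ss)" by simp
  have "formal_arrs Y (map a Ss) \<and> map (\<lambda>a. ival1 Y (snd (snd a))) (map a Ss) = map (paste Y (component \<rho>)) Ss"
    using S by (induction rule: list_all2_induct) (use a in auto)
  moreover have "length ks = length Ss"
    using S by (rule list_all2_lengthD)
  ultimately show ?thesis
    using Ss cells_vert[of ks X] Y.ac_action[of "map a Ss" "length ks"]
    by (simp add: tc_whiskL 1 vc_HV_map_cells del: map_map)
qed

text \<open>The two 2-cells are compared at objects of HV(HV X), which are the lists of grids: one
  side pastes the rows and then evaluates \<rho> at the collapsed row, the other evaluates \<rho> at
  the flattened row.\<close>

lemma mult_iff:
  assumes \<rho>: "\<forall>ts. list_all (formal_obj X) ts \<longrightarrow> component \<rho> ts \<in> arr (ucat Y)"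
  shows "cgg_vcomp (HV (HV (dd_graph X))) (dd_graph Y)
      (cgg_comp (HV (HV (dd_graph X))) (dd_action Y) (HV_map (HV (dd_graph X)) (dd_graph Y) (act_Tf F)))
      (cgg_whiskR (HV (HV (dd_graph X))) \<rho> (HV_map (HV (dd_graph X)) (dd_graph X) (dd_action X)))
      (cgg_whiskL (HV (HV (dd_graph X))) (dd_action Y) (HV_map (HV (dd_graph X)) (dd_graph Y) (act_Tf F))
        (HV_map2 (HV (dd_graph X)) (dd_graph Y) (act_Tf F) \<rho>))
    = cgg_whiskR (HV (HV (dd_graph X))) \<rho> (HV_mu (dd_graph X)) \<longleftrightarrow>
    (\<forall>ks Ss. list_all2 (grid X) ks Ss \<longrightarrow>
      component \<rho> (map (collapse X) Ss) \<cdot> hfold1 Y (map (paste Y (component \<rho>)) Ss)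
      = component \<rho> (concat (map flatten Ss)))"
    (is "?L = ?R \<longleftrightarrow> _")
proof -
  have L: "tc ?L (cells ks) (cells ks) Ss
      = component \<rho> (map (collapse X) Ss) \<cdot> hfold1 Y (map (paste Y (component \<rho>)) Ss)"
    if S: "list_all2 (grid X) ks Ss" for ks Ss
  proof -
    have "Ss \<in> obj (edge (hg (HV (HV (dd_graph X)))) (cells ks) (cells ks))"
      using S by (simp add: hvv_obj)
    then show ?thesis
      using cells_vert[of ks X] list_all2_lengthD[OF S]
      by (simp add: tc_vcomp paste_component[OF \<rho> S] tc_whiskR oc_HV_map_action[OF X.dd S] component_tc
          vc_HV_map_cells)
  qed
  have R: "tc ?R (cells ks) (cells ks) Ss = component \<rho> (concat (map flatten Ss))"
    if S: "list_all2 (grid X) ks Ss" for ks Ss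
  proof -
    have "Ss \<in> obj (edge (hg (HV (HV (dd_graph X)))) (cells ks) (cells ks))"
      using S by (simp add: hvv_obj)
    moreover have "length (concat (map flatten Ss)) = sum_list ks"
      using S by (induction rule: list_all2_induct) (auto dest: grid_flatten)
    ultimately show ?thesis
      using cells_vert[of ks X] by (simp add: tc_whiskR HV_mu_components[OF S] component_tc)
  qed
  have hvv_ball: "(\<forall>c\<in>verts (hg (HV (HV (dd_graph X)))). \<forall>d\<in>verts (hg (HV (HV (dd_graph X)))).
      \<forall>Ss\<in>obj (edge (hg (HV (HV (dd_graph X)))) c d). P c d Ss) \<longleftrightarrow>
      (\<forall>ks Ss. list_all2 (grid X) ks Ss \<longrightarrow> P (cells ks) (cells ks) Ss)" for P
  proof (intro iffI allI impI)
    fix ks Ss assume "list_all2 (grid X) ks Ss" and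
      "\<forall>c\<in>verts (hg (HV (HV (dd_graph X)))). \<forall>d\<in>verts (hg (HV (HV (dd_graph X)))).
        \<forall>Ss\<in>obj (edge (hg (HV (HV (dd_graph X)))) c d). P c d Ss"
    then show "P (cells ks) (cells ks) Ss"
      using cells_vert[of ks X] hvv_obj[of Ss X ks ks] by blast
  qed (auto simp: hvv_verts hvv_obj)
  have "?L = ?R \<longleftrightarrow> (\<forall>ks Ss. list_all2 (grid X) ks Ss \<longrightarrow> tc ?L (cells ks) (cells ks) Ss = tc ?R (cells ks) (cells ks) Ss)"
    by (subst shape_eq_iff[OF shape_ops(2,1)]) (simp_all add: hvv_ball)
  then show ?thesis by (simp add: L R cong: imp_cong)
qed

lemma unit_iff:
  "cgg_whiskR (dd_graph X) \<rho> (HV_eta (dd_graph X)) = cgg_id2 (dd_graph X) (dd_graph Y) (two_map F) \<longleftrightarrow>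
    (\<forall>a\<in>obj (ucat X). component \<rho> [Gen () () a] = ide (ucat Y) (fob F a))"
proof -
  let ?A = "dd_graph X"
  have "vc (HV_eta ?A) () = cell 1"
    by (simp add: HV_eta_def vc_comp) (simp add: vc_def H_eta_def cell_def)
  moreover have "oc (HV_eta ?A) () () a = [Gen () () a]" if "a \<in> obj (ucat X)" for a
  proof -
    have "Gen () () a \<in> obj (free_hom (one_graph (ucat X)) () ())"
      using that by (auto simp: free_hom_obj intro: formal1.gen)
    then show ?thesis
      using that by (simp add: HV_eta_def oc_comp oc_V_eta) (simp add: oc_def H_eta_def)
  qed
  ultimately show ?thesis
    by (subst shape_eq_iff[OF shape_ops(1,3)]) (auto simp: tc_whiskR tc_id2 component_tc)
qed

end

text \<open>If F is not a functor or \<rho> is not a 2-cell, both sides fail; the componentwise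
  translations then apply in the remaining case.\<close>

lemma HV_weak_map_iff:
  "HV_weak_map (dd_graph X) (dd_action X) (dd_graph Y) (dd_action Y) (two_map F) \<rho> \<longleftrightarrow>
    shape (HV (dd_graph X)) \<rho> \<and> weak_family X Y F (component \<rho>)"
proof (cases "cat_functor (ucat X) (ucat Y) F")
  case False
  then show ?thesis
    by (auto simp: HV_weak_map_def Let_def weak_family_def graph_1cell_def)
next
  case F: True
  have 1: "cgg_1cell (dd_graph X) (dd_graph Y) (two_map F)"
    using F by (auto simp: graph_1cell_def two_map_def one_map_def extensional_def)
  show ?thesis
  proof (cases "cgg_2cell (HV (dd_graph X)) (dd_graph Y) (act_Tf F) (f_act F) \<rho>")
    case \<rho>: True
    have arr: "\<forall>ts. list_all (formal_obj X) ts \<longrightarrow> component \<rho> ts \<in> arr (ucat Y)"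
      using \<rho> unfolding two_cell_iff[OF F] by (auto dest: homD)
    show ?thesis
      using \<rho>[unfolded two_cell_iff[OF F]]
      unfolding HV_weak_map_def Let_def weak_family_def
        invertible_iff[OF F \<rho>] mult_iff[OF F arr] unit_iff[OF F] by (simp add: 1 F \<rho>)
  next
    case False
    then show ?thesis
      unfolding HV_weak_map_def Let_def weak_family_def
      by (auto simp: two_cell_iff[OF F] dest: Y.v.isos_hom)
  qed
qed

end

section \<open>The bijection between weak maps and constraint data\<close>

theorem proposition3p2:
  fixes X :: "('x, 'm) ddbicat" and Y :: "('y, 'n) ddbicat"
  assumes "dd_bicats_category X" and "dd_bicats_category Y"
  shows "bij_betw (dd_constraints X) (dd_weak_maps X Y) (dd_constraint_data X Y)"
proof -
  interpret dd_pair X Y by unfold_locales fact+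
  have dd_constraints_two_map: "dd_constraints X (two_map F, \<rho>) =
      (F, (\<lambda>(a, b)\<in>obj (ucat X) \<times> obj (ucat X). component \<rho> [Tens (Gen () () a) (Gen () () b)]),
        (\<lambda>(a, b)\<in>obj (ucat X) \<times> obj (ucat X). component \<rho> [Gen () () a, Gen () () b]), component \<rho> [])"
    for F and \<rho> :: "(unit, hv_vert, (unit, 'x) tm list, 'n) cgg2cell"
    by (simp add: dd_constraints_def)
  \<comment> \<open>Every graph map in question is some \<open>two_map F\<close>, so a weak map is a
    functor with a family of components.\<close>
  have weak_maps: "dd_weak_maps X Y =
      {(two_map F, \<rho>) | F \<rho>. shape (HV (dd_graph X)) \<rho> \<and> weak_family X Y F (component \<rho>)}"
  proof -
    have "HV_weak_map (dd_graph X) (dd_action X) (dd_graph Y) (dd_action Y) f \<rho> \<longleftrightarrow>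
        (\<exists>F. f = two_map F \<and> shape (HV (dd_graph X)) \<rho> \<and> weak_family X Y F (component \<rho>))" for f \<rho>
    proof -
      obtain G where f: "f = two_map G" using two_map_cases by blast
      have "two_map G = two_map F \<longleftrightarrow> F = G" for F :: "('x, 'm, 'y, 'n) func"
        by (metis two_map_simps(2) one_map_simps(2))
      then show ?thesis unfolding f HV_weak_map_iff by simp
    qed
    then show ?thesis unfolding dd_weak_maps_def by auto
  qed
  show ?thesis
    unfolding bij_betw_def
  proof (intro conjI inj_onI subset_antisym subsetI)
    fix p q assume p: "p \<in> dd_weak_maps X Y" and q: "q \<in> dd_weak_maps X Y"
      and eq: "dd_constraints X p = dd_constraints X q"
    obtain F \<rho> where F: "p = (two_map F, \<rho>)" "shape (HV (dd_graph X)) \<rho>" "weak_family X Y F (component \<rho>)"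
      using p weak_maps by auto
    obtain F' \<rho>' where F': "q = (two_map F', \<rho>')" "shape (HV (dd_graph X)) \<rho>'" "weak_family X Y F' (component \<rho>')"
      using q weak_maps by auto
    have FF': "F = F'" and eta: "component \<rho> [] = component \<rho>' []"
      and v: "(\<lambda>(a, b)\<in>obj (ucat X) \<times> obj (ucat X). component \<rho> [Tens (Gen () () a) (Gen () () b)])
        = (\<lambda>(a, b)\<in>obj (ucat X) \<times> obj (ucat X). component \<rho>' [Tens (Gen () () a) (Gen () () b)])"
      and h: "(\<lambda>(a, b)\<in>obj (ucat X) \<times> obj (ucat X). component \<rho> [Gen () () a, Gen () () b])
        = (\<lambda>(a, b)\<in>obj (ucat X) \<times> obj (ucat X). component \<rho>' [Gen () () a, Gen () () b])"
      using eq unfolding F(1) F'(1) dd_constraints_two_map by auto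
    \<comment> \<open>Injectivity: equal constraints give equal values at two generators and at the
      empty row, hence at all rows, and \<open>shape\<close> turns this into equality of
      2-cells.\<close>
    have "component \<rho> ts = component \<rho>' ts" if "list_all (formal_obj X) ts" for ts
    proof (rule weak_family_unique[where F = F and R = "component \<rho>" and R' = "component \<rho>'",
          OF F(3) _ _ _ eta that])
      show "weak_family X Y F (component \<rho>')" using F'(3) FF' by simp
      fix a b assume "a \<in> obj (ucat X)" "b \<in> obj (ucat X)"
      then show "component \<rho> [Tens (Gen () () a) (Gen () () b)] = component \<rho>' [Tens (Gen () () a) (Gen () () b)]"
        "component \<rho> [Gen () () a, Gen () () b] = component \<rho>' [Gen () () a, Gen () () b]"
        using fun_cong[OF v, of "(a, b)"] fun_cong[OF h, of "(a, b)"] by simp_all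
    qed
    then show "p = q"
      using F F' FF' by (auto intro: shape_component_eqI)
  next
    fix y assume "y \<in> dd_constraints X ` dd_weak_maps X Y"
    then obtain F \<rho> where y: "y = dd_constraints X (two_map F, \<rho>)" and \<rho>: "weak_family X Y F (component \<rho>)"
      using weak_maps by auto
    interpret dd_family X Y F "component \<rho>" by unfold_locales fact
    show "y \<in> dd_constraint_data X Y"
      unfolding y dd_constraints_two_map dd_constraint_data_def
      using vert_monoidal hor_monoidal interaction by simp
  next
    fix y assume y: "y \<in> dd_constraint_data X Y"
    then obtain F v h \<eta> where yy: "y = (F, v, h, \<eta>)"
      and d: "monoidal_functor (vert X) (vert Y) F v \<eta>" "monoidal_functor (hor X) (hor Y) F h \<eta>"
        "interaction X Y v h"
      unfolding dd_constraint_data_def by auto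
    interpret dd_constrained X Y F v h \<eta> by unfold_locales fact+
    \<comment> \<open>Surjectivity: the 2-cell whose components are the recursive family.\<close>
    let ?\<rho> = "mk_cell X r"
    \<comment> \<open>As v and h are extensional, recovering them on objects recovers them as
      functions.\<close>
    have ext: "v \<in> extensional (obj (ucat X) \<times> obj (ucat X))" "h \<in> extensional (obj (ucat X) \<times> obj (ucat X))"
      using d by (simp_all add: monoidal_functor_def Let_def)
    have "weak_family X Y F (component ?\<rho>)"
      using weak_family_cong[of X "component ?\<rho>" r Y F] component_mk_cell X.dd hcell_weak_family by blast
    then have "(two_map F, ?\<rho>) \<in> dd_weak_maps X Y"
      unfolding weak_maps using shape_mk_cell by blast
    moreover have "component ?\<rho> [Tens (Gen () () a) (Gen () () b)] = v (a, b) \<and>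
        component ?\<rho> [Gen () () a, Gen () () b] = h (a, b)"
      if "a \<in> obj (ucat X)" "b \<in> obj (ucat X)" for a b
    proof -
      note o = that that[THEN functor_obj[OF F_functor]]
      have g: "formal_obj X (Gen () () a)" "formal_obj X (Gen () () b)"
        using that by (auto intro: formal1.gen)
      \<comment> \<open>By \<open>r_single\<close> the factor of the last generator is an identity,
        so v or h appears composed with a tensor of identities.\<close>
      then show ?thesis
        using o r_single[OF formal1.tens[OF g]] r_single[OF g(2)] v.phi_hom[OF that] h.phi_hom[OF that]
        by (simp add: component_mk_cell formal1.tens[OF g] Y.v.ten1_ide Y.h.ten1_ide Y.v.ide_right X.hten0_unit
            del: hcell.simps(2)) (simp add: Y.h.ten1_ide Y.v.ide_right X.hten0_unit)
    qed
    then have "dd_constraints X (two_map F, ?\<rho>) = y"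
      unfolding dd_constraints_two_map yy using ext
      by (auto simp: component_mk_cell fun_eq_iff extensional_def)
    ultimately show "y \<in> dd_constraints X ` dd_weak_maps X Y" by force
  qed
qed

end
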